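(* Let $m>1$, $\alpha\in(0,1)$, let $\mathbf X$ be an $\alpha$-rough path (over $\mathbb R^d$) and let $\sigma\in C^N(\mathbb R^k,\mathbb R^{k\times d})$, $y_0\in\mathbb R^k$. Let $\mathbf Y$ be a solution on $[0,1]$ of $$dY(t)=-|Y(t)|^{m-1}Y(t)\,dt+\sigma(Y(t))\,dX(t),\qquad Y(0)=y_0,$$ in the sense defined in the context, and let $Y(t)=\langle \mathbf 1,\mathbf Y_t\rangle\in\mathbb R^k$. (1) If $\sigma$ satisfies the bounded-coefficients assumption, then for all $t\in[0,1]$ $$|Y(t)|\le C\max\Big\{\min\{t^{-\frac1{m-1}},|y_0|\},\ \max_{h\in\mathring{\mathcal T}_{\le N}}[\mathbf X:h]^{\frac1{(m-1)\alpha|h|}},\ 1\Big\}.$$ (2) If $\sigma$ satisfies the polynomial-growth assumption with an exponent $\gamma$ such that $1\le\gamma<(m-1)\alpha+1$, then for all $t\in[0,1]$ $$|Y(t)|\le C\max\Big\{\min\{t^{-\frac1{m-1}},|y_0|\},\ \max_{h\in\mathring{\mathcal T}_{\le N}}[\mathbf X:h]^{\frac1{((m-1)\alpha-\gamma+1)|h|}},\ 1\Big\}.$$ In both statements, $C<\infty$ denotes a constant that depends on $d,k,m,\alpha$ and $C_\sigma$.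
   Context: Fix integers $d,k\ge 1$ and $\alpha\in(0,1)$; $N$ is the unique natural number with $N\alpha\le 1<(N+1)\alpha$. $[d]=\{1,\dots,d\}$, $\langle x\rangle=(1+|x|^2)^{1/2}$ for $x\in\mathbb R^k$. The columns of $\sigma$ are $\sigma_\mu:\mathbb R^k\to\mathbb R^k$, $\mu\in[d]$. Convention: $t^{-1/(m-1)}=+\infty$ for $t=0$. Bounded-coefficients assumption: $\sup_{x\in\mathbb R^k}|\partial^\beta\sigma(x)|\le C_\sigma$ for every multi-index $\beta\in\mathbb N^k$ with $|\beta|\le N$, for some constant $C_\sigma<\infty$. Polynomial-growth assumption with exponent $\gamma>0$: $|\partial^\beta\sigma(x)|\le C_\sigma\langle x\rangle^{\gamma-|\beta|}$ for all $x\in\mathbb R^k$ and all $|\beta|\le N$, for some constant $C_\sigma<\infty$. Trees and forests. Consider finite rooted trees (non-planar) with vertices decorated by elements of $[d]$. A forest is a finite, possibly empty, multiset of such trees, written as a commutative product; $\mathbf 1$ is the empty forest. For a forest $f$ and $\mu\in[d]$, $[f]_\mu$ is the tree obtained by joining the roots of all trees of $f$ to a new root decorated by $\mu$; every tree is uniquely of this form. $|f|$ is the number of vertices. $\mathring{\mathcal T}_{\le j}$ is the set of trees $h$ with $|h|\le j$, $\mathcal T_{\le j}=\mathring{\mathcal T}_{\le j}\cup\{\mathbf 1\}$, $\mathcal F$ is the set of forests all of whose trees lie in $\mathring{\mathcal T}_{\le N}$, and $\mathcal F_{\le j}=\{f\in\mathcal F:|f|\le j\}$. $\mathrm{Span}(\mathcal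 F)$ is the free real vector space on $\mathcal F$, a commutative unital algebra under the forest product; $\langle\cdot,\cdot\rangle$ denotes the inner product making forests orthonormal, its tensor version, and duality pairings. $P_{\le n}$ is the linear projection annihilating forests $f$ with $|f|>n$ and fixing the others. Coproduct. $\Delta$ is the multiplicative linear map with $\Delta\mathbf 1=\mathbf 1\otimes\mathbf 1$ and $\Delta[f]_\mu=[f]_\mu\otimes\mathbf 1+(\mathrm{id}\otimes[\,\cdot\,]_\mu)\Delta f$. Rough paths. An $\alpha$-rough path is a map $\mathbf X:[0,1]^2\to\mathrm{Char}$, $(s,t)\mapsto\mathbf X_{s,t}$, where $\mathrm{Char}$ is the set of unital algebra homomorphisms $\mathrm{Span}(\mathcal F)\to\mathbb R$, such that $\langle\mathbf X_{s,u}\otimes\mathbf X_{u,t},\Delta h\rangle=\langle\mathbf X_{s,t},h\rangle$ for all $s,u,t\in[0,1]$, $h\in\mathcal T_{\le N}$, and $[\mathbf X:h]<\infty$ for all $h\in\mathring{\mathcal T}_{\le N}$, where for $f\in\mathcal F$ $$[\mathbf X:f]=\sup_{s\ne t\in[0,1]}\frac{|\langle\mathbf X_{s,t},f\rangle|}{|s-t|^{\alpha|f|}}.$$ Controlled paths. A tree path (resp. forest path) is a map $\mathbf Y:[0,1]\to\mathrm{Span}(\mathcal T_{\le N-1})^k$ (resp. $\mathrm{Span}(\mathcal F_{\le N-1})^k$); operations act componentwise. Write $Y_s=\langle\mathbf 1,\mathbf Y_s\rangle\in\mathbb R^k$ and $\mathbf Y_s=Y_s\mathbf 1+\delta\mathbf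 Y_s$. For $f\in\mathcal F_{\le N-1}$ let $R^{\mathbf Y,f}_{s,t}=\langle f,\mathbf Y_t\rangle-\langle\mathbf X_{s,t}\otimes f,\Delta\mathbf Y_s\rangle\in\mathbb R^k$. $\mathbf Y$ is $\mathbf X$-controlled if for all $f\in\mathcal F_{\le N-1}$ $$\sup_{s,t\in[0,1],\,0<|s-t|<1}\frac{|R^{\mathbf Y,f}_{s,t}|}{|t-s|^{(N-|f|)\alpha}}<\infty.$$ For a tree path $\mathbf Y$ and $g:\mathbb R^k\to\mathbb R^k$ of class $C^{N-1}$, $g(\mathbf Y)$ is the forest path $$g(\mathbf Y)_s=g(Y_s)\mathbf 1+P_{\le N-1}\sum_{p=1}^{N-1}\frac1{p!}\sum_{h_1,\dots,h_p\in\mathring{\mathcal T}_{\le N-1}}D^pg(Y_s)[\langle\mathbf Y_s,h_1\rangle,\dots,\langle\mathbf Y_s,h_p\rangle]\;h_1\cdots h_p .$$ Integration and solutions. For an $\mathbf X$-controlled forest path $\mathbf U$ and $\mu\in[d]$, $\int_s^t\mathbf U_r\,d\mathbf X^{(\mu)}_r\in\mathbb R^k$ is the limit, as the mesh of partitions of $[s,t]$ tends to $0$, of $\sum_n\Xi_{s_n,s_{n+1}}$, where $\Xi_{s,t}=\sum_{f\in\mathcal F_{\le N-1}}\langle f,\mathbf U_s\rangle\langle\mathbf X_{s,t},[f]_\mu\rangle$. A solution of the equation is an $\mathbf X$-controlled tree path $\mathbf Y$ such that for all $s\in[0,1]$ $$\mathbf Y_s=y_0\mathbf 1-\Big(\int_0^s|Y_r|^{m-1}Y_r\,dr\Big)\mathbf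 1+\mathbf Z_s,\qquad \mathbf Z_s=\sum_{\mu\in[d]}\Big(\int_0^s\sigma_\mu(\mathbf Y)_r\,d\mathbf X^{(\mu)}_r\Big)\mathbf 1+\sum_{\mu\in[d]}\sum_{f\in\mathcal F_{\le N-2}}\langle f,\sigma_\mu(\mathbf Y)_s\rangle[f]_\mu .$$
   Formalization: In part (2) the constant C may also depend on the exponent γ; a constant depending only on d, k, m, α and C_σ cannot exist, since solutions can become unbounded as γ approaches (m−1)α+1 while the right-hand maximum stays equal to 1. *)

theory Defs
  imports "HOL-Analysis.Analysis" "HOL-Library.Multiset" "HOL-Library.Poly_Mapping"
    "HOL-Library.Product_Plus"
begin

section \<open>Decorated trees and forests\<close>

datatype 'd rtree = Node 'd "'d rtree multiset"

type_synonym 'd forest = "'d rtree multiset"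

primrec tree_size :: "'d rtree \<Rightarrow> nat" where
  "tree_size (Node \<mu> f) = Suc (sum_mset (image_mset tree_size f))"

definition forest_size :: "'d forest \<Rightarrow> nat" where
  "forest_size f = sum_mset (image_mset tree_size f)"

definition graft :: "'d \<Rightarrow> 'd forest \<Rightarrow> 'd forest" where
  "graft \<mu> f = {#Node \<mu> f#}"

definition trees :: "nat \<Rightarrow> 'd rtree set" where
  "trees j = {h. tree_size h \<le> j}"

definition trees1 :: "nat \<Rightarrow> 'd forest set" where
  "trees1 j = insert {#} ((\<lambda>h. {#h#}) ` trees j)"

definition forests :: "nat \<Rightarrow> 'd forest set" where
  "forests N = {f. set_mset f \<subseteq> trees N}"

text \<open>The bound is an integer so that the set is empty for negative bounds; the bound
  \<open>N - 2\<close> is negative when \<open>N = 1\<close>.\<close>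

definition forests_upto :: "nat \<Rightarrow> int \<Rightarrow> 'd forest set" where
  "forests_upto N j = {f \<in> forests N. int (forest_size f) \<le> j}"

lemma forest_size_simps [simp]:
  "forest_size {#} = 0"
  "forest_size (add_mset h f) = tree_size h + forest_size f"
  "tree_size (Node \<mu> f) = Suc (forest_size f)"
  by (simp_all add: forest_size_def)

lemma tree_size_pos: "0 < tree_size h"
  by (cases h) simp

lemma size_le_forest_size: "size f \<le> forest_size f"
proof (induction f)
  case (add h f)
  then show ?case using tree_size_pos[of h] by simp
qed simp

lemma tree_size_le_forest_size: "h \<in># f \<Longrightarrow> tree_size h \<le> forest_size f"
  by (metis forest_size_simps(2) le_add1 multi_member_split)

lemma finite_trees [simp]: "finite (trees n :: ('d::finite) rtree set)"
proof (induction n)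
  case 0
  have "trees 0 = ({} :: 'd rtree set)"
    using tree_size_pos by (auto simp: trees_def)
  then show ?case by simp
next
  case (Suc n)
  let ?M = "(\<lambda>xs. mset xs) ` {xs. set xs \<subseteq> (trees n :: 'd rtree set) \<and> length xs \<le> n}"
  have "trees (Suc n) \<subseteq> (\<lambda>(\<mu>, f). Node \<mu> f) ` (UNIV \<times> ?M)"
  proof
    fix h :: "'d rtree" assume h: "h \<in> trees (Suc n)"
    obtain \<mu> f where hf: "h = Node \<mu> f" by (cases h)
    have fs: "forest_size f \<le> n" using h by (simp add: hf trees_def forest_size_def)
    obtain xs where xs: "f = mset xs" using ex_mset by metis
    have "set xs \<subseteq> trees n"
      using tree_size_le_forest_size[of _ f] fs xs by (fastforce simp: trees_def)
    moreover have "length xs \<le> n" using size_le_forest_size[of f] fs xs by simp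
    ultimately have "f \<in> ?M" using xs by blast
    then show "h \<in> (\<lambda>(\<mu>, f). Node \<mu> f) ` (UNIV \<times> ?M)" using hf by blast
  qed
  moreover have "finite ((\<lambda>(\<mu>, f). Node \<mu> f) ` ((UNIV :: 'd set) \<times> ?M))"
    by (intro finite_imageI finite_cartesian_product finite_lists_length_le[OF Suc] finite)
  ultimately show ?case by (rule finite_subset)
qed

lemma finite_forests_upto [simp]: "finite (forests_upto N j :: ('d::finite) forest set)"
proof -
  have "forests_upto N j \<subseteq> mset ` {xs. set xs \<subseteq> (trees N :: 'd rtree set) \<and> length xs \<le> nat j}"
  proof
    fix f :: "'d forest" assume f: "f \<in> forests_upto N j"
    obtain xs where xs: "f = mset xs" using ex_mset by metis
    have "length xs \<le> nat j"
      using size_le_forest_size[of f] f xs unfolding forests_upto_def by simp linarith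
    moreover have "set xs \<subseteq> trees N" using f xs by (simp add: forests_upto_def forests_def)
    ultimately show "f \<in> mset ` {xs. set xs \<subseteq> trees N \<and> length xs \<le> nat j}"
      using xs by blast
  qed
  then show ?thesis by (rule finite_subset) (simp add: finite_lists_length_le)
qed

section \<open>The forest algebra and the coproduct\<close>

text \<open>The free vector space on all forests is \<open>'d forest \<Rightarrow>\<^sub>0 real\<close>. Since multiset union is
  the addition of \<open>'d forest\<close>, the convolution product of \<open>HOL-Library.Poly_Mapping\<close> is
  the forest product, and likewise the convolution product on
  \<open>('d forest \<times> 'd forest) \<Rightarrow>\<^sub>0 real\<close> is the product of the tensor square.\<close>

type_synonym 'd falg = "'d forest \<Rightarrow>\<^sub>0 real"
type_synonym 'd ftensor = "('d forest \<times> 'd forest) \<Rightarrow>\<^sub>0 real"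

abbreviation basis :: "'b \<Rightarrow> 'b \<Rightarrow>\<^sub>0 real" where
  "basis b \<equiv> Poly_Mapping.single b 1"

definition scal :: "real \<Rightarrow> ('b \<Rightarrow>\<^sub>0 real) \<Rightarrow> ('b \<Rightarrow>\<^sub>0 real)" where
  "scal c x = Poly_Mapping.map ((*) c) x"

definition lin_ext :: "('b \<Rightarrow> ('c \<Rightarrow>\<^sub>0 real)) \<Rightarrow> ('b \<Rightarrow>\<^sub>0 real) \<Rightarrow> ('c \<Rightarrow>\<^sub>0 real)" where
  "lin_ext \<phi> x = (\<Sum>b \<in> Poly_Mapping.keys x. scal (Poly_Mapping.lookup x b) (\<phi> b))"

definition fspan :: "'b set \<Rightarrow> ('b \<Rightarrow>\<^sub>0 real) set" where
  "fspan A = {x. Poly_Mapping.keys x \<subseteq> A}"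

definition proj_le :: "nat \<Rightarrow> 'd falg \<Rightarrow> 'd falg" where
  "proj_le n = lin_ext (\<lambda>f. if forest_size f \<le> n then basis f else 0)"

primrec tree_coproduct :: "'d rtree \<Rightarrow> 'd ftensor" where
  "tree_coproduct (Node \<mu> f) = basis (graft \<mu> f, {#})
     + lin_ext (\<lambda>(g, h). basis (g, graft \<mu> h)) (prod_mset (image_mset tree_coproduct f))"

definition coproduct :: "'d falg \<Rightarrow> 'd ftensor" where
  "coproduct = lin_ext (\<lambda>f. prod_mset (image_mset tree_coproduct f))"

lemma scal_1 [simp]: "scal 1 x = x"
  unfolding scal_def by (rule poly_mapping_eqI) (simp add: Poly_Mapping.map.rep_eq when_def)

lemma lin_ext_basis [simp]: "lin_ext \<phi> (basis b) = \<phi> b"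
  by (simp add: lin_ext_def)

lemma coproduct_empty: "coproduct (basis {#}) = basis ({#}, {#})"
  by (simp add: coproduct_def flip: single_one zero_prod_def)

lemma coproduct_mult: "coproduct (basis f * basis g) = coproduct (basis f) * coproduct (basis g)"
  by (simp add: coproduct_def mult_single)

lemma coproduct_graft:
  "coproduct (basis (graft \<mu> f)) = basis (graft \<mu> f, {#})
     + lin_ext (\<lambda>(g, h). basis (g, graft \<mu> h)) (coproduct (basis f))"
  by (simp add: coproduct_def graft_def)

text \<open>The pairing of a tensor product of two linear functionals with an element of the
  tensor square.\<close>

definition tensor_pair :: "('d falg \<Rightarrow> real) \<Rightarrow> ('d falg \<Rightarrow> real) \<Rightarrow> 'd ftensor \<Rightarrow> real" where
  "tensor_pair \<phi> \<psi> z = (\<Sum>(f, g) \<in> Poly_Mapping.keys z.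
     Poly_Mapping.lookup z (f, g) * \<phi> (basis f) * \<psi> (basis g))"

section \<open>Rough paths\<close>

definition is_character :: "nat \<Rightarrow> ('d falg \<Rightarrow> real) \<Rightarrow> bool" where
  "is_character N \<xi> \<longleftrightarrow>
     \<xi> 1 = 1 \<and>
     (\<forall>x \<in> fspan (forests N). \<forall>y \<in> fspan (forests N).
        \<xi> (x + y) = \<xi> x + \<xi> y \<and> \<xi> (x * y) = \<xi> x * \<xi> y) \<and>
     (\<forall>c. \<forall>x \<in> fspan (forests N). \<xi> (scal c x) = c * \<xi> x)"

type_synonym 'd rough_map = "real \<Rightarrow> real \<Rightarrow> 'd falg \<Rightarrow> real"

definition rp_quotients :: "real \<Rightarrow> 'd rough_map \<Rightarrow> 'd forest \<Rightarrow> real set" where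
  "rp_quotients \<alpha> X f =
     {\<bar>X s t (basis f)\<bar> / \<bar>s - t\<bar> powr (\<alpha> * real (forest_size f)) | s t.
        s \<in> {0..1} \<and> t \<in> {0..1} \<and> s \<noteq> t}"

definition rp_seminorm :: "real \<Rightarrow> 'd rough_map \<Rightarrow> 'd forest \<Rightarrow> real" where
  "rp_seminorm \<alpha> X f = Sup (rp_quotients \<alpha> X f)"

definition rough_path :: "real \<Rightarrow> nat \<Rightarrow> 'd rough_map \<Rightarrow> bool" where
  "rough_path \<alpha> N X \<longleftrightarrow>
     (\<forall>s \<in> {0..1}. \<forall>t \<in> {0..1}. is_character N (X s t)) \<and>
     (\<forall>s \<in> {0..1}. \<forall>u \<in> {0..1}. \<forall>t \<in> {0..1}. \<forall>h \<in> trees1 N.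
        tensor_pair (X s u) (X u t) (coproduct (basis h)) = X s t (basis h)) \<and>
     (\<forall>h \<in> trees N. bdd_above (rp_quotients \<alpha> X {#h#}))"

section \<open>Controlled paths\<close>

type_synonym ('d, 'k) fpath = "real \<Rightarrow> ('d falg) ^ 'k"

definition coef :: "'d forest \<Rightarrow> ('d falg) ^ 'k \<Rightarrow> real ^ 'k" where
  "coef f y = (\<chi> i. Poly_Mapping.lookup (y $ i) f)"

definition vsingle :: "real ^ 'k \<Rightarrow> 'd forest \<Rightarrow> ('d falg) ^ 'k" where
  "vsingle v f = (\<chi> i. Poly_Mapping.single f (v $ i))"

definition tree_path :: "nat \<Rightarrow> ('d, 'k::finite) fpath \<Rightarrow> bool" where
  "tree_path N Y \<longleftrightarrow> (\<forall>t \<in> {0..1}. \<forall>i. Y t $ i \<in> fspan (trees1 (N - 1)))"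

definition remainder :: "'d rough_map \<Rightarrow> ('d, 'k::finite) fpath \<Rightarrow> 'd forest \<Rightarrow>
    real \<Rightarrow> real \<Rightarrow> real ^ 'k" where
  "remainder X Y f s t = coef f (Y t)
     - (\<chi> i. tensor_pair (X s t) (\<lambda>x. Poly_Mapping.lookup x f) (coproduct (Y s $ i)))"

definition controlled :: "real \<Rightarrow> nat \<Rightarrow> 'd rough_map \<Rightarrow> ('d, 'k::finite) fpath \<Rightarrow> bool" where
  "controlled \<alpha> N X Y \<longleftrightarrow> (\<forall>f \<in> forests_upto N (int N - 1).
     bdd_above {norm (remainder X Y f s t)
                  / \<bar>t - s\<bar> powr ((real N - real (forest_size f)) * \<alpha>) | s t.
                s \<in> {0..1} \<and> t \<in> {0..1} \<and> 0 < \<bar>s - t\<bar> \<and> \<bar>s - t\<bar> < 1})"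

section \<open>Differentiability and composition with a function\<close>

text \<open>\<open>iter_deriv g [v\<^sub>1, \<dots>, v\<^sub>p] x\<close> is \<open>D\<^sup>p g(x)[v\<^sub>1, \<dots>, v\<^sub>p]\<close>.\<close>

primrec iter_deriv :: "('a::real_normed_vector \<Rightarrow> 'b::real_normed_vector) \<Rightarrow> 'a list \<Rightarrow> 'a \<Rightarrow> 'b"
where
  "iter_deriv g [] = g"
| "iter_deriv g (v # vs) = (\<lambda>x. frechet_derivative (iter_deriv g vs) (at x) v)"

text \<open>Class \<open>C\<^sup>n\<close> on the whole space. In finite dimension, continuity of the derivative in
  operator norm is continuity of each directional derivative.\<close>

primrec C_class :: "nat \<Rightarrow> ('a::euclidean_space \<Rightarrow> 'b::real_normed_vector) \<Rightarrow> bool" where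
  "C_class 0 g \<longleftrightarrow> continuous_on UNIV g"
| "C_class (Suc n) g \<longleftrightarrow>
     (\<forall>x. g differentiable (at x)) \<and> (\<forall>v. C_class n (\<lambda>x. frechet_derivative g (at x) v))"

text \<open>A multi-index \<open>\<beta>\<close> is encoded by any word \<open>w\<close> in which the coordinate \<open>i\<close> occurs
  \<open>\<beta>\<^sub>i\<close> times, so \<open>\<bar>\<beta>\<bar> = length w\<close>. For functions of class \<open>C\<^sup>n\<close> and words of length
  at most \<open>n\<close> the order of the letters is irrelevant.\<close>

definition partial :: "(real ^ 'k \<Rightarrow> 'b::real_normed_vector) \<Rightarrow> 'k::finite list \<Rightarrow> real ^ 'k \<Rightarrow> 'b" where
  "partial g w = iter_deriv g (map (\<lambda>i. axis i 1) w)"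

definition compose_path :: "nat \<Rightarrow> (real ^ 'k \<Rightarrow> real ^ 'k) \<Rightarrow> ('d::finite, 'k::finite) fpath \<Rightarrow>
    ('d, 'k) fpath" where
  "compose_path N g Y s =
     vsingle (g (coef {#} (Y s))) {#}
     + (\<chi> i. proj_le (N - 1)
         ((\<Sum>p = 1..N - 1. \<Sum>hs \<in> {hs. length hs = p \<and> set hs \<subseteq> trees (N - 1)}.
             vsingle ((1 / fact p) *\<^sub>R
               iter_deriv g (map (\<lambda>h. coef {#h#} (Y s)) hs) (coef {#} (Y s))) (mset hs)) $ i))"

section \<open>Integration and solutions\<close>

definition germ :: "nat \<Rightarrow> 'd rough_map \<Rightarrow> ('d::finite, 'k::finite) fpath \<Rightarrow> 'd \<Rightarrow>
    real \<Rightarrow> real \<Rightarrow> real ^ 'k" where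
  "germ N X U \<mu> s t = (\<Sum>f \<in> forests_upto N (int N - 1). X s t (basis (graft \<mu> f)) *\<^sub>R coef f (U s))"

definition has_rough_integral :: "nat \<Rightarrow> 'd rough_map \<Rightarrow> ('d::finite, 'k::finite) fpath \<Rightarrow> 'd \<Rightarrow>
    real \<Rightarrow> real \<Rightarrow> real ^ 'k \<Rightarrow> bool" where
  "has_rough_integral N X U \<mu> s t I \<longleftrightarrow>
     (\<forall>\<epsilon> > 0. \<exists>\<delta> > 0. \<forall>(n::nat) (r :: nat \<Rightarrow> real).
        r 0 = s \<and> r n = t \<and> (\<forall>i < n. r i < r (Suc i) \<and> r (Suc i) - r i < \<delta>) \<longrightarrow>
        norm ((\<Sum>i < n. germ N X U \<mu> (r i) (r (Suc i))) - I) < \<epsilon>)"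

text \<open>The functions \<open>J \<mu>\<close> are the rough integrals of the columns, which are required to
  exist.\<close>

definition is_solution :: "real \<Rightarrow> real \<Rightarrow> nat \<Rightarrow> 'd rough_map \<Rightarrow> (real ^ 'k \<Rightarrow> real ^ 'd ^ 'k) \<Rightarrow>
    real ^ 'k \<Rightarrow> ('d::finite, 'k::finite) fpath \<Rightarrow> bool" where
  "is_solution m \<alpha> N X \<sigma> y0 Y \<longleftrightarrow>
     tree_path N Y \<and> controlled \<alpha> N X Y \<and>
     (let \<sigma>Y = (\<lambda>\<mu>. compose_path N (\<lambda>x. column \<mu> (\<sigma> x)) Y) in
      \<exists>J :: 'd \<Rightarrow> real \<Rightarrow> real ^ 'k.
        (\<forall>\<mu>. \<forall>s \<in> {0..1}. has_rough_integral N X (\<sigma>Y \<mu>) \<mu> 0 s (J \<mu> s)) \<and>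
        (\<forall>s \<in> {0..1}. Y s =
           vsingle y0 {#}
           - vsingle (integral {0..s} (\<lambda>r. norm (coef {#} (Y r)) powr (m - 1) *\<^sub>R coef {#} (Y r))) {#}
           + ((\<Sum>\<mu> \<in> UNIV. vsingle (J \<mu> s) {#})
              + (\<Sum>\<mu> \<in> UNIV. \<Sum>f \<in> forests_upto N (int N - 2).
                   vsingle (coef f (\<sigma>Y \<mu> s)) (graft \<mu> f)))))"

section \<open>Assumptions on the coefficients and the shape of the bound\<close>

definition bounded_coeffs :: "nat \<Rightarrow> real \<Rightarrow> (real ^ 'k::finite \<Rightarrow> real ^ 'd::finite ^ 'k) \<Rightarrow> bool" where
  "bounded_coeffs N C\<^sub>\<sigma> \<sigma> \<longleftrightarrow> (\<forall>w. length w \<le> N \<longrightarrow> (\<forall>x. norm (partial \<sigma> w x) \<le> C\<^sub>\<sigma>))"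

definition poly_growth_coeffs ::
    "nat \<Rightarrow> real \<Rightarrow> real \<Rightarrow> (real ^ 'k::finite \<Rightarrow> real ^ 'd::finite ^ 'k) \<Rightarrow> bool" where
  "poly_growth_coeffs N \<gamma> C\<^sub>\<sigma> \<sigma> \<longleftrightarrow> (\<forall>w. length w \<le> N \<longrightarrow>
     (\<forall>x. norm (partial \<sigma> w x) \<le> C\<^sub>\<sigma> * sqrt (1 + (norm x)\<^sup>2) powr (\<gamma> - real (length w))))"

text \<open>\<open>min {t\<^bsup>-1/(m-1)\<^esup>, a}\<close> with the convention that the power is infinite at \<open>t = 0\<close>.\<close>

definition damping :: "real \<Rightarrow> real \<Rightarrow> real \<Rightarrow> real" where
  "damping m t a = (if t = 0 then a else min (t powr (- 1 / (m - 1))) a)"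

end

(*
  For a forest path U = sigma_mu(Y) the translation Gamma = (X_{s,t} (x) id) Delta is an algebra
  homomorphism, and sigma_mu(Y) is, up to truncation, a Taylor polynomial evaluated in the
  forest algebra.  With the submultiplicative norm sum_f |x_f| w^|f|, w = rho |t-s|^alpha, the
  controlled remainder U_t - Gamma U_s therefore becomes a Taylor remainder, bounded by the
  component of Y_t - Gamma Y_s at the empty forest and by w^N.  Sewing turns this into a bound
  for that component which closes on a time interval so short that the noise is small.

  If |Y(t0)| = v exceeds the claimed level, the noise is negligible against the damping on an
  interval of length H of order v^(-m) (bounded coefficients) or v^(1-m) (polynomial growth), so
  |Y| at most doubles and |Y|^(1-m) grows by at least kappa H.  Adding up these gains gives
  |Y(t)|^(1-m) >= kappa t until the level is reached, after which Y cannot climb again.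
*)

theory Submission
  imports Defs
begin

text \<open>Two circularities shape the argument. The tree part of the remainder of \<open>Y\<close>
  is a graft of the remainder of \<sigma>(Y), which in turn is estimated through the remainder of
  \<open>Y\<close>. The graft contributes a factor \<open>w\<close>, so the loop has gain
  proportional to \<tau> = L \<theta> w and is absorbed once \<tau> is small. Moreover,
  controlledness supplies a finite but unquantified constant, while the final constant must not
  depend on the solution. Sewing is therefore used as an improvement map: a bound Q for the sewing
  error yields Q / 2 + c, and iteration forgets the initial value.

  Both growth regimes share one set of estimates with two parameters: \<sigma> has size L and varies
  on the length 1 / \<theta>. Lengths are measured in units of 1 / \<theta>, time as a fraction of
  the current interval and noise by \<tau>, which keeps the constants free of L and \<theta>. The
  bounds on \<sigma> are needed only in a ball of radius 1 / (4 \<theta>) around the current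
  position; a first-exit argument shows that the path stays there during a step.\<close>

abbreviation lookup :: "('b \<Rightarrow>\<^sub>0 'c::zero) \<Rightarrow> 'b \<Rightarrow> 'c" where
  "lookup \<equiv> Poly_Mapping.lookup"

abbreviation keys :: "('b \<Rightarrow>\<^sub>0 'c::zero) \<Rightarrow> 'b set" where
  "keys \<equiv> Poly_Mapping.keys"

section \<open>Linear extensions and weighted norms on the forest algebra\<close>

lemma lookup_scal [simp]: "lookup (scal c x) b = c * lookup x b"
  unfolding scal_def by (simp add: Poly_Mapping.map.rep_eq when_def)

lemma scal_eq_mult: "scal c x = Poly_Mapping.single 0 c * (x :: 'b::monoid_add \<Rightarrow>\<^sub>0 real)"
  by (simp add: scal_def mult_map_scale_conv_mult)

lemma scal_single [simp]: "scal c (Poly_Mapping.single b d) = Poly_Mapping.single b (c * d)"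
  by (rule poly_mapping_eqI) (simp add: lookup_single when_def)

lemma scal_add: "scal c (x + y) = scal c x + scal c y"
  by (rule poly_mapping_eqI) (simp add: lookup_add algebra_simps)

lemma scal_diff: "scal c (x - y) = scal c x - scal c y"
  by (rule poly_mapping_eqI) (simp add: lookup_minus algebra_simps)

lemma scal_add_left: "scal (c + d) x = scal c x + scal d x"
  by (rule poly_mapping_eqI) (simp add: lookup_add algebra_simps)

lemma scal_sum: "scal c (sum f A) = (\<Sum>i\<in>A. scal c (f i))"
  by (rule poly_mapping_eqI) (simp add: lookup_sum sum_distrib_left)

lemma scal_sum_left: "scal (sum c A) x = (\<Sum>i\<in>A. scal (c i) x)"
  by (rule poly_mapping_eqI) (simp add: lookup_sum sum_distrib_right)

lemma scal_scal [simp]: "scal c (scal d x) = scal (c * d) x"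
  by (rule poly_mapping_eqI) simp

lemma scal_0 [simp]: "scal 0 x = 0" "scal c 0 = 0"
  by (rule poly_mapping_eqI, simp)+

lemma scal_mult_left: "scal c x * y = scal c (x * (y :: 'b::monoid_add \<Rightarrow>\<^sub>0 real))"
  by (simp add: scal_eq_mult mult.assoc)

lemma scal_mult_right: "x * scal c y = scal c (x * (y :: 'b::comm_monoid_add \<Rightarrow>\<^sub>0 real))"
  by (simp add: scal_eq_mult mult.left_commute)

lemma poly_mapping_expand: "x = (\<Sum>b\<in>keys x. Poly_Mapping.single b (lookup x b))"
proof (rule poly_mapping_eqI)
  fix k
  have "(\<Sum>b\<in>keys x. lookup x b when b = k) = (lookup x k when k \<in> keys x)"
    by (simp add: when_def sum.delta)
  then show "lookup x k = lookup (\<Sum>b\<in>keys x. Poly_Mapping.single b (lookup x b)) k"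
    by (simp add: lookup_sum lookup_single when_def in_keys_iff)
qed

lemma lin_ext_eq_sum:
  assumes "finite S" "keys x \<subseteq> S"
  shows "lin_ext \<phi> x = (\<Sum>b\<in>S. scal (lookup x b) (\<phi> b))"
  unfolding lin_ext_def using assms
  by (intro sum.mono_neutral_left) (auto simp: in_keys_iff)

lemma lin_ext_0 [simp]: "lin_ext \<phi> 0 = 0"
  by (simp add: lin_ext_def)

lemma lin_ext_single [simp]: "lin_ext \<phi> (Poly_Mapping.single b c) = scal c (\<phi> b)"
  by (simp add: lin_ext_eq_sum[of "{b}"])

lemma lin_ext_add: "lin_ext \<phi> (x + y) = lin_ext \<phi> x + lin_ext \<phi> y"
proof -
  let ?S = "keys x \<union> keys y"
  have "keys (x + y) \<subseteq> ?S" by (rule Poly_Mapping.keys_add)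
  then show ?thesis
    by (simp add: lin_ext_eq_sum[of ?S] lookup_add scal_add_left sum.distrib)
qed

lemma lin_ext_scal: "lin_ext \<phi> (scal c x) = scal c (lin_ext \<phi> x)"
proof -
  have "keys (scal c x) \<subseteq> keys x" by (auto simp: in_keys_iff)
  then show ?thesis
    by (simp add: lin_ext_eq_sum[of "keys x"] scal_sum)
qed

lemma lin_ext_diff: "lin_ext \<phi> (x - y) = lin_ext \<phi> x - lin_ext \<phi> y"
  by (metis lin_ext_add add_diff_cancel_right' diff_add_cancel)

lemma lin_ext_sum: "lin_ext \<phi> (sum f A) = (\<Sum>i\<in>A. lin_ext \<phi> (f i))"
  by (induction A rule: infinite_finite_induct) (simp_all add: lin_ext_add)

text \<open>Addition of indices is the product of basis elements, so multiplicativity on the basis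
  passes to the linear extension. Both the coproduct and the translation become algebra
  homomorphisms in this way.\<close>

lemma lin_ext_mult:
  fixes \<phi> :: "'b::monoid_add \<Rightarrow> ('c::comm_monoid_add \<Rightarrow>\<^sub>0 real)"
  assumes "\<And>a b. \<phi> (a + b) = \<phi> a * \<phi> b"
  shows "lin_ext \<phi> (x * y) = lin_ext \<phi> x * lin_ext \<phi> y"
proof -
  have "x * y = (\<Sum>a\<in>keys x. \<Sum>b\<in>keys y. Poly_Mapping.single (a + b) (lookup x a * lookup y b))"
    by (subst poly_mapping_expand[of x], subst poly_mapping_expand[of y])
      (simp add: sum_product mult_single)
  then have "lin_ext \<phi> (x * y)
      = (\<Sum>a\<in>keys x. \<Sum>b\<in>keys y. scal (lookup x a * lookup y b) (\<phi> a * \<phi> b))"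
    by (simp add: lin_ext_sum assms)
  also have "\<dots> = lin_ext \<phi> x * lin_ext \<phi> y"
    by (simp add: lin_ext_def sum_product scal_mult_left scal_mult_right mult.commute)
  finally show ?thesis .
qed

lemma keys_lin_ext: "keys (lin_ext \<phi> x) \<subseteq> (\<Union>b\<in>keys x. keys (\<phi> b))"
proof -
  have "keys (lin_ext \<phi> x) \<subseteq> (\<Union>b\<in>keys x. keys (scal (lookup x b) (\<phi> b)))"
    unfolding lin_ext_def by (rule Poly_Mapping.keys_sum)
  also have "\<dots> \<subseteq> (\<Union>b\<in>keys x. keys (\<phi> b))" by (auto simp: in_keys_iff)
  finally show ?thesis .
qed

section \<open>Linear functionals given by their values on a basis\<close>

definition pairing :: "('b \<Rightarrow> real) \<Rightarrow> ('b \<Rightarrow>\<^sub>0 real) \<Rightarrow> real" where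
  "pairing \<phi> x = (\<Sum>b\<in>keys x. lookup x b * \<phi> b)"

lemma pairing_eq_sum:
  assumes "finite S" "keys x \<subseteq> S"
  shows "pairing \<phi> x = (\<Sum>b\<in>S. lookup x b * \<phi> b)"
  unfolding pairing_def using assms
  by (intro sum.mono_neutral_left) (auto simp: in_keys_iff)

lemma pairing_single [simp]: "pairing \<phi> (Poly_Mapping.single b c) = c * \<phi> b"
  by (simp add: pairing_eq_sum[of "{b}"])

lemma pairing_0 [simp]: "pairing \<phi> 0 = 0"
  by (simp add: pairing_def)

lemma pairing_add: "pairing \<phi> (x + y) = pairing \<phi> x + pairing \<phi> y"
proof -
  let ?S = "keys x \<union> keys y"
  have "keys (x + y) \<subseteq> ?S" by (rule Poly_Mapping.keys_add)
  then show ?thesis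
    by (simp add: pairing_eq_sum[of ?S] lookup_add distrib_right sum.distrib)
qed

lemma pairing_diff: "pairing \<phi> (x - y) = pairing \<phi> x - pairing \<phi> y"
  by (metis pairing_add add_diff_cancel_right' diff_add_cancel)

lemma pairing_sum: "pairing \<phi> (sum f A) = (\<Sum>i\<in>A. pairing \<phi> (f i))"
  by (induction A rule: infinite_finite_induct) (simp_all add: pairing_add)

lemma pairing_scal: "pairing \<phi> (scal c x) = c * pairing \<phi> x"
proof -
  have "keys (scal c x) \<subseteq> keys x" by (auto simp: in_keys_iff)
  then show ?thesis
    by (simp add: pairing_eq_sum[of "keys x"] sum_distrib_left mult.assoc)
qed

lemma pairing_lin_ext: "pairing \<phi> (lin_ext \<psi> x) = pairing (\<lambda>b. pairing \<phi> (\<psi> b)) x"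
  by (simp add: lin_ext_def pairing_sum pairing_scal pairing_def[of _ x])

lemma pairing_lookup: "pairing (\<lambda>b. lookup (basis b) c) x = lookup x c"
proof -
  have "pairing (\<lambda>b. lookup (basis b) c) x = lookup (\<Sum>b\<in>keys x. Poly_Mapping.single b (lookup x b)) c"
    by (simp add: pairing_def lookup_sum lookup_single when_def if_distrib cong: if_cong)
  then show ?thesis by (simp flip: poly_mapping_expand)
qed

text \<open>The weight is a power of a single number because vertex counts add up under the forest
  product; this makes the norm submultiplicative. A functional bounded by
  \<open>w ^ forest_size f\<close> on forests has dual norm at most one.\<close>

definition wnorm :: "real \<Rightarrow> 'd falg \<Rightarrow> real" where
  "wnorm w x = (\<Sum>f\<in>keys x. \<bar>lookup x f\<bar> * w ^ forest_size f)"

lemma wnorm_eq_sum: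
  assumes "finite S" "keys x \<subseteq> S"
  shows "wnorm w x = (\<Sum>f\<in>S. \<bar>lookup x f\<bar> * w ^ forest_size f)"
  unfolding wnorm_def using assms
  by (intro sum.mono_neutral_left) (auto simp: in_keys_iff)

lemma wnorm_nonneg: "0 \<le> w \<Longrightarrow> 0 \<le> wnorm w x"
  by (simp add: wnorm_def sum_nonneg)

lemma wnorm_0 [simp]: "wnorm w 0 = 0"
  by (simp add: wnorm_def)

lemma wnorm_single [simp]: "wnorm w (Poly_Mapping.single f c) = \<bar>c\<bar> * w ^ forest_size f"
  by (simp add: wnorm_eq_sum[of "{f}"])

lemma wnorm_one [simp]: "wnorm w 1 = 1"
  by (simp flip: single_one zero_multiset_def)

lemma wnorm_minus [simp]: "wnorm w (- x) = wnorm w x"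
  by (simp add: wnorm_def)

lemma wnorm_add: assumes "0 \<le> w" shows "wnorm w (x + y) \<le> wnorm w x + wnorm w y"
proof -
  let ?S = "keys x \<union> keys y"
  have "keys (x + y) \<subseteq> ?S" by (rule Poly_Mapping.keys_add)
  then have "wnorm w (x + y) = (\<Sum>f\<in>?S. \<bar>lookup x f + lookup y f\<bar> * w ^ forest_size f)"
    by (simp add: wnorm_eq_sum[of ?S] lookup_add)
  also have "\<dots> \<le> (\<Sum>f\<in>?S. (\<bar>lookup x f\<bar> + \<bar>lookup y f\<bar>) * w ^ forest_size f)"
    using assms by (intro sum_mono mult_right_mono) auto
  also have "\<dots> = wnorm w x + wnorm w y"
    by (simp add: wnorm_eq_sum[of ?S] distrib_right sum.distrib)
  finally show ?thesis .
qed

lemma wnorm_diff: "0 \<le> w \<Longrightarrow> wnorm w (x - y) \<le> wnorm w x + wnorm w y"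
  using wnorm_add[of w x "- y"] by simp

lemma wnorm_sum: assumes "0 \<le> w" shows "wnorm w (sum f A) \<le> (\<Sum>i\<in>A. wnorm w (f i))"
proof (induction A rule: infinite_finite_induct)
  case (insert i A)
  then show ?case using wnorm_add[OF assms, of "f i" "sum f A"] by simp
qed simp_all

lemma wnorm_scal [simp]: "wnorm w (scal c x) = \<bar>c\<bar> * wnorm w x"
proof -
  have "keys (scal c x) \<subseteq> keys x" by (auto simp: in_keys_iff)
  then show ?thesis
    by (simp add: wnorm_eq_sum[of "keys x"] abs_mult sum_distrib_left mult.assoc)
qed

lemma forest_size_plus [simp]: "forest_size (f + g) = forest_size f + forest_size g"
  by (simp add: forest_size_def)

lemma wnorm_mult: assumes "0 \<le> w" shows "wnorm w (x * y) \<le> wnorm w x * wnorm w y"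
proof -
  have "x * y = (\<Sum>a\<in>keys x. \<Sum>b\<in>keys y. Poly_Mapping.single (a + b) (lookup x a * lookup y b))"
    by (subst poly_mapping_expand[of x], subst poly_mapping_expand[of y])
      (simp add: sum_product mult_single)
  then have "wnorm w (x * y) \<le> (\<Sum>a\<in>keys x. \<Sum>b\<in>keys y.
      wnorm w (Poly_Mapping.single (a + b) (lookup x a * lookup y b)))"
    using assms by (auto intro!: order_trans[OF wnorm_sum] sum_mono wnorm_sum)
  also have "\<dots> = wnorm w x * wnorm w y"
    by (simp add: wnorm_def[of w x] wnorm_def[of w y] sum_product abs_mult power_add mult_ac)
  finally show ?thesis .
qed

lemma wnorm_prod_list:
  assumes "0 \<le> w" "\<And>x. x \<in> set xs \<Longrightarrow> wnorm w x \<le> B" "0 \<le> B"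
  shows "wnorm w (prod_list xs) \<le> B ^ length xs"
  using assms(2)
proof (induction xs)
  case (Cons x xs)
  have "wnorm w (prod_list (x # xs)) \<le> wnorm w x * wnorm w (prod_list xs)"
    using wnorm_mult[OF assms(1)] by simp
  also have "\<dots> \<le> B * B ^ length xs"
    using Cons assms by (intro mult_mono wnorm_nonneg) auto
  finally show ?case by simp
qed simp

lemma wnorm_mono: "0 \<le> v \<Longrightarrow> v \<le> w \<Longrightarrow> wnorm v x \<le> wnorm w x"
  unfolding wnorm_def by (intro sum_mono mult_left_mono power_mono) auto

text \<open>Lowering the weight by a factor \<open>\<tau>\<close> gains one such factor per vertex.
  Truncation errors, which live on large forests, thereby become powers of
  \<open>\<tau>\<close>.\<close>

lemma wnorm_scale_degree_ge:
  assumes "0 \<le> \<tau>" "\<tau> \<le> 1" "0 \<le> w" and "\<And>f. f \<in> keys x \<Longrightarrow> n \<le> forest_size f"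
  shows "wnorm (\<tau> * w) x \<le> \<tau> ^ n * wnorm w x"
proof -
  have "wnorm (\<tau> * w) x \<le> (\<Sum>f\<in>keys x. \<tau> ^ n * (\<bar>lookup x f\<bar> * w ^ forest_size f))"
    unfolding wnorm_def
  proof (rule sum_mono)
    fix f assume "f \<in> keys x"
    then have "\<tau> ^ forest_size f \<le> \<tau> ^ n" using assms by (intro power_decreasing) auto
    then have "\<tau> ^ forest_size f * (\<bar>lookup x f\<bar> * w ^ forest_size f)
        \<le> \<tau> ^ n * (\<bar>lookup x f\<bar> * w ^ forest_size f)"
      using assms by (intro mult_right_mono) auto
    then show "\<bar>lookup x f\<bar> * (\<tau> * w) ^ forest_size f
        \<le> \<tau> ^ n * (\<bar>lookup x f\<bar> * w ^ forest_size f)"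
      by (simp add: power_mult_distrib mult_ac)
  qed
  then show ?thesis by (simp add: wnorm_def sum_distrib_left)
qed

lemma abs_pairing_le_wnorm:
  assumes "\<And>f. \<bar>\<phi> f\<bar> \<le> w ^ forest_size f"
  shows "\<bar>pairing \<phi> x\<bar> \<le> wnorm w x"
proof -
  have "\<bar>pairing \<phi> x\<bar> \<le> (\<Sum>f\<in>keys x. \<bar>lookup x f * \<phi> f\<bar>)"
    unfolding pairing_def by (rule sum_abs)
  also have "\<dots> \<le> wnorm w x"
    unfolding wnorm_def abs_mult using assms by (intro sum_mono mult_left_mono) auto
  finally show ?thesis .
qed

lemma wnorm_lin_ext_le:
  assumes "0 \<le> v" "\<And>f. f \<in> keys x \<Longrightarrow> wnorm v (\<psi> f) \<le> w ^ forest_size f"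
  shows "wnorm v (lin_ext \<psi> x) \<le> wnorm w x"
proof -
  have "wnorm v (lin_ext \<psi> x) \<le> (\<Sum>f\<in>keys x. wnorm v (scal (lookup x f) (\<psi> f)))"
    unfolding lin_ext_def by (rule wnorm_sum[OF assms(1)])
  also have "\<dots> \<le> wnorm w x"
    unfolding wnorm_def[of w x] wnorm_scal using assms(2) by (intro sum_mono mult_left_mono) auto
  finally show ?thesis .
qed

section \<open>Truncation by the number of vertices\<close>

lemma lookup_lin_ext_filter:
  "lookup (lin_ext (\<lambda>f. if P f then basis f else 0) x) k = (if P k then lookup x k else 0)"
proof -
  have "lookup (lin_ext (\<lambda>f. if P f then basis f else 0) x) k
      = (\<Sum>b\<in>keys x. if b = k then (if P k then lookup x k else 0) else 0)"
    unfolding lin_ext_def lookup_sum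
    by (intro sum.cong) (auto simp: lookup_single when_def)
  then show ?thesis by (simp add: in_keys_iff)
qed

lemma lookup_proj_le: "lookup (proj_le n x) f = (if forest_size f \<le> n then lookup x f else 0)"
  unfolding proj_le_def by (rule lookup_lin_ext_filter)

lemma wnorm_proj_le: "0 \<le> w \<Longrightarrow> wnorm w (proj_le n x) \<le> wnorm w x"
  unfolding proj_le_def by (rule wnorm_lin_ext_le) auto

lemma proj_le_sum: "proj_le n (sum f A) = (\<Sum>i\<in>A. proj_le n (f i))"
  by (simp add: proj_le_def lin_ext_sum)

lemma keys_co_proj_le: "f \<in> keys (x - proj_le n x) \<Longrightarrow> Suc n \<le> forest_size f"
  by (auto simp: in_keys_iff lookup_minus lookup_proj_le split: if_splits)

declare tree_size.simps [simp del]

section \<open>Translation by a multiplicative functional\<close>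

lemma lin_ext_lin_ext: "lin_ext \<phi> (lin_ext \<psi> x) = lin_ext (\<lambda>b. lin_ext \<phi> (\<psi> b)) x"
  by (simp add: lin_ext_def[of \<psi>] lin_ext_sum lin_ext_scal lin_ext_def[of "\<lambda>b. lin_ext \<phi> (\<psi> b)"])

lemma lin_ext_plus: "lin_ext (\<lambda>b. \<phi> b + \<psi> b) x = lin_ext \<phi> x + lin_ext \<psi> x"
  by (simp add: lin_ext_def scal_add sum.distrib)

lemma lin_ext_single_const: "lin_ext (\<lambda>b. Poly_Mapping.single c (\<phi> b)) x = Poly_Mapping.single c (pairing \<phi> x)"
proof (rule poly_mapping_eqI)
  fix k show "lookup (lin_ext (\<lambda>b. Poly_Mapping.single c (\<phi> b)) x) k
      = lookup (Poly_Mapping.single c (pairing \<phi> x)) k"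
    by (cases "c = k") (simp_all add: lin_ext_def pairing_def lookup_sum lookup_single_not_eq)
qed

definition contract :: "('d forest \<Rightarrow> real) \<Rightarrow> 'd ftensor \<Rightarrow> 'd falg" where
  "contract \<phi> = lin_ext (\<lambda>(g, k). Poly_Mapping.single k (\<phi> g))"

definition translate :: "('d forest \<Rightarrow> real) \<Rightarrow> 'd falg \<Rightarrow> 'd falg" where
  "translate \<phi> x = contract \<phi> (coproduct x)"

definition Graft :: "'d \<Rightarrow> 'd falg \<Rightarrow> 'd falg" where
  "Graft \<mu> = lin_ext (\<lambda>f. basis (graft \<mu> f))"

lemma translate_add: "translate \<phi> (x + y) = translate \<phi> x + translate \<phi> y"
  by (simp add: translate_def contract_def coproduct_def lin_ext_add)

lemma translate_diff: "translate \<phi> (x - y) = translate \<phi> x - translate \<phi> y"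
  by (simp add: translate_def contract_def coproduct_def lin_ext_diff)

lemma translate_sum: "translate \<phi> (sum f A) = (\<Sum>i\<in>A. translate \<phi> (f i))"
  by (simp add: translate_def contract_def coproduct_def lin_ext_sum)

lemma translate_scal: "translate \<phi> (scal c x) = scal c (translate \<phi> x)"
  by (simp add: translate_def contract_def coproduct_def lin_ext_scal)

lemma translate_eq_lin_ext: "translate \<phi> x = lin_ext (\<lambda>f. translate \<phi> (basis f)) x"
  by (simp add: translate_def contract_def coproduct_def lin_ext_lin_ext)

lemma Graft_diff: "Graft \<mu> (x - y) = Graft \<mu> x - Graft \<mu> y"
  by (simp add: Graft_def lin_ext_diff)

lemma Graft_basis: "Graft \<mu> (basis f) = basis (graft \<mu> f)"
  by (simp add: Graft_def)

lemma forest_size_graft [simp]: "forest_size (graft \<mu> f) = Suc (forest_size f)"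
  by (simp add: graft_def)

lemma wnorm_Graft: assumes "0 \<le> w" shows "wnorm w (Graft \<mu> x) \<le> w * wnorm w x"
proof -
  have "wnorm w (Graft \<mu> x) \<le> (\<Sum>f\<in>keys x. \<bar>lookup x f\<bar> * w ^ Suc (forest_size f))"
    unfolding Graft_def lin_ext_def using wnorm_sum[OF assms] by (rule order_trans) simp
  then show ?thesis by (simp add: wnorm_def sum_distrib_left mult_ac)
qed

lemma keys_Graft: "keys (Graft \<mu> x) \<subseteq> graft \<mu> ` keys x"
  unfolding Graft_def by (rule order_trans[OF keys_lin_ext]) auto

lemma contract_graft:
  "contract \<phi> (lin_ext (\<lambda>(g, h). basis (g, graft \<mu> h)) z) = Graft \<mu> (contract \<phi> z)"
  by (simp add: contract_def Graft_def lin_ext_lin_ext split_def)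

lemma contract_add: "contract \<phi> (x + y) = contract \<phi> x + contract \<phi> y"
  by (simp add: contract_def lin_ext_add)

lemma contract_single: "contract \<phi> (Poly_Mapping.single (g, k) c) = Poly_Mapping.single k (c * \<phi> g)"
  by (simp add: contract_def)

text \<open>The coproduct preserves the total number of vertices. The claim for the trees of
  \<open>f\<close> is a hypothesis here because it is the induction hypothesis of
  \<open>keys_tree_coproduct\<close>.\<close>

lemma keys_prod_mset_tree_coproduct:
  assumes "\<And>h g k. h \<in># f \<Longrightarrow> (g, k) \<in> keys (tree_coproduct h) \<Longrightarrow> forest_size g + forest_size k = tree_size h"
    and "(g, k) \<in> keys (prod_mset (image_mset tree_coproduct f))"
  shows "forest_size g + forest_size k = forest_size f"
  using assms
proof (induction f arbitrary: g k)
  case empty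
  then show ?case by (simp add: zero_prod_def)
next
  case (add h f)
  let ?P = "prod_mset (image_mset tree_coproduct f)"
  have "(g, k) \<in> {a + b | a b. a \<in> keys (tree_coproduct h) \<and> b \<in> keys ?P}"
    using add.prems(2) keys_mult[of "tree_coproduct h" ?P] by (simp add: subset_iff)
  then obtain g1 k1 g2 k2 where *: "(g1, k1) \<in> keys (tree_coproduct h)" "(g2, k2) \<in> keys ?P"
    and gk: "g = g1 + g2" "k = k1 + k2" by auto
  have "forest_size g1 + forest_size k1 = tree_size h" using add.prems(1) *(1) by simp
  moreover have "forest_size g2 + forest_size k2 = forest_size f"
    using add.IH[OF _ *(2)] add.prems(1) by simp
  ultimately show ?case using gk by simp
qed

lemma keys_tree_coproduct:
  "(g, k) \<in> keys (tree_coproduct h) \<Longrightarrow> forest_size g + forest_size k = tree_size h"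
proof (induction h arbitrary: g k)
  case (Node \<mu> f)
  let ?P = "prod_mset (image_mset tree_coproduct f)"
  have "(g, k) \<in> keys (basis (graft \<mu> f, {#}) :: _ ftensor)
      \<union> keys (lin_ext (\<lambda>(g, h). basis (g, graft \<mu> h)) ?P)"
    using Node.prems Poly_Mapping.keys_add[of "basis (graft \<mu> f, {#})"
        "lin_ext (\<lambda>(g, h). basis (g, graft \<mu> h)) ?P"] by auto
  then consider "(g, k) = (graft \<mu> f, {#})" |
      "(g, k) \<in> keys (lin_ext (\<lambda>(g, h). basis (g, graft \<mu> h)) ?P)" by auto
  then show ?case
  proof cases
    case 2
    then obtain k' where "(g, k') \<in> keys ?P" "k = graft \<mu> k'"
      using keys_lin_ext[of "\<lambda>(g, h). basis (g, graft \<mu> h)" ?P] by auto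
    then show ?thesis using keys_prod_mset_tree_coproduct[OF Node.IH, of f] by auto
  qed simp
qed

lemma keys_coproduct:
  assumes "(g, k) \<in> keys (coproduct x)"
  shows "\<exists>f\<in>keys x. forest_size g + forest_size k = forest_size f"
proof -
  obtain f where "f \<in> keys x" "(g, k) \<in> keys (prod_mset (image_mset tree_coproduct f))"
    using assms keys_lin_ext[of "\<lambda>f. prod_mset (image_mset tree_coproduct f)" x]
    unfolding coproduct_def by auto
  then show ?thesis using keys_prod_mset_tree_coproduct[OF keys_tree_coproduct, of f g k] by blast
qed

text \<open>Only the left factors that occur in \<open>z\<close> matter, so a character may be
  replaced by any functional that agrees with it on these.\<close>

lemma tensor_pair_eq_pairing_contract:
  assumes "\<And>g k. (g, k) \<in> keys z \<Longrightarrow> \<xi> (basis g) = \<phi> g"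
  shows "tensor_pair \<xi> \<psi> z = pairing (\<lambda>k. \<psi> (basis k)) (contract \<phi> z)"
  unfolding contract_def pairing_lin_ext tensor_pair_def pairing_def[of _ z]
  using assms by (intro sum.cong) (auto simp: mult_ac)

text \<open>Multiplicativity on all forests, without a bound on their size, makes translation an
  exact algebra homomorphism rather than one up to large forests.\<close>

locale multiplicative_functional =
  fixes \<phi> :: "'d forest \<Rightarrow> real"
  assumes plus: "\<phi> (f + g) = \<phi> f * \<phi> g" and empty: "\<phi> {#} = 1"
begin

lemma translate_mult: "translate \<phi> (x * y) = translate \<phi> x * translate \<phi> y"
proof -
  have "coproduct (x * y) = coproduct x * coproduct y"
    unfolding coproduct_def by (rule lin_ext_mult) simp
  then show ?thesis unfolding translate_def contract_def
    by (simp only:) (rule lin_ext_mult, auto simp: plus mult_single)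
qed

lemma translate_empty: "translate \<phi> (basis {#}) = basis {#}"
  by (simp only: translate_def coproduct_empty contract_single empty mult_1)

lemma translate_one [simp]: "translate \<phi> 1 = 1"
  using translate_empty by (simp flip: single_one zero_multiset_def)

lemma translate_prod_list: "translate \<phi> (prod_list xs) = prod_list (map (translate \<phi>) xs)"
  by (induction xs) (simp_all add: translate_mult)

text \<open>This is the recursive clause of the coproduct: translation commutes with grafting up to
  a scalar at the empty forest. Remainders of grafted elements are therefore grafts of remainders,
  apart from one scalar component.\<close>

lemma translate_Graft:
  "translate \<phi> (Graft \<mu> x) = Poly_Mapping.single {#} (pairing \<phi> (Graft \<mu> x)) + Graft \<mu> (translate \<phi> x)"
proof -
  have *: "translate \<phi> (basis (graft \<mu> f))
      = Poly_Mapping.single {#} (\<phi> (graft \<mu> f)) + Graft \<mu> (translate \<phi> (basis f))" for f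
    by (simp add: translate_def coproduct_graft contract_add contract_single contract_graft)
  have "translate \<phi> (Graft \<mu> x) = lin_ext (\<lambda>f. translate \<phi> (basis (graft \<mu> f))) x"
    by (subst translate_eq_lin_ext) (simp add: Graft_def lin_ext_lin_ext)
  also have "\<dots> = lin_ext (\<lambda>f. Poly_Mapping.single {#} (\<phi> (graft \<mu> f))) x
      + lin_ext (\<lambda>f. Graft \<mu> (translate \<phi> (basis f))) x"
    by (simp add: * lin_ext_plus)
  also have "lin_ext (\<lambda>f. Graft \<mu> (translate \<phi> (basis f))) x = Graft \<mu> (translate \<phi> x)"
    by (subst (2) translate_eq_lin_ext) (simp add: Graft_def lin_ext_lin_ext)
  also have "lin_ext (\<lambda>f. Poly_Mapping.single {#} (\<phi> (graft \<mu> f))) x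
      = Poly_Mapping.single {#} (pairing \<phi> (Graft \<mu> x))"
    by (simp add: lin_ext_single_const Graft_def pairing_lin_ext)
  finally show ?thesis .
qed

context
  fixes w :: real
  assumes w: "0 \<le> w" and bound: "\<And>f. \<bar>\<phi> f\<bar> \<le> w ^ forest_size f"
begin

lemma wnorm_translate_forest:
  assumes "\<And>h. h \<in># f \<Longrightarrow> wnorm w (translate \<phi> (basis {#h#})) \<le> (2 * w) ^ tree_size h"
  shows "wnorm w (translate \<phi> (basis f)) \<le> (2 * w) ^ forest_size f"
  using assms
proof (induction f)
  case empty
  then show ?case by (simp add: translate_empty)
next
  case (add h f)
  have "basis (add_mset h f) = basis {#h#} * (basis f :: _ falg)" by (simp add: mult_single)
  then have "wnorm w (translate \<phi> (basis (add_mset h f)))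
      \<le> wnorm w (translate \<phi> (basis {#h#})) * wnorm w (translate \<phi> (basis f))"
    using wnorm_mult[OF w] by (simp add: translate_mult)
  also have "\<dots> \<le> (2 * w) ^ tree_size h * (2 * w) ^ forest_size f"
    using add w by (intro mult_mono wnorm_nonneg) auto
  finally show ?case by (simp add: power_add)
qed

text \<open>Either the whole tree goes to the left factor, or the root stays on the right and the
  forest below it is translated. With n vertices below the root, 1 + 2^n <= 2^(n+1) shows that
  doubling the weight pays for both.\<close>

lemma wnorm_translate_tree: "wnorm w (translate \<phi> (basis {#h#})) \<le> (2 * w) ^ tree_size h"
proof (induction h)
  case (Node \<mu> f)
  let ?n = "forest_size f"
  have "wnorm w (translate \<phi> (basis {#Node \<mu> f#})) = wnorm w (translate \<phi> (Graft \<mu> (basis f)))"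
    by (simp add: Graft_basis graft_def)
  also have "\<dots> \<le> \<bar>\<phi> (graft \<mu> f)\<bar> + w * wnorm w (translate \<phi> (basis f))"
    unfolding translate_Graft
    by (rule order_trans[OF wnorm_add[OF w]])
      (use wnorm_Graft[OF w, of \<mu> "translate \<phi> (basis f)"] in \<open>simp add: Graft_basis\<close>)
  also have "\<dots> \<le> w ^ Suc ?n + w * (2 * w) ^ ?n"
    using bound[of "graft \<mu> f"] wnorm_translate_forest[OF Node.IH] w
    by (intro add_mono mult_left_mono) auto
  also have "\<dots> = w ^ Suc ?n * (1 + 2 ^ ?n)" by (simp add: power_mult_distrib algebra_simps)
  also have "\<dots> \<le> w ^ Suc ?n * 2 ^ Suc ?n" using w by (intro mult_left_mono) auto
  finally show ?case by (simp add: power_mult_distrib mult_ac)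
qed

lemma wnorm_translate: "wnorm w (translate \<phi> x) \<le> wnorm (2 * w) x"
  by (subst translate_eq_lin_ext)
    (auto intro!: wnorm_lin_ext_le[OF w] wnorm_translate_forest wnorm_translate_tree)

end

end

section \<open>The multiplicative functional of a rough path\<close>

text \<open>A character is only constrained on forests with trees of at most \<open>N\<close> vertices; setting it
  to zero on larger trees gives a functional that is multiplicative on all forests.\<close>

definition tree_char :: "nat \<Rightarrow> ('d falg \<Rightarrow> real) \<Rightarrow> 'd forest \<Rightarrow> real" where
  "tree_char N \<xi> f = prod_mset (image_mset (\<lambda>h. if tree_size h \<le> N then \<xi> (basis {#h#}) else 0) f)"

interpretation tree_char: multiplicative_functional "tree_char N \<xi>" for N \<xi>
  by unfold_locales (simp_all add: tree_char_def)

lemma forests_if_size_le: "forest_size f \<le> N \<Longrightarrow> f \<in> forests N"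
  using tree_size_le_forest_size by (fastforce simp: forests_def trees_def)

lemma tree_char_eq:
  assumes "is_character N \<xi>" "f \<in> forests N"
  shows "\<xi> (basis f) = tree_char N \<xi> f"
  using assms(2)
proof (induction f)
  case empty
  have "\<xi> 1 = 1" using assms(1) by (simp add: is_character_def)
  then show ?case by (simp add: tree_char.empty flip: single_one zero_multiset_def)
next
  case (add h f)
  have h: "tree_size h \<le> N" and f: "f \<in> forests N" using add.prems by (auto simp: forests_def trees_def)
  have "(basis {#h#} :: _ falg) \<in> fspan (forests N)" "(basis f :: _ falg) \<in> fspan (forests N)"
    using h f by (auto simp: fspan_def forests_def trees_def)
  then have "\<xi> (basis {#h#} * basis f) = \<xi> (basis {#h#}) * \<xi> (basis f)"
    using assms(1) unfolding is_character_def by blast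
  then show ?case using add.IH[OF f] h by (simp add: mult_single tree_char_def)
qed

lemma abs_tree_char_le:
  assumes "0 \<le> w" "\<And>h. h \<in> trees N \<Longrightarrow> \<bar>\<xi> (basis {#h#})\<bar> \<le> w ^ tree_size h"
  shows "\<bar>tree_char N \<xi> f\<bar> \<le> w ^ forest_size f"
proof (induction f)
  case (add h f)
  have "\<bar>if tree_size h \<le> N then \<xi> (basis {#h#}) else 0\<bar> \<le> w ^ tree_size h"
    using assms by (auto simp: trees_def)
  moreover have "tree_char N \<xi> (add_mset h f)
      = (if tree_size h \<le> N then \<xi> (basis {#h#}) else 0) * tree_char N \<xi> f"
    by (simp add: tree_char_def)
  ultimately show ?case using add.IH assms(1)
    by (simp only: abs_mult forest_size_simps power_add) (intro mult_mono, auto)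
qed (simp add: tree_char_def)

text \<open>Chen's relation, rewritten as compatibility of the pairing with translation of the
  argument. It is linear in \<open>x\<close>, so single trees and the empty forest suffice.\<close>

lemma chen:
  assumes X: "rough_path \<alpha> N X" and st: "s \<in> {0..1}" "u \<in> {0..1}" "t \<in> {0..1}"
    and x: "keys x \<subseteq> trees1 N"
  shows "pairing (tree_char N (X s t)) x
    = pairing (tree_char N (X u t)) (translate (tree_char N (X s u)) x)"
proof -
  have *: "tree_char N (X s t) h = pairing (tree_char N (X u t)) (translate (tree_char N (X s u)) (basis h))"
    if h: "h \<in> trees1 N" for h
  proof -
    have size: "forest_size h \<le> N" using h by (auto simp: trees1_def trees_def)
    have ch: "is_character N (X a b)" if "a \<in> {0..1}" "b \<in> {0..1}" for a b
      using X that by (simp add: rough_path_def)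
    have small: "g \<in> forests N" "k \<in> forests N" if "(g, k) \<in> keys (coproduct (basis h))" for g k
      using keys_coproduct[OF that] size by (auto intro!: forests_if_size_le)
    have "tree_char N (X s t) h = X s t (basis h)"
      using tree_char_eq[OF ch] st forests_if_size_le[OF size] by simp
    also have "\<dots> = tensor_pair (X s u) (X u t) (coproduct (basis h))"
    proof -
      have "\<forall>s \<in> {0..1}. \<forall>u \<in> {0..1}. \<forall>t \<in> {0..1}. \<forall>h \<in> trees1 N.
          tensor_pair (X s u) (X u t) (coproduct (basis h)) = X s t (basis h)"
        using X unfolding rough_path_def by (elim conjE)
      from this[rule_format, OF st h] show ?thesis by (rule sym)
    qed
    also have "\<dots> = pairing (\<lambda>k. X u t (basis k)) (contract (tree_char N (X s u)) (coproduct (basis h)))"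
    proof (rule tensor_pair_eq_pairing_contract)
      fix g k assume "(g, k) \<in> keys (coproduct (basis h))"
      then show "X s u (basis g) = tree_char N (X s u) g"
        by (rule tree_char_eq[OF ch[OF st(1,2)] small(1)])
    qed
    \<comment> \<open>The forests left after the contraction are right factors of the coproduct;
      they have at most \<open>N\<close> vertices, so the character agrees with its extension on
      them.\<close>
    also have "\<dots> = pairing (tree_char N (X u t)) (contract (tree_char N (X s u)) (coproduct (basis h)))"
    proof -
      have "k \<in> forests N" if "k \<in> keys (contract (tree_char N (X s u)) (coproduct (basis h)))" for k
      proof -
        have "k \<in> (\<Union>b\<in>keys (coproduct (basis h)).
            keys (case b of (g, k) \<Rightarrow> Poly_Mapping.single k (tree_char N (X s u) g)))"
          by (rule subsetD[OF keys_lin_ext that[unfolded contract_def]])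
        then obtain g k' where gk: "(g, k') \<in> keys (coproduct (basis h))"
          and "k \<in> keys (Poly_Mapping.single k' (tree_char N (X s u) g))" by auto
        then have "k = k'" by (simp split: if_splits)
        then show ?thesis using small(2)[OF gk] by simp
      qed
      then show ?thesis unfolding pairing_def
        by (intro sum.cong refl arg_cong2[of _ _ _ _ "(*)"] tree_char_eq[OF ch[OF st(2,3)]])
    qed
    finally show ?thesis by (simp add: translate_def)
  qed
  have "pairing (tree_char N (X u t)) (translate (tree_char N (X s u)) x)
      = pairing (\<lambda>h. pairing (tree_char N (X u t)) (translate (tree_char N (X s u)) (basis h))) x"
    by (subst translate_eq_lin_ext) (rule pairing_lin_ext)
  also have "\<dots> = pairing (tree_char N (X s t)) x"
    unfolding pairing_def[of _ x] using x * by (intro sum.cong) auto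
  finally show ?thesis by simp
qed

section \<open>Iterated directional derivatives\<close>

lemma C_class_iter_deriv: "C_class (n + length vs) g \<Longrightarrow> C_class n (iter_deriv g vs)"
proof (induction vs arbitrary: n)
  case (Cons v vs)
  have "C_class (Suc n + length vs) g" using Cons.prems by simp
  from Cons.IH[OF this] show ?case by simp
qed simp

lemma C_class_differentiable: "C_class (Suc n) g \<Longrightarrow> g differentiable (at x)"
  by simp

lemma C_class_continuous: "C_class n g \<Longrightarrow> continuous_on UNIV g"
  by (cases n) (auto intro: differentiable_imp_continuous_on simp: differentiable_on_def)

lemma differentiable_iter_deriv:
  assumes "C_class n g" "length vs < n"
  shows "iter_deriv g vs differentiable (at x)"
proof -
  have "n = Suc (n - Suc (length vs)) + length vs" using assms(2) by simp
  then show ?thesis using C_class_iter_deriv assms(1) C_class_differentiable by metis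
qed

lemma iter_deriv_append: "iter_deriv g (us @ vs) = iter_deriv (iter_deriv g vs) us"
  by (induction us) simp_all

lemma frechet_derivative_linear_comp:
  assumes "bounded_linear l" "h differentiable (at x)"
  shows "frechet_derivative (\<lambda>x. l (h x)) (at x) v = l (frechet_derivative h (at x) v)"
proof -
  have "(h has_derivative frechet_derivative h (at x)) (at x)"
    using assms(2) by (simp add: frechet_derivative_works)
  from bounded_linear.has_derivative[OF assms(1) this] show ?thesis
    using frechet_derivative_at by metis
qed

lemma iter_deriv_linear_comp:
  assumes "bounded_linear l" "C_class n g" "length vs \<le> n"
  shows "iter_deriv (\<lambda>x. l (g x)) vs = (\<lambda>x. l (iter_deriv g vs x))"
  using assms(3)
proof (induction vs)
  case (Cons v vs)
  then have diff: "iter_deriv g vs differentiable (at x)" for x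
    using differentiable_iter_deriv[OF assms(2)] by simp
  have "iter_deriv (\<lambda>x. l (g x)) vs = (\<lambda>x. l (iter_deriv g vs x))" using Cons by simp
  then show ?case by (simp add: frechet_derivative_linear_comp[OF assms(1) diff])
qed simp

lemma C_class_linear_comp:
  assumes "bounded_linear l" "C_class n g"
  shows "C_class n (\<lambda>x. l (g x))"
  using assms(2)
proof (induction n arbitrary: g)
  case 0
  then show ?case using assms(1) by (simp add: bounded_linear.continuous_on)
next
  case (Suc n)
  have "(\<lambda>x. l (g x)) differentiable (at x)" for x
    using Suc.prems bounded_linear.has_derivative[OF assms(1)]
    unfolding C_class.simps differentiable_def by blast
  moreover have "(\<lambda>x. frechet_derivative (\<lambda>x. l (g x)) (at x) v) = (\<lambda>x. l (frechet_derivative g (at x) v))" for v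
    by (intro ext frechet_derivative_linear_comp[OF assms(1)] C_class_differentiable[OF Suc.prems])
  ultimately show ?case using Suc by simp
qed

lemma has_real_derivative_along_line:
  fixes h :: "'a::real_normed_vector \<Rightarrow> real"
  assumes "h differentiable (at (x + t *\<^sub>R v))"
  shows "((\<lambda>t. h (x + t *\<^sub>R v)) has_real_derivative frechet_derivative h (at (x + t *\<^sub>R v)) v) (at t)"
proof -
  let ?D = "frechet_derivative h (at (x + t *\<^sub>R v))"
  have D: "(h has_derivative ?D) (at (x + t *\<^sub>R v))"
    using assms by (simp add: frechet_derivative_works)
  have "((\<lambda>t. x + t *\<^sub>R v) has_derivative (\<lambda>s. s *\<^sub>R v)) (at t)"
    by (auto intro!: derivative_eq_intros)
  from has_derivative_compose[OF this D]
  have "((\<lambda>t. h (x + t *\<^sub>R v)) has_derivative (\<lambda>s. ?D (s *\<^sub>R v))) (at t)" .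
  moreover have "?D (s *\<^sub>R v) = ?D v * s" for s
    using linear_frechet_derivative[OF assms] by (simp add: linear_scale)
  ultimately show ?thesis by (simp add: has_field_derivative_def)
qed

text \<open>The mean value theorem is used twice: in the direction \<open>u\<close> for the
  difference of \<open>h\<close> along two parallel lines, then in the direction \<open>v\<close>
  for the derivative so obtained.\<close>

lemma second_difference:
  fixes h :: "'a::euclidean_space \<Rightarrow> real"
  assumes h: "C_class 2 h" and t: "0 < t"
  shows "\<exists>a b. 0 < a \<and> a < t \<and> 0 < b \<and> b < t \<and>
    h (x + t *\<^sub>R u + t *\<^sub>R v) - h (x + t *\<^sub>R u) - h (x + t *\<^sub>R v) + h x
      = t\<^sup>2 * iter_deriv h [v, u] (x + a *\<^sub>R u + b *\<^sub>R v)"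
proof -
  have d0: "h differentiable (at y)" for y
    using h by (simp add: numeral_2_eq_2)
  let ?hu = "iter_deriv h [u]"
  have d1: "?hu differentiable (at y)" for y
    using h by (simp add: numeral_2_eq_2)
  let ?\<phi> = "\<lambda>r. h ((x + t *\<^sub>R v) + r *\<^sub>R u) - h (x + r *\<^sub>R u)"
  have "(?\<phi> has_real_derivative ?hu ((x + t *\<^sub>R v) + r *\<^sub>R u) - ?hu (x + r *\<^sub>R u)) (at r)" for r
    using has_real_derivative_along_line[OF d0, where t = r and v = u] by (auto intro!: derivative_intros)
  from MVT2[OF t this] obtain a where a: "0 < a" "a < t" and
    1: "?\<phi> t - ?\<phi> 0 = t * (?hu ((x + t *\<^sub>R v) + a *\<^sub>R u) - ?hu (x + a *\<^sub>R u))" by auto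
  let ?\<psi> = "\<lambda>r. ?hu ((x + a *\<^sub>R u) + r *\<^sub>R v)"
  have "(?\<psi> has_real_derivative iter_deriv h [v, u] ((x + a *\<^sub>R u) + r *\<^sub>R v)) (at r)" for r
    using has_real_derivative_along_line[OF d1, where t = r and v = v and x = "x + a *\<^sub>R u"] by simp
  from MVT2[OF t this] obtain b where b: "0 < b" "b < t" and
    2: "?\<psi> t - ?\<psi> 0 = t * iter_deriv h [v, u] ((x + a *\<^sub>R u) + b *\<^sub>R v)" by auto
  have "?\<phi> t - ?\<phi> 0 = t\<^sup>2 * iter_deriv h [v, u] (x + a *\<^sub>R u + b *\<^sub>R v)"
    unfolding 1 using 2 by (simp add: power2_eq_square add.commute add.left_commute)
  then have "h (x + t *\<^sub>R u + t *\<^sub>R v) - h (x + t *\<^sub>R u) - h (x + t *\<^sub>R v) + h x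
      = t\<^sup>2 * iter_deriv h [v, u] (x + a *\<^sub>R u + b *\<^sub>R v)"
    by (simp add: algebra_simps del: iter_deriv.simps)
  then show ?thesis using a b by blast
qed

text \<open>The second difference is symmetric in \<open>u\<close> and \<open>v\<close>, so at every
  scale the two mixed derivatives take a common value at points close to \<open>x\<close>;
  continuity transfers this to \<open>x\<close> itself.\<close>

lemma symmetric_second_derivative:
  fixes h :: "'a::euclidean_space \<Rightarrow> real"
  assumes h: "C_class 2 h"
  shows "iter_deriv h [u, v] x = iter_deriv h [v, u] x"
proof (rule ccontr)
  let ?A = "iter_deriv h [v, u]" and ?B = "iter_deriv h [u, v]"
  assume ne: "?B x \<noteq> ?A x"
  define e where "e = \<bar>?A x - ?B x\<bar> / 2"
  have e: "0 < e" using ne by (simp add: e_def)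
  have "C_class 0 ?A" "C_class 0 ?B" using h C_class_iter_deriv[of 0] by (simp_all add: numeral_2_eq_2)
  then have "continuous (at x) ?A" "continuous (at x) ?B"
    using C_class_continuous continuous_on_eq_continuous_at by blast+
  then obtain d1 d2 where d: "0 < d1" "0 < d2"
    and A: "\<And>y. norm (y - x) < d1 \<Longrightarrow> \<bar>?A y - ?A x\<bar> < e"
    and B: "\<And>y. norm (y - x) < d2 \<Longrightarrow> \<bar>?B y - ?B x\<bar> < e"
    using e unfolding continuous_at_eps_delta dist_norm real_norm_def by metis
  \<comment> \<open>All points produced by the mean value theorem lie within \<open>t * M\<close> of
    \<open>x\<close>; the summand 1 keeps \<open>M\<close> positive.\<close>
  define M where "M = 1 + norm u + norm v"
  define t where "t = min d1 d2 / (2 * M)"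
  have M: "0 < M" unfolding M_def by (smt (verit) norm_ge_zero)
  then have t: "0 < t" using d by (simp add: t_def)
  have tM: "t * M < d1" "t * M < d2" using d M by (auto simp: t_def min_def field_simps)
  have near: "norm (x + a *\<^sub>R p + b *\<^sub>R q - x) \<le> t * M"
    if "0 < a" "a < t" "0 < b" "b < t" "norm p + norm q \<le> M" for a b p q
  proof -
    have "norm (x + a *\<^sub>R p + b *\<^sub>R q - x) \<le> a * norm p + b * norm q"
      using that norm_triangle_ineq[of "a *\<^sub>R p" "b *\<^sub>R q"] by simp
    also have "\<dots> \<le> t * norm p + t * norm q"
      using that by (intro add_mono mult_right_mono) auto
    also have "\<dots> \<le> t * M" using that t by (simp flip: distrib_left)
    finally show ?thesis .
  qed
  obtain a b where ab: "0 < a" "a < t" "0 < b" "b < t" and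
    1: "h (x + t *\<^sub>R u + t *\<^sub>R v) - h (x + t *\<^sub>R u) - h (x + t *\<^sub>R v) + h x
      = t\<^sup>2 * ?A (x + a *\<^sub>R u + b *\<^sub>R v)" using second_difference[OF h t] by metis
  obtain a' b' where ab': "0 < a'" "a' < t" "0 < b'" "b' < t" and
    2: "h (x + t *\<^sub>R v + t *\<^sub>R u) - h (x + t *\<^sub>R v) - h (x + t *\<^sub>R u) + h x
      = t\<^sup>2 * ?B (x + a' *\<^sub>R v + b' *\<^sub>R u)" using second_difference[OF h t] by metis
  have "h (x + t *\<^sub>R v + t *\<^sub>R u) = h (x + t *\<^sub>R u + t *\<^sub>R v)" by (simp add: add_ac)
  with 1 2 have "t\<^sup>2 * ?A (x + a *\<^sub>R u + b *\<^sub>R v) = t\<^sup>2 * ?B (x + a' *\<^sub>R v + b' *\<^sub>R u)" by linarith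
  then have "?A (x + a *\<^sub>R u + b *\<^sub>R v) = ?B (x + a' *\<^sub>R v + b' *\<^sub>R u)" using t by simp
  moreover have "\<bar>?A (x + a *\<^sub>R u + b *\<^sub>R v) - ?A x\<bar> < e"
    using near[OF ab, of u v] tM by (intro A) (simp add: M_def)
  moreover have "\<bar>?B (x + a' *\<^sub>R v + b' *\<^sub>R u) - ?B x\<bar> < e"
    using near[OF ab', of v u] tM by (intro B) (simp add: M_def)
  ultimately have "\<bar>?A x - ?B x\<bar> < e + e" by linarith
  then show False by (simp add: e_def)
qed

section \<open>Partial derivatives indexed by words\<close>

text \<open>Ordered words replace multi-indices: every multi-index occurs once for each ordering, so
  a p-th derivative is a plain sum over words and the only factorial left in the Taylor formula is 1
  / p!.\<close>

definition words :: "nat \<Rightarrow> 'k::finite list set" where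
  "words p = {w. length w = p}"

lemma finite_words [simp]: "finite (words p :: 'k::finite list set)"
  using finite_lists_length_eq[of "UNIV :: 'k set" p] by (simp add: words_def)

lemma words_0 [simp]: "words 0 = {[]}"
  by (auto simp: words_def)

lemma length_words: "w \<in> words p \<Longrightarrow> length w = p"
  by (simp add: words_def)

lemma sum_words_Suc:
  "(\<Sum>w\<in>words (Suc p). f w) = (\<Sum>i\<in>UNIV. \<Sum>w\<in>words p. f (i # w))"
proof -
  have eq: "words (Suc p) = (\<lambda>(i, w). i # w) ` (UNIV \<times> words p)"
    by (auto simp: words_def length_Suc_conv image_iff)
  have inj: "inj_on (\<lambda>(i, w). i # w) (UNIV \<times> words p)" by (auto simp: inj_on_def)
  have "(\<Sum>w\<in>words (Suc p). f w) = (\<Sum>(i, w)\<in>UNIV \<times> words p. f (i # w))"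
    unfolding eq sum.reindex[OF inj] by (simp add: comp_def split_def)
  then show ?thesis by (simp add: sum.cartesian_product)
qed

lemma card_words: "card (words p :: 'k::finite list set) = CARD('k) ^ p"
  using card_lists_length_eq[of "UNIV :: 'k set" p] by (simp add: words_def)

lemma partial_Cons: "partial g (i # w) x = frechet_derivative (partial g w) (at x) (axis i 1)"
  by (simp add: partial_def)

lemma differentiable_partial: "C_class n g \<Longrightarrow> length w < n \<Longrightarrow> partial g w differentiable (at x)"
  unfolding partial_def by (rule differentiable_iter_deriv) simp_all

lemma frechet_derivative_coordinates:
  fixes h :: "real ^ 'k::finite \<Rightarrow> real"
  assumes "h differentiable (at x)"
  shows "frechet_derivative h (at x) v = (\<Sum>i\<in>UNIV. v $ i * frechet_derivative h (at x) (axis i 1))"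
proof -
  have lin: "linear (frechet_derivative h (at x))" by (rule linear_frechet_derivative[OF assms])
  have "frechet_derivative h (at x) (\<Sum>i\<in>UNIV. v $ i *s axis i 1)
      = (\<Sum>i\<in>UNIV. v $ i * frechet_derivative h (at x) (axis i 1))"
    using lin by (simp add: linear_sum linear_scale scalar_mult_eq_scaleR)
  then show ?thesis by (simp add: basis_expansion)
qed

text \<open>Each further direction is expanded in the standard basis, which prepends one letter to
  the word; no letters have to be exchanged.\<close>

lemma iter_deriv_coordinates:
  fixes g :: "real ^ 'k::finite \<Rightarrow> real"
  assumes "C_class n g" "length vs \<le> n"
  shows "iter_deriv g vs x = (\<Sum>w\<in>words (length vs). partial g w x * prod_list (map2 (\<lambda>v i. v $ i) vs w))"
  using assms(2)
proof (induction vs arbitrary: x)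
  case Nil
  then show ?case by (simp add: partial_def)
next
  case (Cons v vs)
  let ?c = "\<lambda>w. prod_list (map2 (\<lambda>v i. v $ i) vs w)"
  have IH: "iter_deriv g vs = (\<lambda>x. \<Sum>w\<in>words (length vs). partial g w x * ?c w)"
    using Cons by auto
  have diff: "partial g w differentiable (at x)" if "w \<in> words (length vs)" for w x
    using differentiable_partial[OF assms(1)] Cons.prems that by (simp add: words_def)
  have "((\<lambda>x. \<Sum>w\<in>words (length vs). partial g w x * ?c w) has_derivative
      (\<lambda>v. \<Sum>w\<in>words (length vs). frechet_derivative (partial g w) (at x) v * ?c w)) (at x)"
    using diff by (intro has_derivative_sum has_derivative_mult_left) (simp add: frechet_derivative_works)
  from frechet_derivative_at[OF this, symmetric]
  have "iter_deriv g (v # vs) x = (\<Sum>w\<in>words (length vs). frechet_derivative (partial g w) (at x) v * ?c w)"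
    by (simp add: IH)
  also have "\<dots> = (\<Sum>w\<in>words (length vs). \<Sum>i\<in>UNIV. partial g (i # w) x * (v $ i * ?c w))"
  proof (rule sum.cong[OF refl])
    fix w :: "'k list" assume "w \<in> words (length vs)"
    then have "frechet_derivative (partial g w) (at x) v
        = (\<Sum>i\<in>UNIV. v $ i * partial g (i # w) x)"
      unfolding partial_Cons by (intro frechet_derivative_coordinates diff)
    then show "frechet_derivative (partial g w) (at x) v * ?c w
        = (\<Sum>i\<in>UNIV. partial g (i # w) x * (v $ i * ?c w))"
      by (simp add: sum_distrib_left mult_ac)
  qed
  also have "\<dots> = (\<Sum>i\<in>UNIV. \<Sum>w\<in>words (length vs). partial g (i # w) x * (v $ i * ?c w))"
    by (rule sum.swap)
  finally show ?case by (simp add: sum_words_Suc)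
qed

text \<open>The letters of \<open>w\<close> are absorbed into the function and those of
  \<open>u\<close> differentiate an identity of functions, so only the middle pair needs the
  symmetry of second derivatives. Adjacent exchanges are all that \<open>sum_dword\<close>
  requires.\<close>

lemma partial_swap:
  fixes g :: "real ^ 'k::finite \<Rightarrow> real"
  assumes "C_class n g" "length u + 2 + length w \<le> n"
  shows "partial g (u @ i # j # w) = partial g (u @ j # i # w)"
proof -
  let ?ax = "\<lambda>i. axis i 1 :: real ^ 'k"
  let ?h = "partial g w"
  have "n = (n - length w) + length w" using assms by simp
  then have "C_class (n - length w) ?h"
    using C_class_iter_deriv[of "n - length w" "map ?ax w" g] assms by (simp add: partial_def)
  moreover have "n - length w = 2 + (n - length w - 2)" using assms(2) by simp
  ultimately have "C_class (2 + (n - length w - 2)) ?h" by (simp only:)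
  then have "C_class 2 ?h"
  proof -
    have mono: "C_class (a + b) f \<Longrightarrow> C_class a f" for a b and f :: "real ^ 'k \<Rightarrow> real"
    proof (induction a arbitrary: f)
      case 0 then show ?case using C_class_continuous by simp
    qed simp
    show ?thesis using \<open>C_class (2 + (n - length w - 2)) ?h\<close> by (rule mono)
  qed
  then have "iter_deriv ?h [?ax i, ?ax j] = iter_deriv ?h [?ax j, ?ax i]"
    using symmetric_second_derivative by blast
  moreover have "partial g (u @ a # b # w) = iter_deriv (iter_deriv ?h [?ax a, ?ax b]) (map ?ax u)" for a b
    unfolding partial_def map_append list.map iter_deriv_append[of g "map ?ax u"]
    by (simp add: partial_def)
  ultimately show ?thesis by simp
qed

section \<open>Taylor polynomials with values in the forest algebra\<close>

definition taylor_term :: "(real ^ 'k \<Rightarrow> real) \<Rightarrow> nat \<Rightarrow> real ^ 'k::finite \<Rightarrow> ('k \<Rightarrow> 'd falg) \<Rightarrow> 'd falg" where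
  "taylor_term g p x b = (\<Sum>w\<in>words p. scal (partial g w x) (prod_list (map b w)))"

text \<open>Only orders \<open>p < n\<close> occur: for \<open>n = N\<close> the derivatives of
  order \<open>N\<close> are left for the remainder. The increments lie in the forest algebra; taken
  at the tree part of a path and truncated, this becomes \<open>compose_path\<close>.\<close>

definition taylor :: "(real ^ 'k \<Rightarrow> real) \<Rightarrow> nat \<Rightarrow> real ^ 'k::finite \<Rightarrow> ('k \<Rightarrow> 'd falg) \<Rightarrow> 'd falg" where
  "taylor g n x b = (\<Sum>p<n. scal (1 / fact p) (taylor_term g p x b))"

text \<open>An algebra homomorphism passes through every monomial, so translation acts on the
  increments alone and leaves the base point \<open>x\<close> where it is.\<close>

lemma (in multiplicative_functional) translate_taylor:
  "translate \<phi> (taylor g n x b) = taylor g n x (\<lambda>i. translate \<phi> (b i))"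
  by (simp add: taylor_def taylor_term_def translate_sum translate_scal translate_prod_list comp_def)

lemma wnorm_taylor_term:
  fixes b :: "'k::finite \<Rightarrow> 'd falg"
  assumes "0 \<le> v" "0 \<le> \<beta>" "\<And>i. wnorm v (b i) \<le> \<beta>" "\<And>w. length w = p \<Longrightarrow> \<bar>partial g w x\<bar> \<le> K"
  shows "wnorm v (taylor_term g p x b) \<le> K * (real CARD('k) * \<beta>) ^ p"
proof -
  have "wnorm v (taylor_term g p x b) \<le> (\<Sum>w\<in>words p. \<bar>partial g w x\<bar> * wnorm v (prod_list (map b w)))"
    unfolding taylor_term_def using wnorm_sum[OF assms(1)] by (rule order_trans) simp
  also have "\<dots> \<le> (\<Sum>w\<in>(words p :: 'k list set). K * \<beta> ^ p)"
  proof (rule sum_mono)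
    fix w :: "'k list" assume "w \<in> words p"
    then have w: "length w = p" by (rule length_words)
    have "wnorm v (prod_list (map b w)) \<le> \<beta> ^ p"
      using wnorm_prod_list[OF assms(1), of "map b w" \<beta>] assms w by auto
    moreover have "0 \<le> K" using assms(4)[OF w] by linarith
    ultimately show "\<bar>partial g w x\<bar> * wnorm v (prod_list (map b w)) \<le> K * \<beta> ^ p"
      using assms(1,4) w by (intro mult_mono wnorm_nonneg) auto
  qed
  also have "\<dots> = K * (real CARD('k) * \<beta>) ^ p"
    by (simp add: card_words power_mult_distrib)
  finally show ?thesis .
qed

lemma wnorm_scal_inverse_fact: "0 \<le> v \<Longrightarrow> wnorm v (scal (1 / fact p) x) \<le> wnorm v x"
proof -
  assume "0 \<le> v"
  have "1 / fact p \<le> (1::real)" using fact_ge_1[of p, where 'a = real] by simp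
  then have "1 / fact p * wnorm v x \<le> 1 * wnorm v x"
    using wnorm_nonneg[OF \<open>0 \<le> v\<close>] by (intro mult_right_mono) auto
  then show ?thesis by simp
qed

lemma wnorm_taylor:
  fixes b :: "'k::finite \<Rightarrow> 'd falg"
  assumes "0 \<le> v" "0 \<le> \<beta>" "\<And>i. wnorm v (b i) \<le> \<beta>"
    and "\<And>w. length w < n \<Longrightarrow> \<bar>partial g w x\<bar> \<le> K (length w)"
  shows "wnorm v (taylor g n x b) \<le> (\<Sum>p<n. K p * (real CARD('k) * \<beta>) ^ p)"
  unfolding taylor_def
proof (rule order_trans[OF wnorm_sum[OF assms(1)]], rule sum_mono)
  fix p assume "p \<in> {..<n}"
  then have "wnorm v (taylor_term g p x b) \<le> K p * (real CARD('k) * \<beta>) ^ p"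
    using assms(4) by (intro wnorm_taylor_term[OF assms(1-3)]) auto
  then show "wnorm v (scal (1 / fact p) (taylor_term g p x b)) \<le> K p * (real CARD('k) * \<beta>) ^ p"
    by (rule order_trans[OF wnorm_scal_inverse_fact[OF assms(1)]])
qed

text \<open>Telescoping, one factor exchanged at a time. For the empty word the factor
  \<open>length w\<close> vanishes, so the truncated exponent does no harm.\<close>

lemma wnorm_prod_list_diff:
  assumes "0 \<le> v" "0 \<le> \<beta>" "0 \<le> \<delta>"
    and "\<And>i. wnorm v (b i) \<le> \<beta>" "\<And>i. wnorm v (b' i) \<le> \<beta>" "\<And>i. wnorm v (b i - b' i) \<le> \<delta>"
  shows "wnorm v (prod_list (map b w) - prod_list (map b' w)) \<le> real (length w) * \<beta> ^ (length w - 1) * \<delta>"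
proof (induction w)
  case (Cons i w)
  let ?P = "prod_list (map b w)" and ?P' = "prod_list (map b' w)" and ?n = "length w"
  have "b i * ?P - b' i * ?P' = (b i - b' i) * ?P + b' i * (?P - ?P')" by (simp add: algebra_simps)
  then have "wnorm v (b i * ?P - b' i * ?P') \<le> wnorm v (b i - b' i) * wnorm v ?P + wnorm v (b' i) * wnorm v (?P - ?P')"
    using order_trans[OF wnorm_add[OF assms(1)] add_mono[OF wnorm_mult[OF assms(1)] wnorm_mult[OF assms(1)]]]
    by (simp only:)
  also have "\<dots> \<le> \<delta> * \<beta> ^ ?n + \<beta> * (real ?n * \<beta> ^ (?n - 1) * \<delta>)"
    using assms Cons wnorm_prod_list[OF assms(1), of "map b w" \<beta>]
    by (intro add_mono mult_mono wnorm_nonneg) auto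
  also have "\<dots> = real (Suc ?n) * \<beta> ^ ?n * \<delta>"
    by (cases ?n) (simp_all add: algebra_simps)
  finally show ?case by simp
qed simp

lemma wnorm_taylor_diff:
  fixes b :: "'k::finite \<Rightarrow> 'd falg"
  assumes "0 \<le> v" "0 \<le> \<beta>" "0 \<le> \<delta>"
    and "\<And>i. wnorm v (b i) \<le> \<beta>" "\<And>i. wnorm v (b' i) \<le> \<beta>" "\<And>i. wnorm v (b i - b' i) \<le> \<delta>"
    and K: "\<And>w. length w < n \<Longrightarrow> \<bar>partial g w x\<bar> \<le> K (length w)"
  shows "wnorm v (taylor g n x b - taylor g n x b')
    \<le> (\<Sum>p<n. real CARD('k) ^ p * (K p * (real p * \<beta> ^ (p - 1)))) * \<delta>"
proof -
  have "taylor g n x b - taylor g n x b' = (\<Sum>p<n. scal (1 / fact p)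
      (\<Sum>w\<in>words p. scal (partial g w x) (prod_list (map b w) - prod_list (map b' w))))"
    by (simp add: taylor_def taylor_term_def scal_diff sum_subtractf)
  then have "wnorm v (taylor g n x b - taylor g n x b') \<le> (\<Sum>p<n. wnorm v (scal (1 / fact p)
      (\<Sum>w\<in>words p. scal (partial g w x) (prod_list (map b w) - prod_list (map b' w)))))"
    by (simp only: wnorm_sum[OF assms(1)])
  also have "\<dots> \<le> (\<Sum>p<n. \<Sum>w\<in>(words p :: 'k list set). K p * (real p * \<beta> ^ (p - 1) * \<delta>))"
  proof (rule sum_mono)
    fix p assume p: "p \<in> {..<n}"
    have summand: "wnorm v (scal (partial g w x) (prod_list (map b w) - prod_list (map b' w)))
        \<le> K p * (real p * \<beta> ^ (p - 1) * \<delta>)" if "w \<in> words p" for w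
    proof -
      have w: "length w = p" using that by (rule length_words)
      have Kw: "\<bar>partial g w x\<bar> \<le> K p" using K[of w] w p by simp
      then have "0 \<le> K p" by linarith
      then show ?thesis unfolding wnorm_scal
        using wnorm_prod_list_diff[where w = w, OF assms(1-6)] w Kw
        by (intro mult_mono wnorm_nonneg[OF assms(1)]) auto
    qed
    show "wnorm v (scal (1 / fact p) (\<Sum>w\<in>words p. scal (partial g w x)
        (prod_list (map b w) - prod_list (map b' w))))
        \<le> (\<Sum>w\<in>(words p :: 'k list set). K p * (real p * \<beta> ^ (p - 1) * \<delta>))"
      by (rule order_trans[OF wnorm_scal_inverse_fact[OF assms(1)]],
          rule order_trans[OF wnorm_sum[OF assms(1)]], rule sum_mono, rule summand)
  qed
  also have "\<dots> = (\<Sum>p<n. real CARD('k) ^ p * (K p * (real p * \<beta> ^ (p - 1)))) * \<delta>"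
    by (simp add: card_words sum_distrib_left mult_ac)
  finally show ?thesis .
qed

subsection \<open>Changing the base point\<close>

text \<open>Derivatives are taken forest by forest, so no topology on the forest algebra is involved
  and every rule reduces to one for real functions.\<close>

definition has_coeff_derivative :: "(real \<Rightarrow> 'd falg) \<Rightarrow> 'd falg \<Rightarrow> real \<Rightarrow> bool" where
  "has_coeff_derivative x x' r \<longleftrightarrow> (\<forall>f. ((\<lambda>r. lookup (x r) f) has_real_derivative lookup x' f) (at r))"

lemma scal_minus [simp]: "scal c (- x) = - scal c x" "scal (- c) x = - scal c x"
  by (rule poly_mapping_eqI, simp)+

lemma has_coeff_derivative_const: "has_coeff_derivative (\<lambda>r. a) 0 r"
  by (simp add: has_coeff_derivative_def)

lemma has_coeff_derivative_add:
  "has_coeff_derivative x x' r \<Longrightarrow> has_coeff_derivative y y' r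
    \<Longrightarrow> has_coeff_derivative (\<lambda>r. x r + y r) (x' + y') r"
  by (auto simp: has_coeff_derivative_def lookup_add intro!: derivative_eq_intros)

lemma has_coeff_derivative_sum:
  "(\<And>i. i \<in> A \<Longrightarrow> has_coeff_derivative (x i) (x' i) r)
    \<Longrightarrow> has_coeff_derivative (\<lambda>r. \<Sum>i\<in>A. x i r) (\<Sum>i\<in>A. x' i) r"
  by (auto simp: has_coeff_derivative_def lookup_sum intro!: derivative_eq_intros)

lemma has_coeff_derivative_scal:
  "(c has_real_derivative c') (at r) \<Longrightarrow> has_coeff_derivative x x' r
    \<Longrightarrow> has_coeff_derivative (\<lambda>r. scal (c r) (x r)) (scal c' (x r) + scal (c r) x') r"
  by (auto simp: has_coeff_derivative_def lookup_add intro!: derivative_eq_intros)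

lemma lookup_mult_single:
  "lookup (Poly_Mapping.single h c * x) (f :: 'd forest) = (if h \<subseteq># f then c * lookup x (f - h) else (0::real))"
proof -
  have "Poly_Mapping.single h c * x = (\<Sum>a\<in>keys x. Poly_Mapping.single (h + a) (c * lookup x a))"
    by (subst poly_mapping_expand[of x]) (simp add: sum_distrib_left mult_single)
  then have "lookup (Poly_Mapping.single h c * x) f = (\<Sum>a\<in>keys x. if h + a = f then c * lookup x a else 0)"
    by (simp add: lookup_sum lookup_single when_def)
  also have "\<dots> = (if h \<subseteq># f then c * lookup x (f - h) else 0)"
  proof (cases "h \<subseteq># f")
    case True
    then have "h + a = f \<longleftrightarrow> a = f - h" for a by (auto simp: subset_mset.add_diff_inverse)
    then show ?thesis using True by (simp add: in_keys_iff)
  next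
    case False
    then have "h + a \<noteq> f" for a by (metis mset_subset_eq_add_left)
    then show ?thesis using False by simp
  qed
  finally show ?thesis .
qed

lemma has_coeff_derivative_mult_left:
  assumes "has_coeff_derivative x x' r"
  shows "has_coeff_derivative (\<lambda>r. a * x r) (a * x') r"
proof -
  have "a * y = (\<Sum>h\<in>keys a. Poly_Mapping.single h (lookup a h) * y)" for y
    by (subst poly_mapping_expand[of a]) (simp add: sum_distrib_right)
  moreover have "has_coeff_derivative (\<lambda>r. Poly_Mapping.single h c * x r) (Poly_Mapping.single h c * x') r" for h c
    using assms by (auto simp: has_coeff_derivative_def lookup_mult_single intro!: derivative_eq_intros)
  ultimately show ?thesis
    by (simp only:) (intro has_coeff_derivative_sum)
qed

text \<open>The real mean value theorem is applied to a linear functional that norms the difference: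
  its coefficients are the signs of the difference times the weights.\<close>

lemma wnorm_diff_le_coeff_derivative:
  assumes "0 \<le> v" and "\<And>r. 0 \<le> r \<Longrightarrow> r \<le> 1 \<Longrightarrow> has_coeff_derivative x (x' r) r"
    and "\<And>r. 0 \<le> r \<Longrightarrow> r \<le> 1 \<Longrightarrow> wnorm v (x' r) \<le> M"
  shows "wnorm v (x 1 - x 0) \<le> M"
proof -
  let ?z = "x 1 - x 0"
  let ?e = "\<lambda>f. sgn (lookup ?z f) * v ^ forest_size f"
  define l where "l = (\<lambda>y. \<Sum>f\<in>keys ?z. ?e f * lookup y f)"
  have "((\<lambda>r. l (x r)) has_real_derivative l (x' r)) (at r)" if "0 \<le> r" "r \<le> 1" for r
    using assms(2)[OF that] unfolding l_def has_coeff_derivative_def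
    by (auto intro!: derivative_eq_intros sum.cong simp: mult_ac)
  from MVT2[of 0 1 "\<lambda>r. l (x r)" "\<lambda>r. l (x' r)", OF _ this]
  obtain r where r: "0 < r" "r < 1" "l (x 1) - l (x 0) = l (x' r)" by auto
  have "wnorm v ?z = l ?z"
    by (simp add: wnorm_def l_def abs_sgn mult_ac)
  also have "\<dots> = l (x 1) - l (x 0)"
    by (simp add: l_def lookup_minus algebra_simps sum_subtractf)
  also have "\<dots> = l (x' r)" by (rule r(3))
  also have "\<dots> \<le> (\<Sum>f\<in>keys ?z. \<bar>lookup (x' r) f\<bar> * v ^ forest_size f)"
    unfolding l_def
  proof (rule sum_mono)
    fix f
    have "sgn (lookup ?z f) * lookup (x' r) f \<le> \<bar>lookup (x' r) f\<bar>"
      by (auto simp: sgn_real_def)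
    then have "sgn (lookup ?z f) * lookup (x' r) f * v ^ forest_size f \<le> \<bar>lookup (x' r) f\<bar> * v ^ forest_size f"
      using assms(1) by (intro mult_right_mono) auto
    then show "?e f * lookup (x' r) f \<le> \<bar>lookup (x' r) f\<bar> * v ^ forest_size f"
      by (simp add: mult_ac)
  qed
  also have "\<dots> \<le> wnorm v (x' r)"
    using assms(1) unfolding wnorm_eq_sum[of "keys ?z \<union> keys (x' r)" "x' r", simplified]
    by (intro sum_mono2) auto
  also have "\<dots> \<le> M" using assms(3) r by simp
  finally show ?thesis .
qed

context
  fixes c :: "real ^ 'k::finite" and a :: "'k \<Rightarrow> 'd falg"
begin

text \<open>The increment that belongs to the base point \<open>x + r *\<^sub>R c\<close>: as the
  base point advances by \<open>r *\<^sub>R c\<close>, the scalar part of the increment shrinks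
  accordingly. At \<open>r = 1\<close> only \<open>a\<close> remains.\<close>

definition shifted :: "real \<Rightarrow> 'k \<Rightarrow> 'd falg" where
  "shifted r i = scal ((1 - r) * c $ i) 1 + a i"

text \<open>The Leibniz rule for the product of shifted increments along a word; each factor has
  derivative minus \<open>c $ i\<close> times the unit.\<close>

primrec dword :: "real \<Rightarrow> 'k list \<Rightarrow> 'd falg" where
  "dword r [] = 0"
| "dword r (i # w) = shifted r i * dword r w - scal (c $ i) (prod_list (map (shifted r) w))"

lemma has_coeff_derivative_word:
  "has_coeff_derivative (\<lambda>r. prod_list (map (shifted r) w)) (dword r w) r"
proof (induction w)
  case Nil
  then show ?case using has_coeff_derivative_const by simp
next
  case (Cons i w)
  let ?P = "\<lambda>r. prod_list (map (shifted r) w)"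
  have "((\<lambda>r. (1 - r) * c $ i) has_real_derivative - c $ i) (at r)"
    by (auto intro!: derivative_eq_intros)
  note D = has_coeff_derivative_add[OF has_coeff_derivative_scal[OF this Cons]
      has_coeff_derivative_mult_left[OF Cons, of "a i"]]
  have 1: "(\<lambda>r. scal ((1 - r) * c $ i) (?P r) + a i * ?P r) = (\<lambda>r. prod_list (map (shifted r) (i # w)))"
    by (simp add: shifted_def distrib_right scal_mult_left)
  have 2: "scal (- c $ i) (?P r) + scal ((1 - r) * c $ i) (dword r w) + a i * dword r w = dword r (i # w)"
    by (simp add: shifted_def distrib_right scal_mult_left)
  show ?case using D unfolding 1 2 .
qed

text \<open>Symmetric coefficients make all \<open>Suc p\<close> positions of the differentiated
  letter equivalent. In the induction the first letter either is the differentiated one or is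
  exchanged with it.\<close>

lemma sum_dword:
  assumes "\<And>u i j w. length u + 2 + length w = Suc p \<Longrightarrow> \<Phi> (u @ i # j # w) = \<Phi> (u @ j # i # w)"
  shows "(\<Sum>w\<in>words (Suc p). scal (\<Phi> w) (dword r w))
    = - scal (real (Suc p)) (\<Sum>j\<in>UNIV. \<Sum>w\<in>words p. scal (\<Phi> (j # w) * c $ j) (prod_list (map (shifted r) w)))"
  using assms
proof (induction p arbitrary: \<Phi>)
  case 0
  show ?case by (simp add: sum_words_Suc sum_negf)
next
  case (Suc p)
  let ?P = "\<lambda>w. prod_list (map (shifted r) w)"
  let ?S = "\<Sum>j\<in>UNIV. \<Sum>w\<in>words (Suc p). scal (\<Phi> (j # w) * c $ j) (?P w)"
  have IH: "(\<Sum>w\<in>words (Suc p). scal (\<Phi> (i # w)) (dword r w))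
      = - scal (real (Suc p)) (\<Sum>j\<in>UNIV. \<Sum>w\<in>words p. scal (\<Phi> (i # j # w) * c $ j) (?P w))" for i
  proof (rule Suc.IH)
    fix u w :: "'k list" and i' j assume "length u + 2 + length w = Suc p"
    then show "\<Phi> (i # u @ i' # j # w) = \<Phi> (i # u @ j # i' # w)"
      using Suc.prems[of "i # u" w i' j] by simp
  qed
  have "(\<Sum>w\<in>words (Suc (Suc p)). scal (\<Phi> w) (dword r w))
      = (\<Sum>i\<in>UNIV. shifted r i * (\<Sum>w\<in>words (Suc p). scal (\<Phi> (i # w)) (dword r w))) - ?S"
    by (simp add: sum_words_Suc[of _ "Suc p"] scal_diff sum_subtractf sum_distrib_left scal_mult_right)
  also have "(\<Sum>i\<in>UNIV. shifted r i * (\<Sum>w\<in>words (Suc p). scal (\<Phi> (i # w)) (dword r w)))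
      = - scal (real (Suc p)) (\<Sum>i\<in>UNIV. \<Sum>j\<in>UNIV. \<Sum>w\<in>words p. scal (\<Phi> (i # j # w) * c $ j) (?P (i # w)))"
    unfolding IH by (simp add: sum_distrib_left scal_sum scal_mult_right sum_negf)
  also have "(\<Sum>i\<in>UNIV. \<Sum>j\<in>UNIV. \<Sum>w\<in>words p. scal (\<Phi> (i # j # w) * c $ j) (?P (i # w))) = ?S"
  proof -
    have "\<Phi> (i # j # w) = \<Phi> (j # i # w)" if "w \<in> words p" for i j w
      using Suc.prems[of "[]" w i j] length_words[OF that] by simp
    then show ?thesis
      by (subst sum.swap) (simp add: sum_words_Suc cong: sum.cong)
  qed
  also have "- scal (real (Suc p)) ?S - ?S = - scal (real (Suc (Suc p))) ?S"
    by (rule poly_mapping_eqI) (simp add: lookup_minus algebra_simps)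
  finally show ?case .
qed

text \<open>Moving the base point from \<open>x\<close> to \<open>x + c\<close> along a segment, the derivatives of
  consecutive Taylor terms cancel and only the term of order \<open>n\<close> survives.\<close>

lemma wnorm_taylor_shift:
  fixes g :: "real ^ 'k \<Rightarrow> real"
  assumes g: "C_class n g" and n: "0 < n" and v: "0 \<le> v" and "0 \<le> \<beta>" "0 \<le> \<gamma>" "0 \<le> K"
    and b: "\<And>r i. 0 \<le> r \<Longrightarrow> r \<le> 1 \<Longrightarrow> wnorm v (shifted r i) \<le> \<beta>"
    and c: "\<And>i. \<bar>c $ i\<bar> \<le> \<gamma>"
    and K: "\<And>r w. 0 \<le> r \<Longrightarrow> r \<le> 1 \<Longrightarrow> length w = n \<Longrightarrow> \<bar>partial g w (x + r *\<^sub>R c)\<bar> \<le> K"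
  shows "wnorm v (taylor g n (x + c) a - taylor g n x (\<lambda>i. scal (c $ i) 1 + a i))
    \<le> real CARD('k) ^ n * (K * \<gamma> * \<beta> ^ (n - 1))"
proof -
  define P where "P = (\<lambda>r w. prod_list (map (shifted r) w))"
  define T where "T = (\<lambda>r p. \<Sum>j\<in>UNIV. \<Sum>w\<in>words p. scal (partial g (j # w) (x + r *\<^sub>R c) * c $ j) (P r w))"
  define G where "G = (\<lambda>r. taylor g n (x + r *\<^sub>R c) (shifted r))"
  have swap: "(\<Sum>w\<in>words p. scal (\<Sum>j\<in>UNIV. c $ j * partial g (j # w) y) (P r w))
      = (\<Sum>j\<in>UNIV. \<Sum>w\<in>words p. scal (partial g (j # w) y * c $ j) (P r w))" for p y r
    by (simp add: scal_sum_left mult.commute) (rule sum.swap)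
  have deriv: "has_coeff_derivative G (scal (1 / fact (n - 1)) (T r (n - 1))) r" for r
  proof -
    let ?y = "x + r *\<^sub>R c"
    have dp: "((\<lambda>r. partial g w (x + r *\<^sub>R c)) has_real_derivative (\<Sum>j\<in>UNIV. c $ j * partial g (j # w) ?y)) (at r)"
      if "length w < n" for w
      using has_real_derivative_along_line[OF differentiable_partial[OF g that], where x = x and t = r and v = c]
        frechet_derivative_coordinates[OF differentiable_partial[OF g that], of ?y c]
      by (simp add: partial_Cons)
    have deriv_term: "has_coeff_derivative (\<lambda>r. scal (1 / fact p) (taylor_term g p (x + r *\<^sub>R c) (shifted r)))
        (scal (1 / fact p) (T r p + (\<Sum>w\<in>words p. scal (partial g w ?y) (dword r w)))) r"
      if "p < n" for p
    proof -
      have "has_coeff_derivative (\<lambda>r. taylor_term g p (x + r *\<^sub>R c) (shifted r))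
        (\<Sum>w\<in>words p. scal (\<Sum>j\<in>UNIV. c $ j * partial g (j # w) ?y) (P r w)
          + scal (partial g w ?y) (dword r w)) r"
        unfolding taylor_term_def P_def using that
        by (intro has_coeff_derivative_sum has_coeff_derivative_scal has_coeff_derivative_word dp)
          (simp add: length_words)
      then have "has_coeff_derivative (\<lambda>r. taylor_term g p (x + r *\<^sub>R c) (shifted r))
        (T r p + (\<Sum>w\<in>words p. scal (partial g w ?y) (dword r w))) r"
        by (simp add: sum.distrib swap T_def)
      from has_coeff_derivative_scal[OF DERIV_const this, of "1 / fact p"] show ?thesis by simp
    qed
    have "has_coeff_derivative G
        (\<Sum>p<n. scal (1 / fact p) (T r p + (\<Sum>w\<in>words p. scal (partial g w ?y) (dword r w)))) r"
      unfolding G_def taylor_def using deriv_term by (intro has_coeff_derivative_sum) simp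
    \<comment> \<open>Differentiating the increments turns order p into -p T(p-1) / p!, so each
      summand is T(p) / p! - T(p-1) / (p-1)! and the partial sums telescope.\<close>
    moreover have "(\<Sum>p<m. scal (1 / fact p) (T r p + (\<Sum>w\<in>words p. scal (partial g w ?y) (dword r w))))
        = (if m = 0 then 0 else scal (1 / fact (m - 1)) (T r (m - 1)))" if "m \<le> n" for m
      using that
    proof (induction m)
      case (Suc m)
      show ?case
      proof (cases m)
        case (Suc p)
        have "(\<Sum>w\<in>words m. scal (partial g w ?y) (dword r w)) = - scal (real m) (T r p)"
          unfolding Suc T_def P_def
          by (rule sum_dword, rule fun_cong[OF partial_swap[OF g]]) (use Suc.prems Suc in simp)
        then have "scal (1 / fact m) (T r m + (\<Sum>w\<in>words m. scal (partial g w ?y) (dword r w)))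
            = scal (1 / fact m) (T r m) - scal (1 / fact p) (T r p)"
          by (simp add: Suc scal_diff del: of_nat_Suc)
        then show ?thesis using Suc Suc.IH Suc.prems by simp
      qed simp
    qed simp
    ultimately show ?thesis using n by simp
  qed
  have "wnorm v (scal (1 / fact (n - 1)) (T r (n - 1))) \<le> real CARD('k) ^ n * (K * \<gamma> * \<beta> ^ (n - 1))"
    if r: "0 \<le> r" "r \<le> 1" for r
  proof -
    have "wnorm v (T r (n - 1)) \<le> (\<Sum>j\<in>UNIV. \<Sum>w\<in>words (n - 1).
        wnorm v (scal (partial g (j # w) (x + r *\<^sub>R c) * c $ j) (P r w)))"
      unfolding T_def by (rule order_trans[OF wnorm_sum[OF v]], rule sum_mono, rule wnorm_sum[OF v])
    also have "\<dots> \<le> (\<Sum>j\<in>(UNIV :: 'k set). \<Sum>w\<in>(words (n - 1) :: 'k list set). K * \<gamma> * \<beta> ^ (n - 1))"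
    proof (intro sum_mono)
      fix j :: 'k and w :: "'k list" assume "w \<in> words (n - 1)"
      then have w: "length w = n - 1" by (rule length_words)
      have "\<bar>partial g (j # w) (x + r *\<^sub>R c) * c $ j\<bar> \<le> K * \<gamma>"
        unfolding abs_mult using K[OF r, of "j # w"] w n c assms by (intro mult_mono) auto
      moreover have "wnorm v (P r w) \<le> \<beta> ^ (n - 1)"
        using wnorm_prod_list[OF v, of "map (shifted r) w" \<beta>] b[OF r] w \<open>0 \<le> \<beta>\<close> by (auto simp: P_def)
      ultimately show "wnorm v (scal (partial g (j # w) (x + r *\<^sub>R c) * c $ j) (P r w)) \<le> K * \<gamma> * \<beta> ^ (n - 1)"
        unfolding wnorm_scal using assms by (intro mult_mono wnorm_nonneg[OF v]) auto
    qed
    also have "\<dots> = real CARD('k) ^ n * (K * \<gamma> * \<beta> ^ (n - 1))"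
      using n by (simp add: card_words power_eq_if[of _ n])
    finally show ?thesis by (rule order_trans[OF wnorm_scal_inverse_fact[OF v]])
  qed
  from wnorm_diff_le_coeff_derivative[OF v deriv this]
  have "wnorm v (G 1 - G 0) \<le> real CARD('k) ^ n * (K * \<gamma> * \<beta> ^ (n - 1))" .
  moreover have "G 1 = taylor g n (x + c) a" "G 0 = taylor g n x (\<lambda>i. scal (c $ i) 1 + a i)"
    by (simp_all add: G_def shifted_def[abs_def])
  ultimately show ?thesis by simp
qed

end

section \<open>Solutions as paths in the forest algebra\<close>

lemma proj_le_add: "proj_le n (x + y) = proj_le n x + proj_le n y"
  by (simp add: proj_le_def lin_ext_add)

lemma proj_le_scal: "proj_le n (scal c x) = scal c (proj_le n x)"
  by (simp add: proj_le_def lin_ext_scal)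

lemma proj_le_eq_0: "(\<And>f. f \<in> keys x \<Longrightarrow> n < forest_size f) \<Longrightarrow> proj_le n x = 0"
  by (rule poly_mapping_eqI) (force simp: lookup_proj_le in_keys_iff)

lemma proj_le_eq_self: "(\<And>f. f \<in> keys x \<Longrightarrow> forest_size f \<le> n) \<Longrightarrow> proj_le n x = x"
  by (rule poly_mapping_eqI) (force simp: lookup_proj_le in_keys_iff)

text \<open>Forests with more than \<open>n\<close> vertices span an ideal, since vertex counts add
  up under the product.\<close>

lemma proj_le_mult: "proj_le n (x * y) = proj_le n (proj_le n x * proj_le n y)"
proof -
  have zero: "proj_le n (u * (v - proj_le n v)) = 0" for u v :: "'a falg"
  proof (rule proj_le_eq_0)
    fix f assume "f \<in> keys (u * (v - proj_le n v))"
    then obtain g h where "h \<in> keys (v - proj_le n v)" "f = g + h"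
      using keys_mult[of u "v - proj_le n v"] by auto
    then show "n < forest_size f" using keys_co_proj_le[of h v n] by simp
  qed
  have "x * y = proj_le n x * proj_le n y + (proj_le n x * (y - proj_le n y) + y * (x - proj_le n x))"
    by (simp add: algebra_simps)
  then show ?thesis by (simp add: proj_le_add zero)
qed

lemma proj_le_prod_list:
  "proj_le n (prod_list (map b w)) = proj_le n (prod_list (map (\<lambda>i. proj_le n (b i)) w))"
proof (induction w)
  case (Cons i w)
  show ?case
    by (simp only: list.map prod_list.Cons)
      (metis proj_le_mult Cons.IH proj_le_eq_self lookup_proj_le in_keys_iff)
qed simp

text \<open>Up to \<open>n\<close> vertices a Taylor polynomial sees only the increments up to
  \<open>n\<close> vertices. Since grafting adds a vertex, this yields a recursion on tree
  size.\<close>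

lemma proj_le_taylor:
  "proj_le n (taylor g m x b) = proj_le n (taylor g m x (\<lambda>i. proj_le n (b i)))"
  unfolding taylor_def taylor_term_def proj_le_sum proj_le_scal
  by (subst proj_le_prod_list) (rule refl)

lemma sum_lists_Suc:
  "(\<Sum>hs | length hs = Suc p \<and> set hs \<subseteq> T. f hs)
    = (\<Sum>h\<in>T. \<Sum>hs | length hs = p \<and> set hs \<subseteq> T. f (h # hs))"
proof -
  have eq: "{hs. length hs = Suc p \<and> set hs \<subseteq> T}
      = (\<lambda>(h, hs). h # hs) ` (T \<times> {hs. length hs = p \<and> set hs \<subseteq> T})"
    by (auto simp: length_Suc_conv image_iff)
  have inj: "inj_on (\<lambda>(h, hs). h # hs) (T \<times> {hs. length hs = p \<and> set hs \<subseteq> T})"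
    by (auto simp: inj_on_def)
  have "(\<Sum>hs | length hs = Suc p \<and> set hs \<subseteq> T. f hs)
      = (\<Sum>(h, hs)\<in>T \<times> {hs. length hs = p \<and> set hs \<subseteq> T}. f (h # hs))"
    unfolding eq sum.reindex[OF inj] by (simp add: comp_def split_def)
  then show ?thesis by (simp add: sum.cartesian_product)
qed

lemma basis_empty: "basis {#} = (1 :: 'd falg)"
  by (simp flip: single_one zero_multiset_def)

text \<open>Multiplying out replaces words of increments by lists of trees, the index set of
  \<open>compose_path\<close>; different lists with the same multiset remain separate
  summands.\<close>

lemma prod_list_expand:
  fixes v :: "'d rtree \<Rightarrow> real ^ 'k"
  shows "prod_list (map (\<lambda>i. \<Sum>h\<in>T. Poly_Mapping.single {#h#} (v h $ i)) w)
    = (\<Sum>hs | length hs = length w \<and> set hs \<subseteq> T.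
        Poly_Mapping.single (mset hs) (prod_list (map2 (\<lambda>v i. v $ i) (map v hs) w)))"
proof (induction w)
  case Nil
  have "{hs :: 'd rtree list. hs = [] \<and> set hs \<subseteq> T} = {[]}" by auto
  then show ?case by (simp add: basis_empty)
next
  case (Cons i w)
  let ?c = "\<lambda>hs. prod_list (map2 (\<lambda>v i. v $ i) (map v hs) w)"
  have "prod_list (map (\<lambda>i. \<Sum>h\<in>T. Poly_Mapping.single {#h#} (v h $ i)) (i # w))
      = (\<Sum>h\<in>T. \<Sum>hs | length hs = length w \<and> set hs \<subseteq> T.
          Poly_Mapping.single ({#h#} + mset hs) (v h $ i * ?c hs))"
    unfolding list.map prod_list.Cons Cons.IH sum_product mult_single ..
  also have "\<dots> = (\<Sum>hs | length hs = length (i # w) \<and> set hs \<subseteq> T.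
      Poly_Mapping.single (mset hs) (prod_list (map2 (\<lambda>v i. v $ i) (map v hs) (i # w))))"
    unfolding list.size add_0_right add_Suc_right sum_lists_Suc by simp
  finally show ?case .
qed

locale rde_solution =
  fixes m \<alpha> :: real and N :: nat and X :: "'d::finite rough_map"
    and \<sigma> :: "real ^ 'k::finite \<Rightarrow> real ^ 'd ^ 'k" and y0 :: "real ^ 'k" and Y :: "('d, 'k) fpath"
  assumes N_pos: "0 < N" and m_gt_1: "1 < m" and \<alpha>_pos: "0 < \<alpha>"
    and N\<alpha>: "real N * \<alpha> \<le> 1" "1 < (real N + 1) * \<alpha>"
    and rough: "rough_path \<alpha> N X" and smooth: "C_class N \<sigma>"
    and solution: "is_solution m \<alpha> N X \<sigma> y0 Y"
begin

text \<open>\<open>a\<close> is the paper's \<open>\<delta>\<^bold>Y\<close>, \<open>U \<mu>\<close> is \<open>\<sigma>\<^sub>\<mu>(\<^bold>Y)\<close>, and \<open>V \<mu>\<close> is the part of \<open>U \<mu>\<close> that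
  enters the tree coefficients of the solution.\<close>

definition y :: "real \<Rightarrow> real ^ 'k" where "y s = coef {#} (Y s)"

definition a :: "real \<Rightarrow> 'k \<Rightarrow> 'd falg" where
  "a s i = (\<Sum>h\<in>trees (N - 1). Poly_Mapping.single {#h#} (coef {#h#} (Y s) $ i))"

definition \<sigma>c :: "'d \<Rightarrow> 'k \<Rightarrow> real ^ 'k \<Rightarrow> real" where
  "\<sigma>c \<mu> i x = \<sigma> x $ i $ \<mu>"

definition U :: "'d \<Rightarrow> real \<Rightarrow> 'k \<Rightarrow> 'd falg" where
  "U \<mu> s i = compose_path N (\<lambda>x. column \<mu> (\<sigma> x)) Y s $ i"

definition V :: "'d \<Rightarrow> real \<Rightarrow> 'k \<Rightarrow> 'd falg" where
  "V \<mu> s i = lin_ext (\<lambda>f. if forest_size f + 2 \<le> N then basis f else 0) (U \<mu> s i)"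

abbreviation \<Phi> :: "real \<Rightarrow> real \<Rightarrow> 'd forest \<Rightarrow> real" where
  "\<Phi> s t \<equiv> tree_char N (X s t)"

lemma bounded_linear_entry: "bounded_linear (\<lambda>A :: real ^ 'd ^ 'k. A $ i $ \<mu>)"
  by (rule bounded_linear_compose[OF bounded_linear_vec_nth bounded_linear_vec_nth])

lemma \<sigma>c_C_class: "C_class N (\<sigma>c \<mu> i)"
  using C_class_linear_comp[OF bounded_linear_entry smooth] by (simp add: \<sigma>c_def[abs_def])

lemma abs_partial_\<sigma>c_le:
  assumes "length w \<le> N" shows "\<bar>partial (\<sigma>c \<mu> i) w x\<bar> \<le> norm (partial \<sigma> w x)"
proof -
  have "partial (\<sigma>c \<mu> i) w x = partial \<sigma> w x $ i $ \<mu>"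
    using iter_deriv_linear_comp[OF bounded_linear_entry smooth, of "map (\<lambda>i. axis i 1) w"] assms
    by (simp add: partial_def \<sigma>c_def[abs_def])
  then show ?thesis
    using component_le_norm_cart[of "partial \<sigma> w x $ i" \<mu>] Finite_Cartesian_Product.norm_nth_le[where x = "partial \<sigma> w x" and i = i] by simp
qed

lemma iter_deriv_column:
  assumes "length vs < N"
  shows "iter_deriv (\<lambda>x. column \<mu> (\<sigma> x)) vs x $ i = iter_deriv (\<sigma>c \<mu> i) vs x"
proof -
  have lin: "bounded_linear (\<lambda>A :: real ^ 'd ^ 'k. column \<mu> A)"
    unfolding linear_conv_bounded_linear[symmetric]
    by (rule linearI) (simp_all add: column_def vec_eq_iff)
  have "bounded_linear (\<lambda>x :: real ^ 'k. x $ i)" by (rule bounded_linear_vec_nth)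
  from iter_deriv_linear_comp[OF this C_class_linear_comp[OF lin smooth], of vs] assms
  show ?thesis by (simp add: column_def \<sigma>c_def[abs_def])
qed

text \<open>The sum over lists of trees and the sum over words of coordinates are two expansions of
  the same multilinear form, so exchanging the sums identifies the composition with a truncated
  Taylor polynomial.\<close>

lemma U_eq_taylor: "U \<mu> s i = proj_le (N - 1) (taylor (\<sigma>c \<mu> i) N (y s) (a s))"
proof -
  let ?g = "\<sigma>c \<mu> i" and ?v = "\<lambda>h. coef {#h#} (Y s)" and ?T = "trees (N - 1) :: 'd rtree set"
  have order_p: "(\<Sum>hs | length hs = p \<and> set hs \<subseteq> ?T.
      Poly_Mapping.single (mset hs) (1 / fact p * iter_deriv (\<lambda>x. column \<mu> (\<sigma> x)) (map ?v hs) (y s) $ i))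
    = scal (1 / fact p) (taylor_term ?g p (y s) (a s))" if "p < N" for p
  proof -
    have "taylor_term ?g p (y s) (a s) = (\<Sum>w\<in>words p. \<Sum>hs | length hs = p \<and> set hs \<subseteq> ?T.
        Poly_Mapping.single (mset hs) (partial ?g w (y s) * prod_list (map2 (\<lambda>v i. v $ i) (map ?v hs) w)))"
      unfolding taylor_term_def a_def[abs_def] prod_list_expand
      by (intro sum.cong) (simp_all add: scal_sum length_words)
    also have "\<dots> = (\<Sum>hs | length hs = p \<and> set hs \<subseteq> ?T. \<Sum>w\<in>words p.
        Poly_Mapping.single (mset hs) (partial ?g w (y s) * prod_list (map2 (\<lambda>v i. v $ i) (map ?v hs) w)))"
      by (rule sum.swap)
    also have "\<dots> = (\<Sum>hs | length hs = p \<and> set hs \<subseteq> ?T.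
        Poly_Mapping.single (mset hs) (iter_deriv (\<lambda>x. column \<mu> (\<sigma> x)) (map ?v hs) (y s) $ i))"
    proof (rule sum.cong[OF refl])
      fix hs assume "hs \<in> {hs. length hs = p \<and> set hs \<subseteq> ?T}"
      then have len: "length (map ?v hs) = p" by simp
      have "iter_deriv (\<lambda>x. column \<mu> (\<sigma> x)) (map ?v hs) (y s) $ i
          = (\<Sum>w\<in>words p. partial ?g w (y s) * prod_list (map2 (\<lambda>v i. v $ i) (map ?v hs) w))"
        using iter_deriv_column[of "map ?v hs"] iter_deriv_coordinates[OF \<sigma>c_C_class, of "map ?v hs"] len that
        by simp
      then show "(\<Sum>w\<in>words p. Poly_Mapping.single (mset hs)
            (partial ?g w (y s) * prod_list (map2 (\<lambda>v i. v $ i) (map ?v hs) w)))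
          = Poly_Mapping.single (mset hs) (iter_deriv (\<lambda>x. column \<mu> (\<sigma> x)) (map ?v hs) (y s) $ i)"
        by (intro poly_mapping_eqI) (simp add: lookup_sum lookup_single when_def)
    qed
    finally show ?thesis by (simp add: scal_sum)
  qed
  have zero: "taylor_term ?g 0 (y s) (a s) = Poly_Mapping.single {#} (?g (y s))"
    by (simp add: taylor_term_def partial_def scal_eq_mult)
  have "{..<N} = insert 0 {1..N - 1}" using N_pos by auto
  then have "taylor ?g N (y s) (a s) = Poly_Mapping.single {#} (?g (y s))
      + (\<Sum>p=1..N - 1. scal (1 / fact p) (taylor_term ?g p (y s) (a s)))"
    by (simp add: taylor_def zero)
  moreover have "(\<Sum>p=1..N - 1. scal (1 / fact p) (taylor_term ?g p (y s) (a s)))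
      = (\<Sum>p = 1..N - 1. \<Sum>hs | length hs = p \<and> set hs \<subseteq> ?T.
          vsingle ((1 / fact p) *\<^sub>R iter_deriv (\<lambda>x. column \<mu> (\<sigma> x)) (map ?v hs) (y s)) (mset hs)) $ i"
  proof -
    have "scal (1 / fact p) (taylor_term ?g p (y s) (a s))
        = (\<Sum>hs | length hs = p \<and> set hs \<subseteq> ?T.
          vsingle ((1 / fact p) *\<^sub>R iter_deriv (\<lambda>x. column \<mu> (\<sigma> x)) (map ?v hs) (y s)) (mset hs) $ i)"
      if "p \<in> {1..N - 1}" for p
      using that N_pos by (subst order_p[symmetric]) (auto simp: vsingle_def)
    then show ?thesis by (simp only: sum_component) (rule sum.cong, simp_all)
  qed
  \<comment> \<open>In \<open>compose_path\<close> the constant term stands outside the projection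
    and here it stands inside; the empty forest survives every truncation.\<close>
  moreover have "proj_le n (Poly_Mapping.single {#} c) = (Poly_Mapping.single {#} c :: 'd falg)" for n c
    by (rule proj_le_eq_self) (simp split: if_splits)
  ultimately show ?thesis
    by (simp add: U_def compose_path_def proj_le_add vsingle_def y_def \<sigma>c_def column_def)
qed

section \<open>The equation read off coefficient by coefficient\<close>

definition drift :: "real \<Rightarrow> real \<Rightarrow> real ^ 'k" where
  "drift s t = integral {s..t} (\<lambda>r. norm (y r) powr (m - 1) *\<^sub>R y r)"

definition solves_with :: "('d \<Rightarrow> real \<Rightarrow> real ^ 'k) \<Rightarrow> bool" where
  "solves_with J \<longleftrightarrow>
    (\<forall>\<mu>. \<forall>s \<in> {0..1}. has_rough_integral N X (compose_path N (\<lambda>x. column \<mu> (\<sigma> x)) Y) \<mu> 0 s (J \<mu> s)) \<and>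
    (\<forall>s \<in> {0..1}. Y s = vsingle y0 {#} - vsingle (drift 0 s) {#}
       + ((\<Sum>\<mu> \<in> UNIV. vsingle (J \<mu> s) {#})
          + (\<Sum>\<mu> \<in> UNIV. \<Sum>f \<in> forests_upto N (int N - 2).
               vsingle (coef f (compose_path N (\<lambda>x. column \<mu> (\<sigma> x)) Y s)) (graft \<mu> f))))"

definition J :: "'d \<Rightarrow> real \<Rightarrow> real ^ 'k" where "J = (SOME J. solves_with J)"

lemma solves_with_J: "solves_with J"
proof -
  have "\<exists>J. solves_with J"
    using solution unfolding is_solution_def Let_def solves_with_def drift_def y_def by blast
  then show ?thesis unfolding J_def by (rule someI_ex)
qed

lemma rough_integral_J:
  "s \<in> {0..1} \<Longrightarrow> has_rough_integral N X (compose_path N (\<lambda>x. column \<mu> (\<sigma> x)) Y) \<mu> 0 s (J \<mu> s)"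
  using solves_with_J unfolding solves_with_def by blast

text \<open>Writing the cut-off as \<open>forest_size f + 2 \<le> N\<close> agrees with the integer
  bound \<open>N - 2\<close> also for \<open>N = 1\<close>, where nothing is kept; truncated
  subtraction would keep the empty forest.\<close>

lemma V_eq_sum: "V \<mu> s i = (\<Sum>f\<in>forests_upto N (int N - 2). Poly_Mapping.single f (lookup (U \<mu> s i) f))"
proof (rule poly_mapping_eqI)
  fix k :: "'d forest"
  have iff: "k \<in> forests_upto N (int N - 2) \<longleftrightarrow> forest_size k + 2 \<le> N"
    using forests_if_size_le[of k N] by (auto simp: forests_upto_def)
  have "lookup (\<Sum>f\<in>forests_upto N (int N - 2). Poly_Mapping.single f (lookup (U \<mu> s i) f)) k
      = (\<Sum>f\<in>forests_upto N (int N - 2). if f = k then lookup (U \<mu> s i) f else 0)"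
    by (simp only: lookup_sum lookup_single when_def)
  also have "\<dots> = (if k \<in> forests_upto N (int N - 2) then lookup (U \<mu> s i) k else 0)"
    by simp
  finally show "lookup (V \<mu> s i) k
      = lookup (\<Sum>f\<in>forests_upto N (int N - 2). Poly_Mapping.single f (lookup (U \<mu> s i) f)) k"
    unfolding iff V_def lookup_lin_ext_filter by simp
qed

lemma lookup_Graft_empty [simp]: "lookup (Graft \<mu> x) {#} = 0"
  using keys_Graft[of \<mu> x] by (auto simp: in_keys_iff graft_def)

lemma Y_component:
  assumes "s \<in> {0..1}"
  shows "Y s $ i = Poly_Mapping.single {#} (y0 $ i - drift 0 s $ i + (\<Sum>\<mu>\<in>UNIV. J \<mu> s $ i))
    + (\<Sum>\<mu>\<in>UNIV. Graft \<mu> (V \<mu> s i))"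
proof -
  have "(\<Sum>f\<in>forests_upto N (int N - 2). Poly_Mapping.single (graft \<mu> f) (lookup (U \<mu> s i) f)) = Graft \<mu> (V \<mu> s i)" for \<mu>
    by (simp add: V_eq_sum Graft_def lin_ext_sum)
  moreover have "(\<Sum>\<mu>\<in>UNIV. Poly_Mapping.single {#} (J \<mu> s $ i)) = Poly_Mapping.single {#} (\<Sum>\<mu>\<in>UNIV. J \<mu> s $ i)"
    by (rule poly_mapping_eqI) (simp add: lookup_sum lookup_single when_def)
  ultimately show ?thesis
    using solves_with_J assms unfolding solves_with_def
    by (simp add: vsingle_def coef_def U_def single_add single_diff)
qed

lemma y_eq:
  assumes "s \<in> {0..1}"
  shows "y s = y0 - drift 0 s + (\<Sum>\<mu>\<in>UNIV. J \<mu> s)"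
  by (simp add: vec_eq_iff y_def coef_def Y_component[OF assms] lookup_add lookup_sum)

lemma Y_eq_y_a:
  assumes "s \<in> {0..1}" shows "Y s $ i = Poly_Mapping.single {#} (y s $ i) + a s i"
proof -
  have keys: "keys (Y s $ i) \<subseteq> trees1 (N - 1)"
    using solution assms by (simp add: is_solution_def tree_path_def fspan_def)
  have "Y s $ i = (\<Sum>f\<in>trees1 (N - 1). Poly_Mapping.single f (lookup (Y s $ i) f))"
  proof (subst poly_mapping_expand, rule sum.mono_neutral_left)
    show "finite (trees1 (N - 1) :: 'd forest set)" by (simp add: trees1_def)
  qed (use keys in \<open>auto simp: in_keys_iff\<close>)
  also have "\<dots> = Poly_Mapping.single {#} (lookup (Y s $ i) {#})
      + (\<Sum>f\<in>(\<lambda>h. {#h#}) ` trees (N - 1). Poly_Mapping.single f (lookup (Y s $ i) f))"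
    unfolding trees1_def by (subst sum.insert) auto
  also have "\<dots> = Poly_Mapping.single {#} (y s $ i) + a s i"
    by (simp add: y_def coef_def a_def sum.reindex inj_on_def)
  finally show ?thesis .
qed

text \<open>The two descriptions of \<open>Y\<close> have the same coefficient at the empty forest;
  cancelling it leaves a fixed-point equation for the tree part.\<close>

lemma a_eq: assumes "s \<in> {0..1}" shows "a s i = (\<Sum>\<mu>\<in>UNIV. Graft \<mu> (V \<mu> s i))"
proof -
  have "y s $ i = y0 $ i - drift 0 s $ i + (\<Sum>\<mu>\<in>UNIV. J \<mu> s $ i)"
    by (simp add: y_eq[OF assms])
  then show ?thesis using Y_eq_y_a[OF assms, of i] Y_component[OF assms, of i] by simp
qed

end

section \<open>Size of the controlled remainder\<close>

lemma wnorm_le_coeff: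
  assumes "0 \<le> w" "\<And>f. \<bar>lookup x f\<bar> \<le> \<bar>lookup z f\<bar>"
  shows "wnorm w x \<le> wnorm w z"
proof -
  have "keys x \<subseteq> keys z"
  proof
    fix f assume "f \<in> keys x"
    then show "f \<in> keys z" using assms(2)[of f] by (auto simp: in_keys_iff)
  qed
  then have "wnorm w x = (\<Sum>f\<in>keys z. \<bar>lookup x f\<bar> * w ^ forest_size f)"
    by (simp add: wnorm_eq_sum)
  also have "\<dots> \<le> wnorm w z"
    unfolding wnorm_def[of w z] using assms by (intro sum_mono mult_right_mono) auto
  finally show ?thesis .
qed

lemma proj_le_Graft: "proj_le (Suc j) (Graft \<mu> x) = Graft \<mu> (proj_le j x)"
proof -
  have "proj_le (Suc j) (Graft \<mu> x) = lin_ext (\<lambda>f. proj_le (Suc j) (basis (graft \<mu> f))) x"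
    by (simp add: proj_le_def Graft_def lin_ext_lin_ext)
  also have "\<dots> = lin_ext (\<lambda>f. Graft \<mu> (if forest_size f \<le> j then basis f else 0)) x"
    by (intro arg_cong2[of _ _ _ _ lin_ext] ext) (auto simp: proj_le_def Graft_def)
  also have "\<dots> = Graft \<mu> (proj_le j x)"
    by (simp add: proj_le_def Graft_def lin_ext_lin_ext)
  finally show ?thesis .
qed

text \<open>\<open>tree_const d k N K j\<close> bounds the coefficients of trees with at most \<open>j\<close> vertices in
  \<open>\<delta>\<^bold>Y\<close>, by recursion through the fixed-point equation \<open>\<delta>\<^bold>Y = \<Sum>\<^sub>\<mu> [\<sigma>\<^sub>\<mu>(\<^bold>Y)]\<^sub>\<mu>\<close>; here
  \<open>d\<close> and \<open>k\<close> are the dimensions.\<close>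

primrec tree_const :: "real \<Rightarrow> real \<Rightarrow> nat \<Rightarrow> real \<Rightarrow> nat \<Rightarrow> real" where
  "tree_const d k N K 0 = 0"
| "tree_const d k N K (Suc j) = d * (\<Sum>p<N. K * (k * tree_const d k N K j) ^ p)"

text \<open>No tree of the path has more than \<open>N\<close> vertices, so \<open>N\<close> rounds
  of the recursion cover all of them.\<close>

definition path_const :: "real \<Rightarrow> real \<Rightarrow> nat \<Rightarrow> real \<Rightarrow> real" where
  "path_const d k N K = tree_const d k N K N"

definition coeff_const :: "real \<Rightarrow> real \<Rightarrow> nat \<Rightarrow> real \<Rightarrow> real" where
  "coeff_const d k N K = (\<Sum>p<N. K * (k * path_const d k N K) ^ p)"

lemma tree_const_nonneg: "0 \<le> d \<Longrightarrow> 0 \<le> k \<Longrightarrow> 0 \<le> K \<Longrightarrow> 0 \<le> tree_const d k N K j"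
  by (induction j) (auto intro!: mult_nonneg_nonneg sum_nonneg)

lemma path_const_nonneg: "0 \<le> d \<Longrightarrow> 0 \<le> k \<Longrightarrow> 0 \<le> K \<Longrightarrow> 0 \<le> path_const d k N K"
  by (simp add: path_const_def tree_const_nonneg)

lemma coeff_const_nonneg: "0 \<le> d \<Longrightarrow> 0 \<le> k \<Longrightarrow> 0 \<le> K \<Longrightarrow> 0 \<le> coeff_const d k N K"
  by (auto simp: coeff_const_def intro!: mult_nonneg_nonneg zero_le_power sum_nonneg path_const_nonneg)

context rde_solution
begin

text \<open>\<open>1 / \<theta>\<close> is the length scale on which \<open>\<sigma>\<close> varies and \<open>L\<close> its size. Bounded coefficients
  have \<open>\<theta> = L = 1\<close>; under polynomial growth \<open>\<theta> = 1 / v\<close> and \<open>L = v\<^sup>\<gamma>\<close> near points of norm \<open>v\<close>.\<close>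

definition regular_at :: "real \<Rightarrow> real \<Rightarrow> real \<Rightarrow> real ^ 'k \<Rightarrow> bool" where
  "regular_at K L \<theta> x \<longleftrightarrow> (\<forall>w. length w \<le> N \<longrightarrow> norm (partial \<sigma> w x) \<le> K * L * \<theta> ^ length w)"

lemma abs_partial_le:
  "regular_at K L \<theta> x \<Longrightarrow> length w \<le> N \<Longrightarrow> \<bar>partial (\<sigma>c \<mu> i) w x\<bar> \<le> K * L * \<theta> ^ length w"
  using abs_partial_\<sigma>c_le order_trans unfolding regular_at_def by blast

text \<open>The factor \<open>\<theta> ^ p\<close> of the derivatives of order p cancels against p
  increments of size 1 / \<open>\<theta>\<close>, leaving \<open>L\<close> times a constant that
  involves neither scale.\<close>

lemma wnorm_taylor_regular:
  assumes "regular_at K L \<theta> x" "0 < \<theta>" "0 \<le> w" "0 \<le> \<beta>" "\<And>i. wnorm w (b i) \<le> \<beta> / \<theta>"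
  shows "wnorm w (taylor (\<sigma>c \<mu> i) N x b) \<le> L * (\<Sum>p<N. K * (real CARD('k) * \<beta>) ^ p)"
proof -
  have "wnorm w (taylor (\<sigma>c \<mu> i) N x b) \<le> (\<Sum>p<N. (K * L * \<theta> ^ p) * (real CARD('k) * (\<beta> / \<theta>)) ^ p)"
    using assms abs_partial_le by (intro wnorm_taylor[where K = "\<lambda>p. K * L * \<theta> ^ p"]) auto
  also have "\<dots> = L * (\<Sum>p<N. K * (real CARD('k) * \<beta>) ^ p)"
    using assms(2) by (simp add: sum_distrib_left power_mult_distrib power_divide field_simps)
  finally show ?thesis .
qed

lemma forest_size_keys_a:
  assumes "s \<in> {0..1}" "f \<in> keys (a s i)" shows "1 \<le> forest_size f" "forest_size f \<le> N"
proof -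
  obtain h where h: "h \<in> trees (N - 1)" "f \<in> keys (Poly_Mapping.single {#h#} (coef {#h#} (Y s) $ i))"
    using assms(2) Poly_Mapping.keys_sum[of "\<lambda>h. Poly_Mapping.single {#h#} (coef {#h#} (Y s) $ i)" "trees (N - 1)"]
    unfolding a_def by auto
  then have "f = {#h#}" by (simp split: if_splits)
  then show "1 \<le> forest_size f" "forest_size f \<le> N" using h(1) tree_size_pos[of h] by (auto simp: trees_def)
qed

context
  fixes K L \<theta> :: real
  assumes K: "0 \<le> K" and L: "0 < L" and \<theta>: "0 < \<theta>"
begin

text \<open>The weight 1 / (L \<theta>) is the critical one: the coefficient contributes
  \<open>L\<close>, the graft contributes the weight, and the product 1 / \<theta> is again the size
  of increments that the Taylor bound admits. Hence the recursion on tree size closes with constants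
  independent of \<open>L\<close> and \<theta>.\<close>

lemma wnorm_a_critical:
  assumes s: "s \<in> {0..1}" and reg: "regular_at K L \<theta> (y s)"
  shows "wnorm (1 / (L * \<theta>)) (a s i) \<le> path_const (real CARD('d)) (real CARD('k)) N K / \<theta>"
proof -
  let ?w = "1 / (L * \<theta>)"
  have w: "0 \<le> ?w" using L \<theta> by simp
  have "wnorm ?w (proj_le j (a s i)) \<le> tree_const (real CARD('d)) (real CARD('k)) N K j / \<theta>" for j i
  proof (induction j arbitrary: i)
    case 0
    have "proj_le 0 (a s i) = 0"
      using forest_size_keys_a(1)[OF s] by (intro proj_le_eq_0) force
    then show ?case by simp
  next
    case (Suc j)
    let ?T = "tree_const (real CARD('d)) (real CARD('k)) N K j"
    have "wnorm ?w (proj_le j (V \<mu> s i)) \<le> L * (\<Sum>p<N. K * (real CARD('k) * ?T) ^ p)" for \<mu>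
    proof -
      have "wnorm ?w (proj_le j (V \<mu> s i))
          \<le> wnorm ?w (proj_le j (taylor (\<sigma>c \<mu> i) N (y s) (a s)))"
        using w by (intro wnorm_le_coeff)
          (auto simp: lookup_proj_le V_def lookup_lin_ext_filter U_eq_taylor)
      also have "\<dots> = wnorm ?w (proj_le j (taylor (\<sigma>c \<mu> i) N (y s) (\<lambda>i. proj_le j (a s i))))"
        by (subst proj_le_taylor) (rule refl)
      also have "\<dots> \<le> wnorm ?w (taylor (\<sigma>c \<mu> i) N (y s) (\<lambda>i. proj_le j (a s i)))"
        by (rule wnorm_proj_le[OF w])
      also have "\<dots> \<le> L * (\<Sum>p<N. K * (real CARD('k) * ?T) ^ p)"
        by (rule wnorm_taylor_regular[OF reg \<theta> w tree_const_nonneg Suc.IH]) (use K in auto)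
      finally show ?thesis .
    qed
    then have *: "wnorm ?w (Graft \<mu> (proj_le j (V \<mu> s i))) \<le> ?w * (L * (\<Sum>p<N. K * (real CARD('k) * ?T) ^ p))" for \<mu>
      using w by (intro order_trans[OF wnorm_Graft[OF w] mult_left_mono])
    have "proj_le (Suc j) (a s i) = (\<Sum>\<mu>\<in>UNIV. Graft \<mu> (proj_le j (V \<mu> s i)))"
      by (simp add: a_eq[OF s] proj_le_sum proj_le_Graft)
    then have "wnorm ?w (proj_le (Suc j) (a s i))
        \<le> (\<Sum>\<mu>\<in>UNIV. wnorm ?w (Graft \<mu> (proj_le j (V \<mu> s i))))"
      by (simp only: wnorm_sum[OF w])
    also have "\<dots> \<le> (\<Sum>\<mu>\<in>(UNIV :: 'd set). ?w * (L * (\<Sum>p<N. K * (real CARD('k) * ?T) ^ p)))"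
      using * by (intro sum_mono)
    also have "\<dots> = tree_const (real CARD('d)) (real CARD('k)) N K (Suc j) / \<theta>" using L by simp
    finally show ?case .
  qed
  moreover have "proj_le N (a s i) = a s i"
    using forest_size_keys_a(2)[OF s] by (intro proj_le_eq_self)
  ultimately show ?thesis unfolding path_const_def by metis
qed

context
  fixes w \<tau> :: real
  assumes w: "0 \<le> w" and \<tau>: "\<tau> = L * \<theta> * w" and \<tau>_le: "\<tau> \<le> 1 / 2"
begin

lemma \<tau>_nonneg: "0 \<le> \<tau>" using w \<tau> L \<theta> by simp

lemma w_eq: "w = \<tau> * (1 / (L * \<theta>))" using \<tau> L \<theta> by simp

lemma double_w_eq: "2 * w = (2 * \<tau>) * (1 / (L * \<theta>))" using \<tau> L \<theta> by simp

context
  fixes s assumes s: "s \<in> {0..1}" and reg: "regular_at K L \<theta> (y s)"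
begin

text \<open>Each tree has at least one vertex, so going below the critical weight gains a factor
  \<open>\<tau>\<close>. The bound at \<open>2 * w\<close> prepares for translation, which doubles
  the weight; \<open>\<tau> \<le> 1 / 2\<close> keeps even the doubled weight subcritical.\<close>

lemma wnorm_a:
  shows "wnorm w (a s i) \<le> \<tau> * path_const (real CARD('d)) (real CARD('k)) N K / \<theta>"
    and "wnorm (2 * w) (a s i) \<le> 2 * \<tau> * path_const (real CARD('d)) (real CARD('k)) N K / \<theta>"
proof -
  have *: "wnorm (q * (1 / (L * \<theta>))) (a s i) \<le> q * path_const (real CARD('d)) (real CARD('k)) N K / \<theta>"
    if "0 \<le> q" "q \<le> 1" for q
  proof -
    have "wnorm (q * (1 / (L * \<theta>))) (a s i) \<le> q ^ 1 * wnorm (1 / (L * \<theta>)) (a s i)"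
      using forest_size_keys_a(1)[OF s] L \<theta> that by (intro wnorm_scale_degree_ge) auto
    also have "\<dots> \<le> q * (path_const (real CARD('d)) (real CARD('k)) N K / \<theta>)"
      using mult_left_mono[OF wnorm_a_critical[OF s reg] that(1)] by simp
    finally show ?thesis by simp
  qed
  show "wnorm w (a s i) \<le> \<tau> * path_const (real CARD('d)) (real CARD('k)) N K / \<theta>"
    unfolding w_eq using * \<tau>_nonneg \<tau>_le by auto
  show "wnorm (2 * w) (a s i) \<le> 2 * \<tau> * path_const (real CARD('d)) (real CARD('k)) N K / \<theta>"
    unfolding double_w_eq using *[of "2 * \<tau>"] \<tau>_nonneg \<tau>_le by auto
qed

lemma wnorm_taylor_critical:
  "wnorm (1 / (L * \<theta>)) (taylor (\<sigma>c \<mu> i) N (y s) (a s)) \<le> L * coeff_const (real CARD('d)) (real CARD('k)) N K"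
  unfolding coeff_const_def using L \<theta> K
  by (intro wnorm_taylor_regular[OF reg] wnorm_a_critical[OF s reg] path_const_nonneg) auto

text \<open>Anything dominated by the Taylor polynomial inherits its bound at the critical weight; a
  support on forests with at least \<open>n\<close> vertices then gives the power
  \<open>n\<close>.\<close>

lemma wnorm_high_degree:
  assumes "\<And>f. \<bar>lookup x f\<bar> \<le> \<bar>lookup (taylor (\<sigma>c \<mu> i) N (y s) (a s)) f\<bar>"
    and "\<And>f. f \<in> keys x \<Longrightarrow> n \<le> forest_size f"
  shows "wnorm w x \<le> \<tau> ^ n * (L * coeff_const (real CARD('d)) (real CARD('k)) N K)"
    and "wnorm (2 * w) x \<le> (2 * \<tau>) ^ n * (L * coeff_const (real CARD('d)) (real CARD('k)) N K)"
proof -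
  have *: "wnorm (q * (1 / (L * \<theta>))) x \<le> q ^ n * (L * coeff_const (real CARD('d)) (real CARD('k)) N K)"
    if "0 \<le> q" "q \<le> 1" for q
  proof -
    have "wnorm (q * (1 / (L * \<theta>))) x \<le> q ^ n * wnorm (1 / (L * \<theta>)) x"
      using assms(2) L \<theta> that by (intro wnorm_scale_degree_ge) auto
    also have "\<dots> \<le> q ^ n * (L * coeff_const (real CARD('d)) (real CARD('k)) N K)"
      using L \<theta> that order_trans[OF wnorm_le_coeff[OF _ assms(1)] wnorm_taylor_critical]
      by (intro mult_left_mono) auto
    finally show ?thesis .
  qed
  show "wnorm w x \<le> \<tau> ^ n * (L * coeff_const (real CARD('d)) (real CARD('k)) N K)"
    unfolding w_eq using * \<tau>_nonneg \<tau>_le by auto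
  show "wnorm (2 * w) x \<le> (2 * \<tau>) ^ n * (L * coeff_const (real CARD('d)) (real CARD('k)) N K)"
    unfolding double_w_eq using *[of "2 * \<tau>"] \<tau>_nonneg \<tau>_le by auto
qed

lemma wnorm_V: "wnorm w (V \<mu> s i) \<le> L * coeff_const (real CARD('d)) (real CARD('k)) N K"
  using wnorm_high_degree(1)[of "V \<mu> s i" \<mu> i 0]
  by (simp add: V_def lookup_lin_ext_filter U_eq_taylor lookup_proj_le)

lemma wnorm_U: "wnorm w (U \<mu> s i) \<le> L * coeff_const (real CARD('d)) (real CARD('k)) N K"
  using wnorm_high_degree(1)[of "U \<mu> s i" \<mu> i 0]
  by (simp add: U_eq_taylor lookup_proj_le)

lemma wnorm_taylor_diff_U:
  shows "wnorm w (taylor (\<sigma>c \<mu> i) N (y s) (a s) - U \<mu> s i) \<le> \<tau> ^ N * (L * coeff_const (real CARD('d)) (real CARD('k)) N K)"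
    and "wnorm (2 * w) (taylor (\<sigma>c \<mu> i) N (y s) (a s) - U \<mu> s i) \<le> (2 * \<tau>) ^ N * (L * coeff_const (real CARD('d)) (real CARD('k)) N K)"
proof -
  let ?x = "taylor (\<sigma>c \<mu> i) N (y s) (a s) - U \<mu> s i"
  have 1: "\<bar>lookup ?x f\<bar> \<le> \<bar>lookup (taylor (\<sigma>c \<mu> i) N (y s) (a s)) f\<bar>" for f
    by (simp add: U_eq_taylor lookup_minus lookup_proj_le)
  have 2: "f \<in> keys ?x \<Longrightarrow> N \<le> forest_size f" for f
    using keys_co_proj_le[of f _ "N - 1"] N_pos by (simp add: U_eq_taylor)
  show "wnorm w ?x \<le> \<tau> ^ N * (L * coeff_const (real CARD('d)) (real CARD('k)) N K)"
    and "wnorm (2 * w) ?x \<le> (2 * \<tau>) ^ N * (L * coeff_const (real CARD('d)) (real CARD('k)) N K)"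
    by (rule wnorm_high_degree[OF 1 2]; assumption)+
qed

text \<open>Forests that occur in \<open>U\<close> but not in \<open>V\<close> have exactly
  \<open>N - 1\<close> vertices: they contribute to the integral, but not to the tree coefficients
  of the solution.\<close>

lemma wnorm_U_diff_V:
  shows "wnorm w (U \<mu> s i - V \<mu> s i) \<le> \<tau> ^ (N - 1) * (L * coeff_const (real CARD('d)) (real CARD('k)) N K)"
    and "wnorm (2 * w) (U \<mu> s i - V \<mu> s i) \<le> (2 * \<tau>) ^ (N - 1) * (L * coeff_const (real CARD('d)) (real CARD('k)) N K)"
proof -
  let ?x = "U \<mu> s i - V \<mu> s i"
  have 1: "\<bar>lookup ?x f\<bar> \<le> \<bar>lookup (taylor (\<sigma>c \<mu> i) N (y s) (a s)) f\<bar>" for f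
    by (simp add: U_eq_taylor lookup_minus lookup_proj_le V_def lookup_lin_ext_filter)
  have 2: "f \<in> keys ?x \<Longrightarrow> N - 1 \<le> forest_size f" for f
    by (auto simp: in_keys_iff lookup_minus V_def lookup_lin_ext_filter split: if_splits)
  show "wnorm w ?x \<le> \<tau> ^ (N - 1) * (L * coeff_const (real CARD('d)) (real CARD('k)) N K)"
    and "wnorm (2 * w) ?x \<le> (2 * \<tau>) ^ (N - 1) * (L * coeff_const (real CARD('d)) (real CARD('k)) N K)"
    by (rule wnorm_high_degree[OF 1 2]; assumption)+
qed

end

end

end

section \<open>The controlled remainder and its component at the empty forest\<close>

definition rem :: "real \<Rightarrow> real \<Rightarrow> 'k \<Rightarrow> 'd falg" where
  "rem s t i = Y t $ i - translate (\<Phi> s t) (Y s $ i)"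

definition \<rho> :: "real \<Rightarrow> real \<Rightarrow> real ^ 'k" where
  "\<rho> s t = (\<chi> i. lookup (rem s t i) {#})"

lemma translate_single_empty: "translate (\<Phi> s t) (Poly_Mapping.single {#} c) = Poly_Mapping.single {#} c"
proof -
  have "Poly_Mapping.single {#} c = scal c (basis {#})" by (simp only: scal_single mult_1_right)
  then show ?thesis by (metis translate_scal tree_char.translate_empty)
qed

lemma rem_eq:
  assumes "s \<in> {0..1}" "t \<in> {0..1}"
  shows "rem s t i = Poly_Mapping.single {#} (y t $ i - y s $ i) + a t i - translate (\<Phi> s t) (a s i)"
  by (simp add: rem_def Y_eq_y_a[OF assms(1)] Y_eq_y_a[OF assms(2)] translate_add translate_single_empty single_diff algebra_simps)

text \<open>Since translation commutes with grafting up to a scalar, the tree part of the remainder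
  of \<open>Y\<close> consists of grafted remainders of \<open>V\<close>; everything else is
  collected at the empty forest.\<close>

lemma rem_eq_Graft:
  assumes "s \<in> {0..1}" "t \<in> {0..1}"
  shows "rem s t i = Poly_Mapping.single {#} (y t $ i - y s $ i - (\<Sum>\<mu>\<in>UNIV. pairing (\<Phi> s t) (Graft \<mu> (V \<mu> s i))))
    + (\<Sum>\<mu>\<in>UNIV. Graft \<mu> (V \<mu> t i - translate (\<Phi> s t) (V \<mu> s i)))"
proof -
  have sum_single: "(\<Sum>\<mu>\<in>A. Poly_Mapping.single {#} (c \<mu>)) = (Poly_Mapping.single {#} (sum c A) :: 'd falg)" for c and A :: "'d set"
    by (rule poly_mapping_eqI) (simp add: lookup_sum lookup_single when_def)
  show ?thesis
    by (simp add: rem_eq[OF assms] a_eq[OF assms(1)] a_eq[OF assms(2)] translate_sum tree_char.translate_Graft Graft_diff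
        sum.distrib sum_subtractf sum_single single_diff single_add algebra_simps)
qed

lemma \<rho>_component:
  assumes "s \<in> {0..1}" "t \<in> {0..1}"
  shows "\<rho> s t $ i = y t $ i - y s $ i - (\<Sum>\<mu>\<in>UNIV. pairing (\<Phi> s t) (Graft \<mu> (V \<mu> s i)))"
  by (simp add: \<rho>_def rem_eq_Graft[OF assms] lookup_add lookup_sum)

end

section \<open>Estimating the remainder of the composed path\<close>

definition graft_const :: "real \<Rightarrow> real \<Rightarrow> nat \<Rightarrow> real \<Rightarrow> real" where
  "graft_const d k N K = coeff_const d k N K * (1 + 2 ^ (N - 1))"

definition lip_const :: "real \<Rightarrow> real \<Rightarrow> nat \<Rightarrow> real \<Rightarrow> real" where
  "lip_const d k N K = (\<Sum>p<N. k ^ p * (K * (real p * (1 + path_const d k N K) ^ (p - 1))))"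

text \<open>The coefficient of \<theta> |\<rho>| when the base point is moved. A power
  \<open>N\<close> appears there, of which all factors but one are replaced by the crude bound of
  \<open>norm_\<rho>_le\<close>.\<close>

definition shift_const :: "real \<Rightarrow> real \<Rightarrow> nat \<Rightarrow> real \<Rightarrow> real" where
  "shift_const d k N K = k ^ N * K * 2 ^ N * (k * (1 + d * coeff_const d k N K)) ^ (N - 1)"

text \<open>Collects all terms of order \<tau>^N: the noise part of the base-point shift, and the
  truncation of the Taylor polynomial at time \<open>t\<close>, giving 1, and at time
  \<open>s\<close>, giving 2^N because of the translation.\<close>

definition trunc_const :: "real \<Rightarrow> real \<Rightarrow> nat \<Rightarrow> real \<Rightarrow> real" where
  "trunc_const d k N K = k ^ N * K * 2 ^ N * (d * coeff_const d k N K + path_const d k N K) ^ N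
    + coeff_const d k N K * (1 + 2 ^ N)"

lemma const_nonneg:
  assumes "0 \<le> d" "0 \<le> k" "0 \<le> K"
  shows "0 \<le> graft_const d k N K" "0 \<le> lip_const d k N K" "0 \<le> shift_const d k N K" "0 \<le> trunc_const d k N K"
  using path_const_nonneg[OF assms, of N] coeff_const_nonneg[OF assms, of N] assms
  by (auto simp: graft_const_def lip_const_def shift_const_def trunc_const_def
      intro!: mult_nonneg_nonneg zero_le_power sum_nonneg add_nonneg_nonneg)

lemma power_add_le: "0 \<le> a \<Longrightarrow> 0 \<le> b \<Longrightarrow> (a + b) ^ n \<le> 2 ^ n * (a ^ n + b ^ n)" for a b :: real
proof -
  assume ab: "0 \<le> a" "0 \<le> b"
  have "(a + b) ^ n \<le> (2 * max a b) ^ n" using ab by (intro power_mono) auto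
  also have "\<dots> = 2 ^ n * max a b ^ n" by (simp add: power_mult_distrib)
  also have "\<dots> \<le> 2 ^ n * (a ^ n + b ^ n)" using ab by (intro mult_left_mono) (auto simp: max_def)
  finally show ?thesis .
qed

context rde_solution
begin

context
  fixes K L \<theta> w \<tau> s t :: real
  assumes K: "0 \<le> K" and L: "0 < L" and \<theta>: "0 < \<theta>"
    and w: "0 \<le> w" and \<tau>: "\<tau> = L * \<theta> * w" and \<tau>_le: "\<tau> \<le> 1 / 2"
    and s: "s \<in> {0..1}" and t: "t \<in> {0..1}"
    and bound: "\<And>f. \<bar>\<Phi> s t f\<bar> \<le> w ^ forest_size f"
    and segment: "\<And>r. 0 \<le> r \<Longrightarrow> r \<le> 1 \<Longrightarrow> regular_at K L \<theta> (y s + r *\<^sub>R (y t - y s))"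
    and close: "norm (y t - y s) \<le> 1 / \<theta>"
begin

lemma reg_s: "regular_at K L \<theta> (y s)" and reg_t: "regular_at K L \<theta> (y t)"
  using segment[of 0] segment[of 1] by simp_all

lemmas fixed = K L \<theta> w \<tau> \<tau>_le

lemma wnorm_rem:
  "wnorm w (rem s t i) \<le> \<bar>\<rho> s t $ i\<bar> + (\<Sum>\<mu>\<in>UNIV. w * (wnorm w (U \<mu> t i - translate (\<Phi> s t) (U \<mu> s i))
      + L * graft_const (real CARD('d)) (real CARD('k)) N K * \<tau> ^ (N - 1)))"
proof -
  let ?C = "coeff_const (real CARD('d)) (real CARD('k)) N K"
  have V: "wnorm w (V \<mu> t i - translate (\<Phi> s t) (V \<mu> s i))
      \<le> wnorm w (U \<mu> t i - translate (\<Phi> s t) (U \<mu> s i)) + L * graft_const (real CARD('d)) (real CARD('k)) N K * \<tau> ^ (N - 1)" for \<mu>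
  proof -
    have eq: "V \<mu> t i - translate (\<Phi> s t) (V \<mu> s i) = (U \<mu> t i - translate (\<Phi> s t) (U \<mu> s i))
        - (U \<mu> t i - V \<mu> t i) + translate (\<Phi> s t) (U \<mu> s i - V \<mu> s i)"
      by (simp add: translate_diff)
    have "wnorm w (translate (\<Phi> s t) (U \<mu> s i - V \<mu> s i)) \<le> (2 * \<tau>) ^ (N - 1) * (L * ?C)"
      using tree_char.wnorm_translate[OF w bound] wnorm_U_diff_V(2)[OF fixed s reg_s] by (rule order_trans)
    moreover have "wnorm w (U \<mu> t i - V \<mu> t i) \<le> \<tau> ^ (N - 1) * (L * ?C)"
      by (rule wnorm_U_diff_V(1)[OF fixed t reg_t])
    ultimately have "wnorm w (V \<mu> t i - translate (\<Phi> s t) (V \<mu> s i))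
      \<le> wnorm w (U \<mu> t i - translate (\<Phi> s t) (U \<mu> s i)) + \<tau> ^ (N - 1) * (L * ?C) + (2 * \<tau>) ^ (N - 1) * (L * ?C)"
      unfolding eq using wnorm_add[OF w] wnorm_diff[OF w] by (smt (verit))
    then show ?thesis by (simp add: graft_const_def power_mult_distrib algebra_simps)
  qed
  have "rem s t i = Poly_Mapping.single {#} (\<rho> s t $ i) + (\<Sum>\<mu>\<in>UNIV. Graft \<mu> (V \<mu> t i - translate (\<Phi> s t) (V \<mu> s i)))"
    using rem_eq_Graft[OF s t] \<rho>_component[OF s t] by simp
  then have "wnorm w (rem s t i) \<le> \<bar>\<rho> s t $ i\<bar> + wnorm w (\<Sum>\<mu>\<in>UNIV. Graft \<mu> (V \<mu> t i - translate (\<Phi> s t) (V \<mu> s i)))"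
    using wnorm_add[OF w, of "Poly_Mapping.single {#} (\<rho> s t $ i)"] by simp
  also have "\<dots> \<le> \<bar>\<rho> s t $ i\<bar> + (\<Sum>\<mu>\<in>UNIV. w * wnorm w (V \<mu> t i - translate (\<Phi> s t) (V \<mu> s i)))"
    by (intro add_left_mono order_trans[OF wnorm_sum[OF w]] sum_mono wnorm_Graft[OF w])
  also have "\<dots> \<le> \<bar>\<rho> s t $ i\<bar> + (\<Sum>\<mu>\<in>UNIV. w * (wnorm w (U \<mu> t i - translate (\<Phi> s t) (U \<mu> s i))
      + L * graft_const (real CARD('d)) (real CARD('k)) N K * \<tau> ^ (N - 1)))"
    using V w by (intro add_left_mono sum_mono mult_left_mono)
  finally show ?thesis .
qed

lemma pairing_sum_le:
  "\<bar>\<Sum>\<mu>\<in>UNIV. pairing (\<Phi> s t) (Graft \<mu> (V \<mu> s i))\<bar>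
    \<le> real CARD('d) * coeff_const (real CARD('d)) (real CARD('k)) N K * \<tau> / \<theta>"
proof -
  let ?C = "coeff_const (real CARD('d)) (real CARD('k)) N K"
  have "\<bar>pairing (\<Phi> s t) (Graft \<mu> (V \<mu> s i))\<bar> \<le> ?C * \<tau> / \<theta>" for \<mu>
  proof -
    have "\<bar>pairing (\<Phi> s t) (Graft \<mu> (V \<mu> s i))\<bar> \<le> w * wnorm w (V \<mu> s i)"
      by (rule order_trans[OF abs_pairing_le_wnorm[OF bound] wnorm_Graft[OF w]])
    also have "\<dots> \<le> w * (L * ?C)"
      using wnorm_V[OF fixed s reg_s] w by (intro mult_left_mono)
    also have "\<dots> = ?C * \<tau> / \<theta>" using \<theta> by (simp add: \<tau>)
    finally show ?thesis .
  qed
  then have "(\<Sum>\<mu>\<in>(UNIV :: 'd set). \<bar>pairing (\<Phi> s t) (Graft \<mu> (V \<mu> s i))\<bar>) \<le> (\<Sum>\<mu>\<in>(UNIV :: 'd set). ?C * \<tau> / \<theta>)"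
    by (intro sum_mono)
  then show ?thesis by (intro order_trans[OF sum_abs]) (simp add: mult.assoc)
qed

text \<open>A crude bound without any smallness. It serves to replace a power of \<theta> |\<rho>|
  by a multiple of \<theta> |\<rho>|.\<close>

lemma norm_\<rho>_le:
  "\<theta> * norm (\<rho> s t) \<le> real CARD('k) * (1 + real CARD('d) * coeff_const (real CARD('d)) (real CARD('k)) N K)"
proof -
  let ?C = "real CARD('d) * coeff_const (real CARD('d)) (real CARD('k)) N K"
  have C: "0 \<le> ?C" using K by (simp add: coeff_const_nonneg)
  have "\<bar>\<rho> s t $ i\<bar> \<le> (1 + ?C) / \<theta>" for i
  proof -
    have "\<bar>(y t - y s) $ i\<bar> \<le> 1 / \<theta>" using close component_le_norm_cart order_trans by blast
    moreover have "?C * \<tau> / \<theta> \<le> ?C * 1 / \<theta>"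
      using C \<tau>_le \<theta> by (intro divide_right_mono mult_left_mono) auto
    ultimately show ?thesis
      using pairing_sum_le[of i] by (simp add: \<rho>_component[OF s t] add_divide_distrib)
  qed
  then have "norm (\<rho> s t) \<le> (\<Sum>i\<in>(UNIV :: 'k set). (1 + ?C) / \<theta>)"
    by (intro order_trans[OF norm_le_l1_cart] sum_mono)
  then show ?thesis using \<theta> by (simp add: field_simps)
qed

text \<open>Both terms are Taylor polynomials up to truncation, with different base points and
  different increments. Moving the base point costs a derivative of order \<open>N\<close>;
  exchanging the increments costs their difference, which is exactly the remainder of
  \<open>Y\<close>.\<close>

lemma wnorm_remainder_U_aux:
  assumes \<delta>: "\<And>i. wnorm w (rem s t i) \<le> \<delta>"
  shows "wnorm w (U \<mu> t i - translate (\<Phi> s t) (U \<mu> s i))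
    \<le> L * (shift_const (real CARD('d)) (real CARD('k)) N K * (\<theta> * norm (\<rho> s t))
      + trunc_const (real CARD('d)) (real CARD('k)) N K * \<tau> ^ N
      + lip_const (real CARD('d)) (real CARD('k)) N K * (\<theta> * \<delta>))"
proof -
  let ?k = "real CARD('k)" and ?d = "real CARD('d)"
  let ?C1 = "path_const ?d ?k N K" and ?C2 = "coeff_const ?d ?k N K"
  let ?T = "\<lambda>s. taylor (\<sigma>c \<mu> i) N (y s) (a s)" and ?tr = "translate (\<Phi> s t)"
  let ?c = "y t - y s" and ?P = "norm (\<rho> s t)"
  let ?b = "\<lambda>i. scal (?c $ i) 1 + a t i"
  let ?e = "\<theta> * ?P"
  define \<gamma> where "\<gamma> = ?P + ?d * ?C2 * \<tau> / \<theta>"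
  have C1: "0 \<le> ?C1" and C2: "0 \<le> ?C2" using K by (simp_all add: path_const_nonneg coeff_const_nonneg)
  have \<tau>0: "0 \<le> \<tau>" using w L \<theta> by (simp add: \<tau>)
  have \<gamma>0: "0 \<le> \<gamma>" using C2 \<tau>0 \<theta> by (simp add: \<gamma>_def)
  have c1: "\<bar>?c $ j\<bar> \<le> 1 / \<theta>" for j using close component_le_norm_cart order_trans by blast
  have c2: "\<bar>?c $ j\<bar> \<le> \<gamma>" for j
  proof -
    have "?c $ j = \<rho> s t $ j + (\<Sum>\<mu>\<in>UNIV. pairing (\<Phi> s t) (Graft \<mu> (V \<mu> s j)))"
      by (simp add: \<rho>_component[OF s t])
    then show ?thesis
      using pairing_sum_le[of j] component_le_norm_cart[of "\<rho> s t" j] unfolding \<gamma>_def by linarith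
  qed
  have a_t: "wnorm w (a t j) \<le> \<tau> * ?C1 / \<theta>" for j by (rule wnorm_a(1)[OF fixed t reg_t])
  have tr_a: "wnorm w (?tr (a s j)) \<le> 2 * \<tau> * ?C1 / \<theta>" for j
    by (rule order_trans[OF tree_char.wnorm_translate[OF w bound] wnorm_a(2)[OF fixed s reg_s]])
  have shifted_le: "wnorm w (shifted ?c (a t) r j) \<le> \<bar>?c $ j\<bar> + \<tau> * ?C1 / \<theta>" if "0 \<le> r" "r \<le> 1" for r j
  proof -
    have "wnorm w (shifted ?c (a t) r j) \<le> \<bar>(1 - r) * ?c $ j\<bar> + wnorm w (a t j)"
      unfolding shifted_def using wnorm_add[OF w, of "scal ((1 - r) * ?c $ j) 1" "a t j"] by simp
    moreover have "\<bar>(1 - r) * ?c $ j\<bar> \<le> \<bar>?c $ j\<bar>"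
      using that by (simp add: abs_mult mult_left_le_one_le)
    ultimately show ?thesis using a_t[of j] by linarith
  qed
  have shift: "wnorm w (?T t - taylor (\<sigma>c \<mu> i) N (y s) ?b)
      \<le> L * (shift_const ?d ?k N K * ?e + ?k ^ N * K * 2 ^ N * (?d * ?C2 + ?C1) ^ N * \<tau> ^ N)"
  proof -
    let ?\<beta> = "\<gamma> + \<tau> * ?C1 / \<theta>"
    have \<beta>0: "0 \<le> ?\<beta>" using \<gamma>0 \<tau>0 C1 \<theta> by simp
    have 1: "\<And>r j. 0 \<le> r \<Longrightarrow> r \<le> 1 \<Longrightarrow> wnorm w (shifted ?c (a t) r j) \<le> ?\<beta>"
      using shifted_le c2 by (smt (verit))
    have 2: "\<And>r u. 0 \<le> r \<Longrightarrow> r \<le> 1 \<Longrightarrow> length u = N \<Longrightarrow> \<bar>partial (\<sigma>c \<mu> i) u (y s + r *\<^sub>R ?c)\<bar> \<le> K * L * \<theta> ^ N"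
      using abs_partial_le[OF segment] by auto
    have "wnorm w (taylor (\<sigma>c \<mu> i) N (y s + ?c) (a t) - taylor (\<sigma>c \<mu> i) N (y s) ?b)
        \<le> ?k ^ N * ((K * L * \<theta> ^ N) * \<gamma> * ?\<beta> ^ (N - 1))"
      by (rule wnorm_taylor_shift[OF \<sigma>c_C_class N_pos w \<beta>0 \<gamma>0 _ 1 c2 2]) (use K L \<theta> in auto)
    also have "\<dots> \<le> ?k ^ N * ((K * L * \<theta> ^ N) * ?\<beta> * ?\<beta> ^ (N - 1))"
      using K L \<theta> \<gamma>0 \<beta>0 \<tau>0 C1 by (intro mult_left_mono mult_right_mono) auto
    also have "\<dots> = ?k ^ N * (K * L * (\<theta> * ?\<beta>) ^ N)"
      using N_pos by (simp add: power_mult_distrib power_eq_if[of _ N] mult_ac)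
    also have "\<theta> * ?\<beta> = ?e + (?d * ?C2 + ?C1) * \<tau>"
      using \<theta> by (simp add: \<gamma>_def field_simps)
    also have "?k ^ N * (K * L * (?e + (?d * ?C2 + ?C1) * \<tau>) ^ N)
        \<le> ?k ^ N * (K * L * (2 ^ N * (?e ^ N + ((?d * ?C2 + ?C1) * \<tau>) ^ N)))"
      using K L \<theta> C1 C2 \<tau>0 by (intro mult_left_mono power_add_le) auto
    \<comment> \<open>The bound has to be linear in \<open>?e\<close>, because the sewing argument
      later absorbs it.\<close>
    also have "\<dots> \<le> ?k ^ N * (K * L * (2 ^ N * ((?k * (1 + ?d * ?C2)) ^ (N - 1) * ?e + ((?d * ?C2 + ?C1) * \<tau>) ^ N)))"
    proof -
      have "?e ^ N = ?e ^ (N - 1) * ?e" using N_pos by (simp add: power_eq_if[of _ N])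
      also have "\<dots> \<le> (?k * (1 + ?d * ?C2)) ^ (N - 1) * ?e"
        using norm_\<rho>_le \<theta> by (intro mult_right_mono power_mono) auto
      finally show ?thesis using K L by (intro mult_left_mono add_right_mono) auto
    qed
    also have "\<dots> = L * (shift_const ?d ?k N K * ?e + ?k ^ N * K * 2 ^ N * (?d * ?C2 + ?C1) ^ N * \<tau> ^ N)"
      unfolding shift_const_def power_mult_distrib[of "?d * ?C2 + ?C1" \<tau> N]
      by (simp only: distrib_left mult.assoc mult.left_commute mult.commute)
    finally show ?thesis by simp
  qed
  have lip: "wnorm w (taylor (\<sigma>c \<mu> i) N (y s) ?b - taylor (\<sigma>c \<mu> i) N (y s) (\<lambda>j. ?tr (a s j)))
      \<le> L * (lip_const ?d ?k N K * (\<theta> * \<delta>))"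
  proof -
    let ?\<beta> = "(1 + ?C1) / \<theta>"
    \<comment> \<open>Used with q = 1 for the tree part at time \<open>t\<close> and with q = 2 for
      the translated tree part at time \<open>s\<close>.\<close>
    have small: "q * \<tau> * ?C1 / \<theta> \<le> ?C1 / \<theta>" if "0 \<le> q" "q \<le> 2" for q
    proof -
      have "q * \<tau> \<le> 2 * (1 / 2)" using that \<tau>0 \<tau>_le by (intro mult_mono) auto
      then have "q * \<tau> * ?C1 \<le> 1 * ?C1" using C1 by (intro mult_right_mono) auto
      then show ?thesis using \<theta> by (simp add: divide_right_mono)
    qed
    have b: "wnorm w (?b j) \<le> ?\<beta>" for j
      using shifted_le[of 0 j] c1[of j] small[of 1] by (simp add: shifted_def add_divide_distrib)
    have tr: "wnorm w (?tr (a s j)) \<le> ?\<beta>" for j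
    proof -
      have "0 \<le> 1 / \<theta>" using \<theta> by simp
      then show ?thesis using tr_a[of j] small[of 2] unfolding add_divide_distrib by linarith
    qed
    \<comment> \<open>The scalar displacement together with the tree part at \<open>t\<close>, minus
      the translated tree part at \<open>s\<close>, is the controlled remainder itself.\<close>
    have diff: "wnorm w (?b j - ?tr (a s j)) \<le> \<delta>" for j
      using \<delta>[of j] by (simp add: rem_eq[OF s t] scal_eq_mult zero_multiset_def)
    have \<delta>0: "0 \<le> \<delta>" using \<delta> wnorm_nonneg[OF w] order_trans by blast
    have "wnorm w (taylor (\<sigma>c \<mu> i) N (y s) ?b - taylor (\<sigma>c \<mu> i) N (y s) (\<lambda>j. ?tr (a s j)))
        \<le> (\<Sum>p<N. ?k ^ p * ((K * L * \<theta> ^ p) * (real p * ?\<beta> ^ (p - 1)))) * \<delta>"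
      using C1 \<theta> by (intro wnorm_taylor_diff[OF w _ \<delta>0 b tr diff, where K = "\<lambda>p. K * L * \<theta> ^ p"]
          abs_partial_le[OF reg_s]) auto
    also have "(\<Sum>p<N. ?k ^ p * ((K * L * \<theta> ^ p) * (real p * ?\<beta> ^ (p - 1)))) = L * \<theta> * lip_const ?d ?k N K"
      unfolding lip_const_def sum_distrib_left
    proof (rule sum.cong[OF refl])
      fix p
      show "?k ^ p * ((K * L * \<theta> ^ p) * (real p * ?\<beta> ^ (p - 1)))
          = L * \<theta> * (?k ^ p * (K * (real p * (1 + ?C1) ^ (p - 1))))"
        using \<theta> by (cases p) (simp_all add: power_divide)
    qed
    finally show ?thesis by (simp add: mult_ac)
  qed
  have eq: "U \<mu> t i - ?tr (U \<mu> s i) = (?T t - taylor (\<sigma>c \<mu> i) N (y s) ?b)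
      + (taylor (\<sigma>c \<mu> i) N (y s) ?b - taylor (\<sigma>c \<mu> i) N (y s) (\<lambda>j. ?tr (a s j)))
      - (?T t - U \<mu> t i) + ?tr (?T s - U \<mu> s i)"
    by (simp add: translate_diff tree_char.translate_taylor)
  have "wnorm w (?tr (?T s - U \<mu> s i)) \<le> (2 * \<tau>) ^ N * (L * ?C2)"
    by (rule order_trans[OF tree_char.wnorm_translate[OF w bound] wnorm_taylor_diff_U(2)[OF fixed s reg_s]])
  then have "wnorm w (U \<mu> t i - ?tr (U \<mu> s i))
    \<le> L * (shift_const ?d ?k N K * ?e + ?k ^ N * K * 2 ^ N * (?d * ?C2 + ?C1) ^ N * \<tau> ^ N)
      + L * (lip_const ?d ?k N K * (\<theta> * \<delta>)) + \<tau> ^ N * (L * ?C2) + (2 * \<tau>) ^ N * (L * ?C2)"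
    unfolding eq using shift lip wnorm_taylor_diff_U(1)[OF fixed t reg_t, of \<mu> i]
      wnorm_add[OF w] wnorm_diff[OF w] by (smt (verit))
  then show ?thesis by (simp add: trunc_const_def power_mult_distrib algebra_simps)
qed

end

end

text \<open>Makes the feedback of the remainder into itself at most one half. The summand 1 also
  keeps the threshold at most 1 / 2, as needed for subcritical weights.\<close>

definition eps_const :: "real \<Rightarrow> real \<Rightarrow> nat \<Rightarrow> real \<Rightarrow> real" where
  "eps_const d k N K = 1 / (2 * (1 + k * d * lip_const d k N K))"

text \<open>Sum of the coefficients of \<theta> |\<rho>| and of \<tau>^N after the feedback
  inequality has been solved; the factors 2 stem from the absorption.\<close>

definition key_const :: "real \<Rightarrow> real \<Rightarrow> nat \<Rightarrow> real \<Rightarrow> real" where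
  "key_const d k N K = shift_const d k N K + 2 * lip_const d k N K * (k + k * d * shift_const d k N K)
    + trunc_const d k N K + 2 * lip_const d k N K * (k * d * (trunc_const d k N K + graft_const d k N K))"

lemma eps_const_bounds:
  assumes "0 \<le> d" "0 \<le> k" "0 \<le> K"
  shows "0 < eps_const d k N K" "eps_const d k N K \<le> 1 / 2"
    "eps_const d k N K * (k * d * lip_const d k N K) \<le> 1 / 2"
proof -
  have p: "0 \<le> k * d * lip_const d k N K" using const_nonneg[OF assms, of N] assms by simp
  then show "0 < eps_const d k N K" "eps_const d k N K \<le> 1 / 2"
    "eps_const d k N K * (k * d * lip_const d k N K) \<le> 1 / 2"
    by (simp_all add: eps_const_def field_simps)
qed

lemma key_const_nonneg:
  assumes "0 \<le> d" "0 \<le> k" "0 \<le> K" shows "0 \<le> key_const d k N K"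
  using const_nonneg[OF assms, of N] assms by (auto simp: key_const_def intro!: add_nonneg_nonneg)

context rde_solution
begin

text \<open>The sum of the remainders of \<open>Y\<close> over all components is the one quantity in
  which the loop between \<open>Y\<close> and its composition closes. After absorption only the
  component at the empty forest and the truncation order remain.\<close>

lemma wnorm_remainder_U:
  assumes K: "0 \<le> K" and L: "0 < L" and \<theta>: "0 < \<theta>"
    and w: "0 \<le> w" and \<tau>: "\<tau> = L * \<theta> * w" and \<tau>_le: "\<tau> \<le> eps_const (real CARD('d)) (real CARD('k)) N K"
    and s: "s \<in> {0..1}" and t: "t \<in> {0..1}"
    and bound: "\<And>f. \<bar>\<Phi> s t f\<bar> \<le> w ^ forest_size f"
    and segment: "\<And>r. 0 \<le> r \<Longrightarrow> r \<le> 1 \<Longrightarrow> regular_at K L \<theta> (y s + r *\<^sub>R (y t - y s))"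
    and close: "norm (y t - y s) \<le> 1 / \<theta>"
  shows "wnorm w (U \<mu> t i - translate (\<Phi> s t) (U \<mu> s i))
    \<le> key_const (real CARD('d)) (real CARD('k)) N K * L * (\<theta> * norm (\<rho> s t) + \<tau> ^ N)"
proof -
  let ?k = "real CARD('k)" and ?d = "real CARD('d)"
  let ?A1 = "shift_const ?d ?k N K" and ?A2 = "trunc_const ?d ?k N K" and ?C3 = "graft_const ?d ?k N K"
    and ?C5 = "lip_const ?d ?k N K"
  let ?e = "\<theta> * norm (\<rho> s t)"
  define \<delta> where "\<delta> = (\<Sum>i\<in>UNIV. wnorm w (rem s t i))"
  have K0: "0 \<le> ?d" "0 \<le> ?k" by simp_all
  note nn = const_nonneg[OF K0 K, of N] and eps = eps_const_bounds[OF K0 K, of N]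
  have half: "\<tau> \<le> 1 / 2" using \<tau>_le eps(2) by linarith
  have \<tau>0: "0 \<le> \<tau>" using w L \<theta> by (simp add: \<tau>)
  have e0: "0 \<le> ?e" using \<theta> by simp
  note fixed = K L \<theta> w \<tau> half s t bound segment close
  have \<delta>: "wnorm w (rem s t i) \<le> \<delta>" for i
    unfolding \<delta>_def using wnorm_nonneg[OF w] by (intro member_le_sum) auto
  have \<delta>0: "0 \<le> \<delta>" unfolding \<delta>_def by (intro sum_nonneg wnorm_nonneg[OF w])
  define b where "b = ?A1 * ?e + ?A2 * \<tau> ^ N + ?C5 * (\<theta> * \<delta>)"
  have E: "wnorm w (U \<mu> t i - translate (\<Phi> s t) (U \<mu> s i)) \<le> L * b" for \<mu> i
    unfolding b_def by (rule wnorm_remainder_U_aux[OF fixed \<delta>])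
  have "\<delta> \<le> (\<Sum>i\<in>(UNIV :: 'k set). norm (\<rho> s t) + (\<Sum>\<mu>\<in>(UNIV :: 'd set). w * (L * b + L * ?C3 * \<tau> ^ (N - 1))))"
    unfolding \<delta>_def
  proof (rule sum_mono)
    fix i
    have "wnorm w (rem s t i) \<le> \<bar>\<rho> s t $ i\<bar> + (\<Sum>\<mu>\<in>UNIV. w * (wnorm w (U \<mu> t i - translate (\<Phi> s t) (U \<mu> s i)) + L * ?C3 * \<tau> ^ (N - 1)))"
      by (rule wnorm_rem[OF fixed])
    also have "\<dots> \<le> norm (\<rho> s t) + (\<Sum>\<mu>\<in>(UNIV :: 'd set). w * (L * b + L * ?C3 * \<tau> ^ (N - 1)))"
      by (rule add_mono[OF component_le_norm_cart], rule sum_mono, rule mult_left_mono[OF _ w],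
          rule add_right_mono, rule E)
    finally show "wnorm w (rem s t i) \<le> norm (\<rho> s t) + (\<Sum>\<mu>\<in>(UNIV :: 'd set). w * (L * b + L * ?C3 * \<tau> ^ (N - 1)))" .
  qed
  then have "\<theta> * \<delta> \<le> \<theta> * (\<Sum>i\<in>(UNIV :: 'k set). norm (\<rho> s t) + (\<Sum>\<mu>\<in>(UNIV :: 'd set). w * (L * b + L * ?C3 * \<tau> ^ (N - 1))))"
    using \<theta> by (intro mult_left_mono) auto
  also have "\<dots> = ?k * ?e + ?k * ?d * (\<tau> * b + ?C3 * (\<tau> * \<tau> ^ (N - 1)))"
    by (simp add: \<tau> algebra_simps)
  also have "\<tau> * \<tau> ^ (N - 1) = \<tau> ^ N" using N_pos by (simp add: power_eq_if[of _ N])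
  also have "?k * ?d * (\<tau> * b + ?C3 * \<tau> ^ N)
      = ?k * ?d * (\<tau> * (?A1 * ?e + ?A2 * \<tau> ^ N)) + (\<tau> * (?k * ?d * ?C5)) * (\<theta> * \<delta>) + ?k * ?d * (?C3 * \<tau> ^ N)"
    by (simp add: b_def algebra_simps)
  \<comment> \<open>The summand containing \<delta> receives the coefficient 1 / 2, so that it can
    be moved to the other side; elsewhere \<tau> is simply bounded by 1.\<close>
  also have "?k * e + (?k * ?d * (\<tau> * (?A1 * ?e + ?A2 * \<tau> ^ N)) + (\<tau> * (?k * ?d * ?C5)) * (\<theta> * \<delta>) + ?k * ?d * (?C3 * \<tau> ^ N))
      \<le> ?k * e + (?k * ?d * (1 * (?A1 * ?e + ?A2 * \<tau> ^ N)) + 1 / 2 * (\<theta> * \<delta>) + ?k * ?d * (?C3 * \<tau> ^ N))" for e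
  proof -
    have "\<tau> * (?k * ?d * ?C5) \<le> 1 / 2"
    proof -
      have "0 \<le> ?k * ?d * ?C5" using nn by simp
      from mult_right_mono[OF \<tau>_le this] eps(3) show ?thesis by linarith
    qed
    then show ?thesis using nn \<delta>0 \<theta> \<tau>0 half e0
      by (intro add_mono mult_left_mono mult_right_mono order_refl add_nonneg_nonneg) auto
  qed
  finally have \<theta>\<delta>: "\<theta> * \<delta> \<le> 2 * (?k + ?k * ?d * ?A1) * ?e + 2 * (?k * ?d * (?A2 + ?C3)) * \<tau> ^ N"
    by (simp add: algebra_simps)
  have "b \<le> ?A1 * ?e + ?A2 * \<tau> ^ N + ?C5 * (2 * (?k + ?k * ?d * ?A1) * ?e + 2 * (?k * ?d * (?A2 + ?C3)) * \<tau> ^ N)"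
    unfolding b_def using \<theta>\<delta> nn by (intro add_left_mono mult_left_mono) auto
  also have "\<dots> = (?A1 + 2 * ?C5 * (?k + ?k * ?d * ?A1)) * ?e + (?A2 + 2 * ?C5 * (?k * ?d * (?A2 + ?C3))) * \<tau> ^ N"
    by (simp add: algebra_simps)
  also have "\<dots> \<le> key_const ?d ?k N K * ?e + key_const ?d ?k N K * \<tau> ^ N"
  proof -
    have "0 \<le> ?A1 + 2 * ?C5 * (?k + ?k * ?d * ?A1)" "0 \<le> ?A2 + 2 * ?C5 * (?k * ?d * (?A2 + ?C3))"
      using nn by (simp_all add: add_nonneg_nonneg)
    then have "?A1 + 2 * ?C5 * (?k + ?k * ?d * ?A1) \<le> key_const ?d ?k N K"
      "?A2 + 2 * ?C5 * (?k * ?d * (?A2 + ?C3)) \<le> key_const ?d ?k N K"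
      unfolding key_const_def by linarith+
    then show ?thesis using e0 \<tau>0 by (intro add_mono mult_right_mono) auto
  qed
  finally have "L * b \<le> L * (key_const ?d ?k N K * ?e + key_const ?d ?k N K * \<tau> ^ N)"
    using L by (intro mult_left_mono) auto
  then show ?thesis using E[of \<mu> i] by (simp add: algebra_simps)
qed

section \<open>The germ of the rough integral\<close>

definition \<Xi> :: "real \<Rightarrow> real \<Rightarrow> real ^ 'k" where
  "\<Xi> s t = (\<Sum>\<mu>\<in>UNIV. germ N X (compose_path N (\<lambda>x. column \<mu> (\<sigma> x)) Y) \<mu> s t)"

lemma forest_size_keys_U: "f \<in> keys (U \<mu> s i) \<Longrightarrow> forest_size f \<le> N - 1"
  by (auto simp: U_eq_taylor in_keys_iff lookup_proj_le split: if_splits)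

lemma is_character_X: "s \<in> {0..1} \<Longrightarrow> t \<in> {0..1} \<Longrightarrow> is_character N (X s t)"
  using rough by (simp add: rough_path_def)

lemma \<Xi>_component:
  assumes "s \<in> {0..1}" "t \<in> {0..1}"
  shows "\<Xi> s t $ i = (\<Sum>\<mu>\<in>UNIV. pairing (\<Phi> s t) (Graft \<mu> (U \<mu> s i)))"
proof -
  have "germ N X (compose_path N (\<lambda>x. column \<mu> (\<sigma> x)) Y) \<mu> s t $ i = pairing (\<Phi> s t) (Graft \<mu> (U \<mu> s i))" for \<mu>
  proof -
    let ?F = "forests_upto N (int N - 1) :: 'd forest set"
    have F: "f \<in> ?F \<longleftrightarrow> forest_size f \<le> N - 1" for f
      using forests_if_size_le[of f N] N_pos by (auto simp: forests_upto_def)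
    have "germ N X (compose_path N (\<lambda>x. column \<mu> (\<sigma> x)) Y) \<mu> s t $ i
        = (\<Sum>f\<in>?F. lookup (U \<mu> s i) f * \<Phi> s t (graft \<mu> f))"
      unfolding germ_def sum_component
    proof (rule sum.cong[OF refl])
      fix f assume "f \<in> ?F"
      then have "graft \<mu> f \<in> forests N" using N_pos F by (intro forests_if_size_le) simp
      from tree_char_eq[OF is_character_X[OF assms] this]
      show "(X s t (basis (graft \<mu> f)) *\<^sub>R coef f (compose_path N (\<lambda>x. column \<mu> (\<sigma> x)) Y s)) $ i
          = lookup (U \<mu> s i) f * \<Phi> s t (graft \<mu> f)"
        by (simp add: coef_def U_def)
    qed
    also have "\<dots> = pairing (\<lambda>f. \<Phi> s t (graft \<mu> f)) (U \<mu> s i)"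
      by (rule pairing_eq_sum[symmetric]) (use F forest_size_keys_U in auto)
    finally show ?thesis by (simp add: Graft_def pairing_lin_ext)
  qed
  then show ?thesis by (simp add: \<Xi>_def)
qed

text \<open>Chen's relation and the grafting rule split the germ over the long interval; what is
  left is the remainder of the composed path, grafted once. The graft supplies the extra factor of
  noise that brings the exponent to (N + 1) \<alpha> > 1.\<close>

lemma \<Xi>_defect:
  assumes "s \<in> {0..1}" "u \<in> {0..1}" "t \<in> {0..1}"
  shows "(\<Xi> s t - \<Xi> s u - \<Xi> u t) $ i
    = - (\<Sum>\<mu>\<in>UNIV. pairing (\<Phi> u t) (Graft \<mu> (U \<mu> u i - translate (\<Phi> s u) (U \<mu> s i))))"
proof -
  have "pairing (\<Phi> s t) (Graft \<mu> (U \<mu> s i))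
      = pairing (\<Phi> s u) (Graft \<mu> (U \<mu> s i)) + pairing (\<Phi> u t) (Graft \<mu> (translate (\<Phi> s u) (U \<mu> s i)))" for \<mu>
  proof -
    have "keys (Graft \<mu> (U \<mu> s i)) \<subseteq> trees1 N"
    proof
      fix f assume "f \<in> keys (Graft \<mu> (U \<mu> s i))"
      then obtain g where "g \<in> keys (U \<mu> s i)" "f = graft \<mu> g"
        using keys_Graft[of \<mu> "U \<mu> s i"] by auto
      then show "f \<in> trees1 N"
        using forest_size_keys_U[of g \<mu> s i] N_pos by (auto simp: trees1_def trees_def graft_def)
    qed
    from chen[OF rough assms this] show ?thesis
      by (simp add: tree_char.translate_Graft pairing_add tree_char.empty)
  qed
  then show ?thesis
    by (simp add: \<Xi>_component[OF assms(1,2)] \<Xi>_component[OF assms(1,3)] \<Xi>_component[OF assms(2,3)] Graft_diff pairing_diff sum.distrib sum_subtractf)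
qed

lemma norm_le_card: "(\<And>i. \<bar>(v :: real ^ 'k) $ i\<bar> \<le> b) \<Longrightarrow> norm v \<le> real CARD('k) * b"
proof -
  assume "\<And>i. \<bar>v $ i\<bar> \<le> b"
  then have "(\<Sum>i\<in>UNIV. \<bar>v $ i\<bar>) \<le> (\<Sum>i\<in>(UNIV :: 'k set). b)" by (intro sum_mono)
  then show ?thesis using norm_le_l1_cart[of v] by simp
qed

lemma abs_sum_pairing_Graft_le:
  assumes "0 \<le> w" "\<And>f. \<bar>\<phi> f\<bar> \<le> w ^ forest_size f" "\<And>\<mu>. wnorm w (x \<mu>) \<le> b"
  shows "\<bar>\<Sum>\<mu>\<in>(UNIV :: 'd set). pairing \<phi> (Graft \<mu> (x \<mu>))\<bar> \<le> real CARD('d) * (w * b)"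
proof -
  have "\<bar>pairing \<phi> (Graft \<mu> (x \<mu>))\<bar> \<le> w * b" for \<mu>
    using abs_pairing_le_wnorm[OF assms(2), of "Graft \<mu> (x \<mu>)"] wnorm_Graft[OF assms(1), of \<mu> "x \<mu>"]
      mult_left_mono[OF assms(3) assms(1), of \<mu>] by linarith
  then have "(\<Sum>\<mu>\<in>(UNIV :: 'd set). \<bar>pairing \<phi> (Graft \<mu> (x \<mu>))\<bar>) \<le> (\<Sum>\<mu>\<in>(UNIV :: 'd set). w * b)"
    by (intro sum_mono)
  then show ?thesis by (intro order_trans[OF sum_abs]) simp
qed

text \<open>Only forests with at most \<open>N\<close> vertices enter the tensor pairing, so
  character and extension may be exchanged. This makes the control hypothesis available for
  \<open>\<rho>\<close>.\<close>

lemma \<rho>_eq_remainder: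
  assumes "s \<in> {0..1}" "t \<in> {0..1}" shows "\<rho> s t = remainder X Y {#} s t"
proof -
  have "tensor_pair (X s t) (\<lambda>x. lookup x {#}) (coproduct (Y s $ i)) = lookup (translate (\<Phi> s t) (Y s $ i)) {#}" for i
  proof -
    have "X s t (basis g) = \<Phi> s t g" if gk: "(g, k) \<in> keys (coproduct (Y s $ i))" for g k
    proof -
      obtain f where f: "f \<in> keys (Y s $ i)" "forest_size g + forest_size k = forest_size f"
        using keys_coproduct[OF gk] by blast
      have "f = {#} \<or> f \<in> keys (a s i)"
        using f(1) Poly_Mapping.keys_add[of "Poly_Mapping.single {#} (y s $ i)" "a s i"]
        unfolding Y_eq_y_a[OF assms(1)] by (auto split: if_splits)
      then have "forest_size f \<le> N" using forest_size_keys_a[OF assms(1)] by auto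
      then show ?thesis using f(2) tree_char_eq[OF is_character_X[OF assms] forests_if_size_le] by simp
    qed
    then have "tensor_pair (X s t) (\<lambda>x. lookup x {#}) (coproduct (Y s $ i))
        = pairing (\<lambda>k. lookup (basis k) {#}) (contract (\<Phi> s t) (coproduct (Y s $ i)))"
      by (rule tensor_pair_eq_pairing_contract)
    then show ?thesis by (simp only: pairing_lookup translate_def)
  qed
  then show ?thesis by (simp add: vec_eq_iff \<rho>_def remainder_def rem_def lookup_minus coef_def)
qed

text \<open>Purely qualitative, as \<open>A\<close> depends on the solution: it yields continuity
  and starts the iteration that removes the dependence.\<close>

lemma controlled_bound:
  obtains A where "0 \<le> A" "\<And>s t. s \<in> {0..1} \<Longrightarrow> t \<in> {0..1} \<Longrightarrow> s \<noteq> t \<Longrightarrow> \<bar>t - s\<bar> < 1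
    \<Longrightarrow> norm (\<rho> s t) \<le> A * \<bar>t - s\<bar> powr (real N * \<alpha>)"
proof -
  have "({#} :: 'd forest) \<in> forests_upto N (int N - 1)"
    using N_pos by (simp add: forests_upto_def forests_def)
  moreover have "controlled \<alpha> N X Y" using solution by (simp add: is_solution_def)
  ultimately have "bdd_above {norm (remainder X Y {#} s t) / \<bar>t - s\<bar> powr ((real N - real (forest_size ({#} :: 'd forest))) * \<alpha>) | s t.
      s \<in> {0..1} \<and> t \<in> {0..1} \<and> 0 < \<bar>s - t\<bar> \<and> \<bar>s - t\<bar> < 1}" (is "bdd_above ?S")
    unfolding controlled_def by (elim bspec[rotated])
  then obtain A where A': "\<And>x. x \<in> ?S \<Longrightarrow> x \<le> A"
    unfolding bdd_above_def by blast
  have A: "norm (remainder X Y {#} s t) / \<bar>t - s\<bar> powr (real N * \<alpha>) \<le> A"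
    if "s \<in> {0..1}" "t \<in> {0..1}" "0 < \<bar>s - t\<bar>" "\<bar>s - t\<bar> < 1" for s t
    using that by (intro A') auto
  have "norm (\<rho> s t) \<le> max A 0 * \<bar>t - s\<bar> powr (real N * \<alpha>)"
    if "s \<in> {0..1}" "t \<in> {0..1}" "s \<noteq> t" "\<bar>t - s\<bar> < 1" for s t
  proof -
    have "norm (\<rho> s t) / \<bar>t - s\<bar> powr (real N * \<alpha>) \<le> max A 0"
      using A[of s t] that \<rho>_eq_remainder by (simp add: abs_minus_commute)
    then show ?thesis using that by (simp add: field_simps)
  qed
  then show ?thesis using that[of "max A 0"] by simp
qed

end

section \<open>Sewing along dyadic partitions\<close>

lemma sum_lessThan_double: "(\<Sum>i<2 * (M::nat). f i) = (\<Sum>i<M. f (2 * i) + f (Suc (2 * i)) :: 'a::comm_monoid_add)"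
  by (induction M) (simp_all add: add_ac)

lemma sum_lessThan_plus: "(\<Sum>i<a + (b::nat). f i) = (\<Sum>i<a. f i) + (\<Sum>i<b. f (a + i) :: 'a::comm_monoid_add)"
  by (induction b) (simp_all add: add_ac)

definition dyadic :: "real \<Rightarrow> real \<Rightarrow> nat \<Rightarrow> nat \<Rightarrow> real" where
  "dyadic s t n i = s + (t - s) * real i / 2 ^ n"

lemma dyadic_Suc_even: "dyadic s t (Suc n) (2 * i) = dyadic s t n i"
  by (simp add: dyadic_def)

lemma dyadic_Suc_odd:
  "dyadic s t (Suc n) (Suc (2 * i)) = (dyadic s t n i + dyadic s t n (Suc i)) / 2"
  by (simp add: dyadic_def field_simps)

lemma dyadic_diff: "dyadic s t n (Suc i) - dyadic s t n i = (t - s) / 2 ^ n"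
  by (simp add: dyadic_def field_simps)

text \<open>Each refinement changes the Riemann sum by midpoint defects only, in total at most
  \<open>M * q ^ n\<close> with \<open>q < 1\<close>. Convergence to the integral is given, so
  general partitions need not be compared.\<close>

lemma dyadic_sewing:
  fixes \<Xi> :: "real \<Rightarrow> real \<Rightarrow> 'a::real_normed_vector"
  assumes st: "s < t" and z: "1 < z" and B: "0 \<le> B"
    and defect: "\<And>a b. s \<le> a \<Longrightarrow> a < b \<Longrightarrow> b \<le> t
      \<Longrightarrow> norm (\<Xi> a b - \<Xi> a ((a + b) / 2) - \<Xi> ((a + b) / 2) b) \<le> B * (b - a) powr z"
    and lim: "(\<lambda>n. \<Sum>i<2 ^ n. \<Xi> (dyadic s t n i) (dyadic s t n (Suc i))) \<longlonglongrightarrow> I"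
  shows "norm (I - \<Xi> s t) \<le> B * (t - s) powr z / (1 - 2 powr (1 - z))"
proof -
  define P where "P = (\<lambda>n. \<Sum>i<2 ^ n. \<Xi> (dyadic s t n i) (dyadic s t n (Suc i)))"
  define q :: real where "q = 2 powr (1 - z)"
  define M where "M = B * (t - s) powr z"
  have q: "0 < q" "q < 1" using z powr_less_mono[of "1 - z" 0 "2::real"] by (simp_all add: q_def)
  have M: "0 \<le> M" using B by (simp add: M_def)
  have step: "norm (P (Suc n) - P n) \<le> M * q ^ n" for n
  proof -
    let ?r = "dyadic s t n"
    have mono: "s \<le> ?r i" "?r i < ?r (Suc i)" "?r (Suc i) \<le> t" if "i < 2 ^ n" for i
    proof -
      show "s \<le> ?r i" using st by (simp add: dyadic_def)
      show "?r i < ?r (Suc i)" using dyadic_diff[of s t n i] st by (metis diff_gt_0_iff_gt zero_less_divide_iff zero_less_numeral zero_less_power)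
      have "real (Suc i) \<le> 2 ^ n" using that by (metis Suc_leI of_nat_le_iff of_nat_numeral of_nat_power)
      then have "(t - s) * real (Suc i) / 2 ^ n \<le> (t - s) * 2 ^ n / 2 ^ n"
        using st by (intro divide_right_mono mult_left_mono) auto
      then show "?r (Suc i) \<le> t" by (simp add: dyadic_def)
    qed
    have eq: "P (Suc n) - P n = - (\<Sum>i<2 ^ n. \<Xi> (?r i) (?r (Suc i)) - \<Xi> (?r i) ((?r i + ?r (Suc i)) / 2) - \<Xi> ((?r i + ?r (Suc i)) / 2) (?r (Suc i)))"
    proof -
      have "dyadic s t (Suc n) (Suc (Suc (2 * i))) = ?r (Suc i)" for i
        using dyadic_Suc_even[of s t n "Suc i"] by simp
      then have "P (Suc n) = (\<Sum>i<2 ^ n. \<Xi> (?r i) ((?r i + ?r (Suc i)) / 2) + \<Xi> ((?r i + ?r (Suc i)) / 2) (?r (Suc i)))"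
        unfolding P_def power_Suc sum_lessThan_double by (simp only: dyadic_Suc_even dyadic_Suc_odd)
      then show ?thesis by (simp add: P_def sum_subtractf sum.distrib)
    qed
    have "norm (P (Suc n) - P n) \<le> (\<Sum>i<(2::nat) ^ n. B * ((t - s) / 2 ^ n) powr z)"
      unfolding eq norm_minus_cancel
    proof (rule sum_norm_le)
      fix i :: nat assume "i \<in> {..<2 ^ n}"
      then have i: "i < 2 ^ n" by simp
      show "norm (\<Xi> (?r i) (?r (Suc i)) - \<Xi> (?r i) ((?r i + ?r (Suc i)) / 2) - \<Xi> ((?r i + ?r (Suc i)) / 2) (?r (Suc i)))
          \<le> B * ((t - s) / 2 ^ n) powr z"
        using defect[OF mono[OF i]] by (simp only: dyadic_diff)
    qed
    also have "\<dots> = M * (2 ^ n / (2 ^ n) powr z)"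
    proof -
      have "((t - s) / 2 ^ n) powr z = (t - s) powr z / (2 ^ n) powr z"
        by (rule powr_divide)
      then show ?thesis by (simp only: sum_constant card_lessThan M_def) simp
    qed
    also have "(2::real) ^ n / (2 ^ n) powr z = q ^ n"
    proof -
      have pow: "(2::real) ^ n = 2 powr real n" by (simp add: powr_realpow)
      have "(2::real) ^ n / (2 ^ n) powr z = 2 powr (real n * (1 - z))"
        unfolding pow by (simp add: powr_powr right_diff_distrib flip: powr_diff)
      also have "\<dots> = q ^ n"
        by (simp add: q_def powr_power mult.commute)
      finally show ?thesis .
    qed
    finally show ?thesis .
  qed
  have partial: "norm (P n - P 0) \<le> M * (\<Sum>j<n. q ^ j)" for n
  proof (induction n)
    case (Suc n)
    have "norm (P (Suc n) - P 0) \<le> norm (P (Suc n) - P n) + norm (P n - P 0)"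
      using norm_triangle_ineq[of "P (Suc n) - P n" "P n - P 0"] by simp
    also have "\<dots> \<le> M * q ^ n + M * (\<Sum>j<n. q ^ j)" using step Suc by (intro add_mono)
    finally show ?case by (simp add: algebra_simps)
  qed simp
  have "norm (P n - P 0) \<le> M / (1 - q)" for n
  proof -
    have "(\<Sum>j<n. q ^ j) = (1 - q ^ n) / (1 - q)" using q by (simp add: sum_gp_strict)
    also have "\<dots> \<le> 1 / (1 - q)" using q by (intro divide_right_mono) auto
    finally have "M * (\<Sum>j<n. q ^ j) \<le> M * (1 / (1 - q))" using M by (intro mult_left_mono)
    then show ?thesis using partial[of n] by simp
  qed
  moreover have "(\<lambda>n. norm (P n - P 0)) \<longlonglongrightarrow> norm (I - P 0)"
    using lim unfolding P_def by (intro tendsto_intros)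
  ultimately have "norm (I - P 0) \<le> M / (1 - q)"
    by (intro tendsto_upperbound[of _ "norm (I - P 0)" sequentially]) auto
  then show ?thesis by (simp add: P_def M_def q_def dyadic_def)
qed

text \<open>The equation provides integrals from time 0. A fine partition of \<open>[0, s]\<close>
  put in front of one of \<open>[s, t]\<close> is a partition of \<open>[0, t]\<close>, and the sums
  subtract.\<close>

lemma has_rough_integral_diff:
  assumes I1: "has_rough_integral N X U \<mu> 0 s I1" and I2: "has_rough_integral N X U \<mu> 0 t I2" and s: "0 \<le> s"
  shows "has_rough_integral N X U \<mu> s t (I2 - I1)"
  unfolding has_rough_integral_def
proof (intro allI impI)
  fix e :: real assume "0 < e"
  then have e: "0 < e / 2" by simp
  obtain d1 where d1: "0 < d1" "\<And>n r. r 0 = 0 \<and> r n = s \<and> (\<forall>i<n. r i < r (Suc i) \<and> r (Suc i) - r i < d1)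
      \<Longrightarrow> norm ((\<Sum>i<n. germ N X U \<mu> (r i) (r (Suc i))) - I1) < e / 2"
    using I1 e unfolding has_rough_integral_def by blast
  obtain d2 where d2: "0 < d2" "\<And>n r. r 0 = 0 \<and> r n = t \<and> (\<forall>i<n. r i < r (Suc i) \<and> r (Suc i) - r i < d2)
      \<Longrightarrow> norm ((\<Sum>i<n. germ N X U \<mu> (r i) (r (Suc i))) - I2) < e / 2"
    using I2 e unfolding has_rough_integral_def by blast
  define d where "d = min d1 d2"
  have d: "0 < d" using d1 d2 by (simp add: d_def)
  \<comment> \<open>Partitions are strictly increasing, so for \<open>s = 0\<close> the partition
    without subintervals is used; otherwise a uniform one.\<close>
  obtain n0 p where p: "p 0 = 0" "p n0 = s" "\<And>i. i < n0 \<Longrightarrow> p i < p (Suc i) \<and> p (Suc i) - p i < d"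
  proof (cases "s = 0")
    case True
    then show ?thesis using that[of "\<lambda>i. 0" 0] by simp
  next
    case False
    then have s: "0 < s" using s by simp
    obtain n :: nat where n: "s / d < real n" using reals_Archimedean2 by blast
    have n0: "0 < real n" using n s d by (meson divide_pos_pos less_trans)
    have "s * real (Suc i) / n - s * real i / n = s / n" for i using n0 by (simp add: add_divide_distrib distrib_left)
    moreover have "s / n < d" using n n0 d by (simp add: field_simps)
    moreover have "0 < s / n" using s n0 by simp
    ultimately show ?thesis using n0 by (intro that[of "\<lambda>i. s * real i / n" n]) (auto, smt (verit))
  qed
  show "\<exists>\<delta>>0. \<forall>n r. r 0 = s \<and> r n = t \<and> (\<forall>i<n. r i < r (Suc i) \<and> r (Suc i) - r i < \<delta>)
      \<longrightarrow> norm ((\<Sum>i<n. germ N X U \<mu> (r i) (r (Suc i))) - (I2 - I1)) < e"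
  proof (intro exI[of _ d] conjI allI impI)
    fix n and r :: "nat \<Rightarrow> real"
    assume r: "r 0 = s \<and> r n = t \<and> (\<forall>i<n. r i < r (Suc i) \<and> r (Suc i) - r i < d)"
    define c where "c = (\<lambda>i. if i \<le> n0 then p i else r (i - n0))"
    have c1: "c i = p i" if "i \<le> n0" for i using that by (simp add: c_def)
    have c2: "c (n0 + i) = r i" for i using p r by (cases i) (simp_all add: c_def)
    have step: "c i < c (Suc i) \<and> c (Suc i) - c i < d" if "i < n0 + n" for i
    proof (cases "i < n0")
      case True
      then show ?thesis using p(3) by (simp add: c1)
    next
      case False
      then obtain j where j: "i = n0 + j" by (metis le_iff_add not_less)
      then show ?thesis using that r c2[of j] c2[of "Suc j"] by simp
    qed
    let ?S = "\<lambda>f n. \<Sum>i<n. germ N X U \<mu> (f i) (f (Suc i))"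
    have "?S c (n0 + n) = ?S p n0 + ?S r n"
      unfolding sum_lessThan_plus using c2 c1
      by (intro arg_cong2[of _ _ _ _ "(+)"] sum.cong refl) (simp_all flip: add_Suc_right)
    moreover have "norm (?S c (n0 + n) - I2) < e / 2"
      using step c1[of 0] c2[of n] p r by (intro d2) (auto simp: d_def)
    moreover have "norm (?S p n0 - I1) < e / 2"
      using p by (intro d1) (auto simp: d_def)
    ultimately show "norm (?S r n - (I2 - I1)) < e"
      using norm_triangle_ineq4[of "?S c (n0 + n) - I2" "?S p n0 - I1"] by (simp add: algebra_simps)
  qed (rule d)
qed

lemma has_rough_integral_dyadic:
  assumes I: "has_rough_integral N X U \<mu> s t I" and st: "s < t"
  shows "(\<lambda>n. \<Sum>i<2 ^ n. germ N X U \<mu> (dyadic s t n i) (dyadic s t n (Suc i))) \<longlonglongrightarrow> I"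
proof (rule LIMSEQ_I)
  fix e :: real assume "0 < e"
  then obtain d where d: "0 < d" "\<And>n r. r 0 = s \<and> r n = t \<and> (\<forall>i<n. r i < r (Suc i) \<and> r (Suc i) - r i < d)
      \<Longrightarrow> norm ((\<Sum>i<n. germ N X U \<mu> (r i) (r (Suc i))) - I) < e"
    using I unfolding has_rough_integral_def by blast
  obtain n0 where n0: "(1 / 2) ^ n0 < d / (t - s)"
    using real_arch_pow_inv[of "d / (t - s)" "1 / 2"] d st by auto
  show "\<exists>no. \<forall>n\<ge>no. norm ((\<Sum>i<2 ^ n. germ N X U \<mu> (dyadic s t n i) (dyadic s t n (Suc i))) - I) < e"
  proof (intro exI[of _ n0] allI impI d(2))
    fix n assume "n0 \<le> n"
    then have "(1 / 2 :: real) ^ n \<le> (1 / 2) ^ n0" by (intro power_decreasing) auto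
    then have "(1 / 2) ^ n < d / (t - s)" using n0 by linarith
    then have "(t - s) / 2 ^ n < d" using st by (simp add: field_simps power_divide)
    moreover have "0 < (t - s) / 2 ^ n" using st by simp
    ultimately have "dyadic s t n i < dyadic s t n (Suc i) \<and> dyadic s t n (Suc i) - dyadic s t n i < d" for i
      using dyadic_diff[of s t n i] by linarith
    then show "dyadic s t n 0 = s \<and> dyadic s t n (2 ^ n) = t
        \<and> (\<forall>i<2 ^ n. dyadic s t n i < dyadic s t n (Suc i) \<and> dyadic s t n (Suc i) - dyadic s t n i < d)"
      by (simp add: dyadic_def)
  qed
qed

text \<open>\<open>k\<close> comes from passing from components to the norm, \<open>d\<close> from
  the sum over the columns, and the denominator from the geometric series of the dyadic
  refinements.\<close>

definition sew_const :: "real \<Rightarrow> real \<Rightarrow> real \<Rightarrow> nat \<Rightarrow> real \<Rightarrow> real" where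
  "sew_const \<alpha> d k N K = k * d * key_const d k N K / (1 - 2 powr (1 - (real N + 1) * \<alpha>))"

text \<open>The first summand bounds the germ. The second is the fixed point 2 c of the improvement
  map Q / 2 + c, divided by the noise level.\<close>

definition incr_const :: "real \<Rightarrow> real \<Rightarrow> real \<Rightarrow> nat \<Rightarrow> real \<Rightarrow> real" where
  "incr_const \<alpha> d k N K = k * d * coeff_const d k N K
    + 2 * sew_const \<alpha> d k N K * (2 + k * d * coeff_const d k N K)"

lemma sew_const_nonneg:
  assumes "0 \<le> d" "0 \<le> k" "0 \<le> K" "1 < (real N + 1) * \<alpha>" shows "0 \<le> sew_const \<alpha> d k N K"
proof -
  have "2 powr (1 - (real N + 1) * \<alpha>) < (2::real) powr 0" using assms by (intro powr_less_mono) auto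
  then show ?thesis using key_const_nonneg[OF assms(1-3), of N] assms by (simp add: sew_const_def)
qed

lemma abs_X_le_seminorm:
  assumes "rough_path \<alpha> N X" "h \<in> trees N" "rp_seminorm \<alpha> X {#h#} \<le> R ^ tree_size h"
    and "s \<in> {0..1}" "t \<in> {0..1}" "s \<noteq> t"
  shows "\<bar>X s t (basis {#h#})\<bar> \<le> (R * \<bar>s - t\<bar> powr \<alpha>) ^ tree_size h"
proof -
  let ?q = "\<bar>s - t\<bar> powr (\<alpha> * real (tree_size h))"
  have "bdd_above (rp_quotients \<alpha> X {#h#})" using assms(1,2) by (simp add: rough_path_def)
  moreover have "\<bar>X s t (basis {#h#})\<bar> / ?q \<in> rp_quotients \<alpha> X {#h#}"
    using assms(4-6) unfolding rp_quotients_def by (force simp: forest_size_def)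
  ultimately have "\<bar>X s t (basis {#h#})\<bar> / ?q \<le> R ^ tree_size h"
    using assms(3) unfolding rp_seminorm_def by (meson cSup_upper order_trans)
  moreover have "0 < ?q" using assms(6) by simp
  ultimately have "\<bar>X s t (basis {#h#})\<bar> \<le> R ^ tree_size h * ?q" by (simp add: field_simps)
  then show ?thesis using assms(6) by (simp add: power_mult_distrib powr_power mult.commute)
qed

lemma rp_seminorm_nonneg:
  assumes "rough_path \<alpha> N X" "h \<in> trees N" shows "0 \<le> rp_seminorm \<alpha> X {#h#}"
proof -
  have "bdd_above (rp_quotients \<alpha> X {#h#})" using assms by (simp add: rough_path_def)
  moreover have "\<bar>X 0 1 (basis {#h#})\<bar> / \<bar>0 - 1\<bar> powr (\<alpha> * real (forest_size {#h#})) \<in> rp_quotients \<alpha> X {#h#}"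
    unfolding rp_quotients_def by (rule CollectI, rule exI[of _ 0], rule exI[of _ 1]) simp
  ultimately show ?thesis unfolding rp_seminorm_def by (intro cSup_upper2) auto
qed

context rde_solution
begin

section \<open>Continuity and increments of the solution\<close>

lemma abs_\<Phi>_le:
  assumes "0 \<le> R" and "\<And>h. h \<in> trees N \<Longrightarrow> \<bar>X s t (basis {#h#})\<bar> \<le> (R * \<bar>s - t\<bar> powr \<alpha>) ^ tree_size h"
  shows "\<bar>\<Phi> s t f\<bar> \<le> (R * \<bar>s - t\<bar> powr \<alpha>) ^ forest_size f"
  using assms by (intro abs_tree_char_le) auto

lemma exists_rough_bound:
  obtains R where "0 \<le> R"
    "\<And>s t f. s \<in> {0..1} \<Longrightarrow> t \<in> {0..1} \<Longrightarrow> s \<noteq> t \<Longrightarrow> \<bar>\<Phi> s t f\<bar> \<le> (R * \<bar>s - t\<bar> powr \<alpha>) ^ forest_size f"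
proof -
  define R where "R = 1 + (\<Sum>h\<in>trees N. rp_seminorm \<alpha> X {#h#})"
  have nn: "0 \<le> rp_seminorm \<alpha> X {#h#}" if "h \<in> trees N" for h
    using rp_seminorm_nonneg[OF rough that] .
  have R1: "1 \<le> R" using nn by (simp add: R_def sum_nonneg)
  have "rp_seminorm \<alpha> X {#h#} \<le> R ^ tree_size h" if "h \<in> trees N" for h
  proof -
    have "rp_seminorm \<alpha> X {#h#} \<le> R"
      using member_le_sum[of h "trees N" "\<lambda>h. rp_seminorm \<alpha> X {#h#}"] nn that by (simp add: R_def)
    also have "\<dots> \<le> R ^ tree_size h"
      using R1 tree_size_pos[of h] power_increasing[of 1 "tree_size h" R] by simp
    finally show ?thesis .
  qed
  then show ?thesis
    using R1 by (intro that[of R] abs_\<Phi>_le abs_X_le_seminorm[OF rough]) auto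
qed

text \<open>The remainder vanishes by control and the pairing with the driver by its
  \<alpha>-scaling. Continuity makes the drift integrable and gives meaning to first exit
  times.\<close>

lemma continuous_y: "continuous_on {0..1} y"
  unfolding continuous_on_def
proof
  fix s :: real assume s: "s \<in> {0..1}"
  obtain R where R: "0 \<le> R"
    "\<And>s t f. s \<in> {0..1} \<Longrightarrow> t \<in> {0..1} \<Longrightarrow> s \<noteq> t \<Longrightarrow> \<bar>\<Phi> s t f\<bar> \<le> (R * \<bar>s - t\<bar> powr \<alpha>) ^ forest_size f"
    using exists_rough_bound by blast
  obtain A where A: "0 \<le> A" "\<And>s t. s \<in> {0..1} \<Longrightarrow> t \<in> {0..1} \<Longrightarrow> s \<noteq> t \<Longrightarrow> \<bar>t - s\<bar> < 1
    \<Longrightarrow> norm (\<rho> s t) \<le> A * \<bar>t - s\<bar> powr (real N * \<alpha>)" using controlled_bound by blast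
  define b where "b = (\<Sum>i\<in>UNIV. \<Sum>\<mu>\<in>UNIV. wnorm R (V \<mu> s i))"
  let ?g = "\<lambda>t. real CARD('k) * (A * \<bar>t - s\<bar> powr (real N * \<alpha>) + real CARD('d) * (R * \<bar>t - s\<bar> powr \<alpha> * b))"
  have le: "norm (y t - y s) \<le> ?g t" if t: "t \<in> {0..1}" "t \<noteq> s" "\<bar>t - s\<bar> < 1" for t
  proof (rule norm_le_card)
    fix i
    have w: "0 \<le> R * \<bar>s - t\<bar> powr \<alpha>" "R * \<bar>s - t\<bar> powr \<alpha> \<le> R"
      using R(1) t(3) \<alpha>_pos by (auto simp: mult_left_le powr_le1)
    have "wnorm (R * \<bar>s - t\<bar> powr \<alpha>) (V \<mu> s i) \<le> b" for \<mu>
    proof -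
      have "wnorm (R * \<bar>s - t\<bar> powr \<alpha>) (V \<mu> s i) \<le> wnorm R (V \<mu> s i)"
        by (rule wnorm_mono[OF w])
      also have "\<dots> \<le> (\<Sum>\<mu>\<in>UNIV. wnorm R (V \<mu> s i))"
        by (intro member_le_sum wnorm_nonneg[OF R(1)]) auto
      also have "\<dots> \<le> b" unfolding b_def
        by (intro member_le_sum[where f = "\<lambda>i. \<Sum>\<mu>\<in>UNIV. wnorm R (V \<mu> s i)"] sum_nonneg wnorm_nonneg[OF R(1)]) auto
      finally show ?thesis .
    qed
    from abs_sum_pairing_Graft_le[OF w(1) R(2)[OF s t(1)] this] t(2)
    have "\<bar>\<Sum>\<mu>\<in>UNIV. pairing (\<Phi> s t) (Graft \<mu> (V \<mu> s i))\<bar> \<le> real CARD('d) * (R * \<bar>t - s\<bar> powr \<alpha> * b)"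
      by (simp add: abs_minus_commute)
    moreover have "\<bar>\<rho> s t $ i\<bar> \<le> A * \<bar>t - s\<bar> powr (real N * \<alpha>)"
      using A(2)[OF s t(1)] t component_le_norm_cart[of "\<rho> s t" i] by auto
    ultimately show "\<bar>(y t - y s) $ i\<bar> \<le> A * \<bar>t - s\<bar> powr (real N * \<alpha>) + real CARD('d) * (R * \<bar>t - s\<bar> powr \<alpha> * b)"
      using \<rho>_component[OF s t(1), of i] by simp
  qed
  have "(?g \<longlongrightarrow> 0) (at s within {0..1})"
  proof -
    have p: "((\<lambda>t. \<bar>t - s\<bar> powr e) \<longlongrightarrow> 0) (at s within {0..1})" if "0 < e" for e
    proof (rule tendsto_zero_powrI)
      show "((\<lambda>t. \<bar>t - s\<bar>) \<longlongrightarrow> 0) (at s within {0..1})"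
        by (rule tendsto_eq_rhs[OF tendsto_rabs[OF tendsto_diff[OF tendsto_ident_at tendsto_const]]]) simp
    qed (use that in auto)
    have "(?g \<longlongrightarrow> real CARD('k) * (A * 0 + real CARD('d) * (R * 0 * b))) (at s within {0..1})"
      using N_pos \<alpha>_pos by (intro tendsto_intros p) auto
    then show ?thesis by simp
  qed
  moreover have "\<forall>\<^sub>F t in at s within {0..1}. norm (y t - y s) \<le> ?g t"
    unfolding eventually_at using le by (intro exI[of _ 1]) (auto simp: dist_real_def)
  ultimately have "((\<lambda>t. y t - y s) \<longlongrightarrow> 0) (at s within {0..1})"
    by (rule Lim_null_comparison[rotated])
  then show "(y \<longlongrightarrow> y s) (at s within {0..1})" by (simp add: Lim_null[of y])
qed

lemma continuous_damping: "continuous_on {0..1} (\<lambda>r. norm (y r) powr (m - 1) *\<^sub>R y r)"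
  using m_gt_1 by (intro continuous_on_scaleR continuous_on_powr' continuous_y continuous_intros) auto

lemma drift_diff:
  assumes "0 \<le> s" "s \<le> t" "t \<le> 1" shows "drift 0 t - drift 0 s = drift s t"
proof -
  have "(\<lambda>r. norm (y r) powr (m - 1) *\<^sub>R y r) integrable_on {0..t}"
    using continuous_on_subset[OF continuous_damping, of "{0..t}"] assms
    by (intro integrable_continuous_interval) auto
  from Henstock_Kurzweil_Integration.integral_combine[OF assms(1,2) this]
  show ?thesis unfolding drift_def by (simp add: algebra_simps)
qed

definition I :: "real \<Rightarrow> real \<Rightarrow> real ^ 'k" where
  "I s t = (\<Sum>\<mu>\<in>UNIV. J \<mu> t - J \<mu> s)"

lemma y_increment:
  assumes "0 \<le> s" "s \<le> t" "t \<le> 1" shows "y t - y s = I s t - drift s t"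
  using assms drift_diff[OF assms] by (simp add: y_eq I_def sum_subtractf algebra_simps)

text \<open>Over a degenerate interval the partition without subintervals is admissible for every
  mesh, so the integral is arbitrarily close to the empty sum.\<close>

lemma y_0: "y 0 = y0"
proof -
  have "J \<mu> 0 = 0" for \<mu>
  proof -
    have "norm (J \<mu> 0) < e" if "0 < e" for e
    proof -
      have "has_rough_integral N X (compose_path N (\<lambda>x. column \<mu> (\<sigma> x)) Y) \<mu> 0 0 (J \<mu> 0)"
        by (rule rough_integral_J) simp
      from this[unfolded has_rough_integral_def, THEN spec, THEN mp, OF that]
      obtain d where "\<forall>n r. r 0 = 0 \<and> r n = 0 \<and> (\<forall>i<n. r i < r (Suc i) \<and> r (Suc i) - r i < d)
          \<longrightarrow> norm ((\<Sum>i<n. germ N X (compose_path N (\<lambda>x. column \<mu> (\<sigma> x)) Y) \<mu> (r i) (r (Suc i))) - J \<mu> 0) < e"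
        by (elim exE conjE)
      from this[THEN spec[of _ 0], THEN spec[of _ "\<lambda>_. 0"]] show ?thesis by simp
    qed
    then show ?thesis by (metis less_irrefl zero_less_norm_iff)
  qed
  then show ?thesis by (simp add: y_eq drift_def)
qed

lemma dyadic_sums_tendsto_I:
  assumes "0 \<le> s" "s < t" "t \<le> 1"
  shows "(\<lambda>n. \<Sum>i<2 ^ n. \<Xi> (dyadic s t n i) (dyadic s t n (Suc i))) \<longlonglongrightarrow> I s t"
proof -
  have "(\<lambda>n. \<Sum>\<mu>\<in>UNIV. \<Sum>i<2 ^ n. germ N X (compose_path N (\<lambda>x. column \<mu> (\<sigma> x)) Y) \<mu> (dyadic s t n i) (dyadic s t n (Suc i)))
      \<longlonglongrightarrow> (\<Sum>\<mu>\<in>UNIV. J \<mu> t - J \<mu> s)"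
    using assms by (intro tendsto_sum has_rough_integral_dyadic has_rough_integral_diff rough_integral_J) auto
  then show ?thesis unfolding \<Xi>_def I_def by (subst sum.swap)
qed

context
  fixes K L \<theta> R \<epsilon> t0 t1 :: real
  assumes K: "0 \<le> K" and L: "0 < L" and \<theta>: "0 < \<theta>" and R: "0 \<le> R"
    and t01: "0 \<le> t0" "t0 < t1" "t1 \<le> 1" "t1 - t0 < 1"
    and X_bound: "\<And>s t h. s \<in> {0..1} \<Longrightarrow> t \<in> {0..1} \<Longrightarrow> s \<noteq> t \<Longrightarrow> h \<in> trees N
      \<Longrightarrow> \<bar>X s t (basis {#h#})\<bar> \<le> (R * \<bar>s - t\<bar> powr \<alpha>) ^ tree_size h"
    and regular: "\<And>x. x \<in> cball (y t0) (1 / (4 * \<theta>)) \<Longrightarrow> regular_at K L \<theta> x"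
    and stay: "\<And>r. r \<in> {t0..t1} \<Longrightarrow> y r \<in> cball (y t0) (1 / (4 * \<theta>))"
    and drift_le: "\<And>s t. t0 \<le> s \<Longrightarrow> s \<le> t \<Longrightarrow> t \<le> t1 \<Longrightarrow> norm (drift s t) \<le> (t - s) / (\<theta> * (t1 - t0))"
    and \<epsilon>: "L * \<theta> * (R * (t1 - t0) powr \<alpha>) \<le> \<epsilon>"
    and \<epsilon>_eps: "\<epsilon> \<le> eps_const (real CARD('d)) (real CARD('k)) N K"
    and absorb: "sew_const \<alpha> (real CARD('d)) (real CARD('k)) N K * \<epsilon> \<le> 1 / 2"
begin

text \<open>Time as a fraction of the interval under consideration. In this unit the noise is at
  most \<epsilon> x^\<alpha> and the drift at most x / \<theta>, whatever the length of the
  interval.\<close>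

definition x :: "real \<Rightarrow> real \<Rightarrow> real" where "x s t = (t - s) / (t1 - t0)"

definition w :: "real \<Rightarrow> real \<Rightarrow> real" where "w s t = R * (t - s) powr \<alpha>"

lemma \<epsilon>_bounds: "0 \<le> \<epsilon>" "\<epsilon> \<le> 1 / 2"
proof -
  have "0 \<le> L * \<theta> * (R * (t1 - t0) powr \<alpha>)" using L \<theta> R by simp
  then show "0 \<le> \<epsilon>" using \<epsilon> by linarith
  show "\<epsilon> \<le> 1 / 2" using \<epsilon>_eps eps_const_bounds(2)[OF _ _ K, of "real CARD('d)" "real CARD('k)" N] by simp
qed

context
  fixes s t assumes st: "t0 \<le> s" "s < t" "t \<le> t1"
begin

lemma x_bounds: "0 < x s t" "x s t \<le> 1" using st t01 by (simp_all add: x_def)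

lemma w_nonneg: "0 \<le> w s t" using R by (simp add: w_def)

lemma \<tau>_le_\<epsilon>_powr: "L * \<theta> * w s t \<le> \<epsilon> * x s t powr \<alpha>"
proof -
  have "L * \<theta> * w s t = L * \<theta> * (R * (t1 - t0) powr \<alpha>) * x s t powr \<alpha>"
    using st t01 by (simp add: w_def x_def powr_divide)
  also have "\<dots> \<le> \<epsilon> * x s t powr \<alpha>" using \<epsilon> by (intro mult_right_mono) auto
  finally show ?thesis .
qed

lemma \<tau>_le_\<epsilon>: "L * \<theta> * w s t \<le> \<epsilon>"
proof -
  have "x s t powr \<alpha> \<le> 1" using x_bounds \<alpha>_pos by (intro powr_le1) auto
  then show ?thesis using \<tau>_le_\<epsilon>_powr \<epsilon>_bounds mult_left_mono[of "x s t powr \<alpha>" 1 \<epsilon>] by linarith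
qed

lemma \<tau>_power_le: "(L * \<theta> * w s t) ^ N \<le> x s t powr (real N * \<alpha>)"
proof -
  have "L * \<theta> * w s t \<le> 1 * x s t powr \<alpha>"
    using \<tau>_le_\<epsilon>_powr \<epsilon>_bounds mult_right_mono[of \<epsilon> 1 "x s t powr \<alpha>"] by simp
  then have "(L * \<theta> * w s t) ^ N \<le> (x s t powr \<alpha>) ^ N"
    using L \<theta> w_nonneg by (intro power_mono) auto
  then show ?thesis using x_bounds by (simp add: powr_power mult.commute)
qed

lemma \<Phi>_bound: "\<bar>\<Phi> s t f\<bar> \<le> w s t ^ forest_size f"
proof -
  have "\<bar>\<Phi> s t f\<bar> \<le> (R * \<bar>s - t\<bar> powr \<alpha>) ^ forest_size f"
    by (rule abs_\<Phi>_le[OF R X_bound]) (use st t01 in auto)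
  then show ?thesis using st by (simp add: w_def)
qed

lemma st_mem: "s \<in> {0..1}" "t \<in> {0..1}" using st t01 by auto

lemma close_st: "norm (y t - y s) \<le> 1 / \<theta>"
proof -
  have "dist (y t) (y s) \<le> 1 / (4 * \<theta>) + 1 / (4 * \<theta>)"
    using stay[of s] stay[of t] st by (intro dist_triangle_le[where z = "y t0"]) (auto simp: dist_commute)
  also have "\<dots> \<le> 1 / \<theta>" using \<theta> by (simp add: field_simps)
  finally show ?thesis by (simp add: dist_norm)
qed

lemma segment_st: "0 \<le> r \<Longrightarrow> r \<le> 1 \<Longrightarrow> regular_at K L \<theta> (y s + r *\<^sub>R (y t - y s))"
proof (rule regular)
  assume r: "0 \<le> r" "r \<le> 1"
  have "(1 - r) *\<^sub>R y s + r *\<^sub>R y t \<in> cball (y t0) (1 / (4 * \<theta>))"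
    using stay st r by (intro convexD[OF convex_cball]) auto
  then show "y s + r *\<^sub>R (y t - y s) \<in> cball (y t0) (1 / (4 * \<theta>))"
    by (simp add: algebra_simps)
qed

lemma regular_s: "regular_at K L \<theta> (y s)"
  using stay st by (intro regular) auto

lemma norm_\<Xi>_le: "norm (\<Xi> s t) \<le> real CARD('k) * real CARD('d) * coeff_const (real CARD('d)) (real CARD('k)) N K * \<epsilon> / \<theta>"
proof -
  let ?C = "coeff_const (real CARD('d)) (real CARD('k)) N K"
  have C: "0 \<le> ?C" using K by (simp add: coeff_const_nonneg)
  have half: "L * \<theta> * w s t \<le> 1 / 2" using \<tau>_le_\<epsilon> \<epsilon>_bounds by linarith
  have "norm (\<Xi> s t) \<le> real CARD('k) * (real CARD('d) * (w s t * (L * ?C)))"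
  proof (rule norm_le_card)
    fix i
    show "\<bar>\<Xi> s t $ i\<bar> \<le> real CARD('d) * (w s t * (L * ?C))"
      unfolding \<Xi>_component[OF st_mem]
      by (rule abs_sum_pairing_Graft_le[OF w_nonneg \<Phi>_bound wnorm_U[OF K L \<theta> w_nonneg refl half st_mem(1) regular_s]])
  qed
  also have "\<dots> = real CARD('k) * real CARD('d) * ?C * (L * \<theta> * w s t) / \<theta>" using \<theta> by simp
  also have "\<dots> \<le> real CARD('k) * real CARD('d) * ?C * \<epsilon> / \<theta>"
    using \<tau>_le_\<epsilon> C \<theta> by (intro divide_right_mono mult_left_mono) auto
  finally show ?thesis .
qed

text \<open>Bounding \<open>I - \<Xi>\<close> bounds \<open>\<rho>\<close>: their difference consists of the drift and of the
  terms of the germ with trees of exactly \<open>N\<close> vertices.\<close>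

lemma norm_\<rho>_le_of_sewing:
  assumes Q: "0 \<le> Q" "norm (I s t - \<Xi> s t) \<le> Q / \<theta> * x s t powr ((real N + 1) * \<alpha>)"
  shows "norm (\<rho> s t) \<le> (Q + 1 + real CARD('k) * real CARD('d) * coeff_const (real CARD('d)) (real CARD('k)) N K) / \<theta>
    * x s t powr (real N * \<alpha>)"
proof -
  let ?C = "coeff_const (real CARD('d)) (real CARD('k)) N K"
  let ?x = "x s t powr (real N * \<alpha>)"
  have C: "0 \<le> ?C" using K by (simp add: coeff_const_nonneg)
  have half: "L * \<theta> * w s t \<le> 1 / 2" using \<tau>_le_\<epsilon> \<epsilon>_bounds by linarith
  define W where "W = (\<chi> i. \<Sum>\<mu>\<in>UNIV. pairing (\<Phi> s t) (Graft \<mu> (U \<mu> s i - V \<mu> s i)))"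
  have "\<rho> s t = (I s t - \<Xi> s t) - drift s t + W"
  proof -
    have "y t $ i - y s $ i = I s t $ i - drift s t $ i" for i
      using arg_cong[OF y_increment[of s t], of "\<lambda>v. v $ i"] st t01 by simp
    then show ?thesis
      by (simp add: vec_eq_iff \<rho>_component[OF st_mem] \<Xi>_component[OF st_mem] W_def Graft_diff pairing_diff sum_subtractf)
  qed
  then have "norm (\<rho> s t) \<le> norm (I s t - \<Xi> s t) + norm (drift s t) + norm W"
    using norm_triangle_ineq[of "(I s t - \<Xi> s t) - drift s t" W] norm_triangle_ineq4[of "I s t - \<Xi> s t" "drift s t"] by simp
  also have "norm (I s t - \<Xi> s t) \<le> Q / \<theta> * ?x"
  proof -
    have "x s t powr ((real N + 1) * \<alpha>) \<le> ?x" using x_bounds \<alpha>_pos by (intro powr_mono') (auto simp: distrib_right)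
    then show ?thesis using Q \<theta> by (meson divide_nonneg_pos mult_left_mono order_trans)
  qed
  also have "norm (drift s t) \<le> 1 / \<theta> * ?x"
  proof -
    have "norm (drift s t) \<le> 1 / \<theta> * x s t" using drift_le[of s t] st by (simp add: x_def)
    \<comment> \<open>Here \<open>real N * \<alpha> \<le> 1\<close> enters: a drift that is linear
      in time does not spoil the order of the remainder.\<close>
    also have "x s t \<le> ?x" using powr_mono'[of "real N * \<alpha>" 1 "x s t"] x_bounds N\<alpha> by simp
    finally show ?thesis using \<theta> by (simp add: divide_right_mono)
  qed
  also have "norm W \<le> real CARD('k) * real CARD('d) * ?C / \<theta> * ?x"
  proof -
    have "norm W \<le> real CARD('k) * (real CARD('d) * (w s t * ((L * \<theta> * w s t) ^ (N - 1) * (L * ?C))))"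
    proof (rule norm_le_card)
      fix i
      show "\<bar>W $ i\<bar> \<le> real CARD('d) * (w s t * ((L * \<theta> * w s t) ^ (N - 1) * (L * ?C)))"
        unfolding W_def vec_lambda_beta
        by (rule abs_sum_pairing_Graft_le[OF w_nonneg \<Phi>_bound wnorm_U_diff_V(1)[OF K L \<theta> w_nonneg refl half st_mem(1) regular_s]])
    qed
    also have "\<dots> = real CARD('k) * real CARD('d) * ?C / \<theta> * (L * \<theta> * w s t) ^ N"
      using \<theta> N_pos by (simp add: power_eq_if[of _ N])
    also have "\<dots> \<le> real CARD('k) * real CARD('d) * ?C / \<theta> * ?x"
      using C \<theta> \<tau>_power_le by (intro mult_left_mono) auto
    finally show ?thesis .
  qed
  finally show ?thesis by (simp add: algebra_simps add_divide_distrib)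
qed

end

text \<open>Converse to \<open>norm_\<rho>_le_of_sewing\<close>: the defect carries one more noise
  factor than the remainder, which raises the exponent to (N + 1) \<alpha> and produces the small
  prefactor \<epsilon>.\<close>

lemma sewing_of_norm_\<rho>_le:
  assumes M: "0 \<le> M" and \<rho>: "\<And>s t. t0 \<le> s \<Longrightarrow> s < t \<Longrightarrow> t \<le> t1 \<Longrightarrow> norm (\<rho> s t) \<le> M / \<theta> * x s t powr (real N * \<alpha>)"
    and st: "t0 \<le> s" "s < t" "t \<le> t1"
  shows "norm (I s t - \<Xi> s t) \<le> sew_const \<alpha> (real CARD('d)) (real CARD('k)) N K * \<epsilon> * (M + 1) / \<theta> * x s t powr ((real N + 1) * \<alpha>)"
proof -
  let ?k = "real CARD('k)" and ?d = "real CARD('d)" and ?z = "(real N + 1) * \<alpha>"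
  let ?key = "key_const ?d ?k N K"
  have key: "0 \<le> ?key" using K by (simp add: key_const_nonneg)
  \<comment> \<open>The division by a power of the interval length converts powers of the normalised
    time into powers of \<open>b - a\<close>, the form required for sewing.\<close>
  define B where "B = ?k * ?d * ?key * \<epsilon> * (M + 1) / \<theta> / (t1 - t0) powr ?z"
  have B0: "0 \<le> B" using key \<epsilon>_bounds M \<theta> by (simp add: B_def)
  have "norm (I s t - \<Xi> s t) \<le> B * (t - s) powr ?z / (1 - 2 powr (1 - ?z))"
  proof (rule dyadic_sewing[OF st(2) N\<alpha>(2) B0 _ dyadic_sums_tendsto_I])
    fix a b assume ab: "s \<le> a" "a < b" "b \<le> t"
    let ?u = "(a + b) / 2" and ?\<tau> = "L * \<theta> * w a b"
    have in_ab: "t0 \<le> a" "a < b" "b \<le> t1" and au: "t0 \<le> a" "a < ?u" "?u \<le> t1" and ub: "t0 \<le> ?u" "?u < b" "b \<le> t1"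
      using ab st by auto
    have \<tau>0: "0 \<le> ?\<tau>" using L \<theta> w_nonneg[OF in_ab] by simp
    have w_le: "w a ?u \<le> w a b" "w ?u b \<le> w a b"
      unfolding w_def using R ab \<alpha>_pos by (auto intro!: mult_left_mono powr_mono2)
    have \<Phi>au: "\<bar>\<Phi> a ?u f\<bar> \<le> w a b ^ forest_size f" and \<Phi>ub: "\<bar>\<Phi> ?u b f\<bar> \<le> w a b ^ forest_size f" for f
      using \<Phi>_bound[OF au, of f] \<Phi>_bound[OF ub, of f] power_mono[OF w_le(1) w_nonneg[OF au], of "forest_size f"]
        power_mono[OF w_le(2) w_nonneg[OF ub], of "forest_size f"] by linarith+
    have \<rho>au: "norm (\<rho> a ?u) \<le> M / \<theta> * x a b powr (real N * \<alpha>)"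
    proof -
      have "x a ?u powr (real N * \<alpha>) \<le> x a b powr (real N * \<alpha>)"
      proof (rule powr_mono2)
        show "x a ?u \<le> x a b" unfolding x_def using ab t01 by (intro divide_right_mono) auto
      qed (use \<alpha>_pos x_bounds(1)[OF au] in auto)
      then show ?thesis using \<rho>[OF au] M \<theta> by (meson divide_nonneg_pos mult_left_mono order_trans)
    qed
    have rem: "wnorm (w a b) (U \<mu> ?u i - translate (\<Phi> a ?u) (U \<mu> a i)) \<le> ?key * L * (\<theta> * norm (\<rho> a ?u) + ?\<tau> ^ N)" for \<mu> i
      using \<tau>_le_\<epsilon>[OF in_ab] \<epsilon>_eps
      by (intro wnorm_remainder_U[OF K L \<theta> w_nonneg[OF in_ab] refl _ st_mem(1)[OF au] st_mem(2)[OF au] \<Phi>au segment_st[OF au] close_st[OF au]]) auto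
    have "norm (\<Xi> a b - \<Xi> a ?u - \<Xi> ?u b) \<le> ?k * (?d * (w a b * (?key * L * (\<theta> * norm (\<rho> a ?u) + ?\<tau> ^ N))))"
    proof (rule norm_le_card)
      fix i
      show "\<bar>(\<Xi> a b - \<Xi> a ?u - \<Xi> ?u b) $ i\<bar> \<le> ?d * (w a b * (?key * L * (\<theta> * norm (\<rho> a ?u) + ?\<tau> ^ N)))"
        unfolding \<Xi>_defect[OF st_mem(1)[OF in_ab] st_mem(2)[OF au] st_mem(2)[OF in_ab]] abs_minus_cancel
        by (rule abs_sum_pairing_Graft_le[OF w_nonneg[OF in_ab] \<Phi>ub rem])
    qed
    also have "\<dots> = ?k * ?d * ?key / \<theta> * (?\<tau> * (\<theta> * norm (\<rho> a ?u) + ?\<tau> ^ N))" using \<theta> by simp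
    also have "\<dots> \<le> ?k * ?d * ?key / \<theta> * ((\<epsilon> * x a b powr \<alpha>) * (M * x a b powr (real N * \<alpha>) + x a b powr (real N * \<alpha>)))"
    proof -
      have "\<theta> * norm (\<rho> a ?u) \<le> M * x a b powr (real N * \<alpha>)" using \<rho>au \<theta> by (simp add: field_simps)
      from mult_mono[OF \<tau>_le_\<epsilon>_powr[OF in_ab] add_mono[OF this \<tau>_power_le[OF in_ab]]]
      show ?thesis using key \<theta> \<tau>0 \<epsilon>_bounds by (intro mult_left_mono) auto
    qed
    also have "\<dots> = ?k * ?d * ?key * \<epsilon> * (M + 1) / \<theta> * (x a b powr \<alpha> * x a b powr (real N * \<alpha>))"
      by (simp add: algebra_simps add_divide_distrib)
    also have "x a b powr \<alpha> * x a b powr (real N * \<alpha>) = x a b powr ?z"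
      by (simp add: algebra_simps flip: powr_add)
    also have "?k * ?d * ?key * \<epsilon> * (M + 1) / \<theta> * x a b powr ?z = B * (b - a) powr ?z"
      by (simp add: B_def x_def powr_divide)
    finally show "norm (\<Xi> a b - \<Xi> a ?u - \<Xi> ?u b) \<le> B * (b - a) powr ?z" .
  qed (use st t01 in auto)
  also have "\<dots> = sew_const \<alpha> ?d ?k N K * \<epsilon> * (M + 1) / \<theta> * x s t powr ?z"
    by (simp add: B_def sew_const_def x_def powr_divide)
  finally show ?thesis .
qed

lemma norm_I_le:
  assumes st: "t0 \<le> s" "s < t" "t \<le> t1"
  shows "norm (I s t) \<le> incr_const \<alpha> (real CARD('d)) (real CARD('k)) N K * \<epsilon> / \<theta>"
proof -
  let ?k = "real CARD('k)" and ?d = "real CARD('d)" and ?z = "(real N + 1) * \<alpha>"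
  let ?C = "coeff_const ?d ?k N K" and ?S = "sew_const \<alpha> ?d ?k N K * \<epsilon>"
  define valid where "valid = (\<lambda>Q. \<forall>s t. t0 \<le> s \<longrightarrow> s < t \<longrightarrow> t \<le> t1 \<longrightarrow> norm (I s t - \<Xi> s t) \<le> Q / \<theta> * x s t powr ?z)"
  define c where "c = ?S * (2 + ?k * ?d * ?C)"
  have C: "0 \<le> ?C" using K by (simp add: coeff_const_nonneg)
  have S: "0 \<le> ?S" using K N\<alpha> \<epsilon>_bounds by (simp add: sew_const_nonneg)
  have c: "0 \<le> c" using C S by (simp add: c_def)
  have valid_mono: "valid Q" if "valid P" "P \<le> Q" for P Q
    unfolding valid_def
  proof (intro allI impI)
    fix s t assume "t0 \<le> s" "s < t" "t \<le> t1"
    then have "norm (I s t - \<Xi> s t) \<le> P / \<theta> * x s t powr ?z" using that(1) by (simp add: valid_def)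
    also have "\<dots> \<le> Q / \<theta> * x s t powr ?z" using that(2) \<theta> by (intro mult_right_mono divide_right_mono) auto
    finally show "norm (I s t - \<Xi> s t) \<le> Q / \<theta> * x s t powr ?z" .
  qed
  \<comment> \<open>A bound on the sewing error bounds \<open>\<rho>\<close>, which bounds the
    sewing error again; the assumption \<open>absorb\<close> turns the prefactor of \<open>Q\<close>
    into 1 / 2.\<close>
  have improve: "valid (Q / 2 + c)" if "valid Q" "0 \<le> Q" for Q
  proof (rule valid_mono)
    have "norm (\<rho> s t) \<le> (Q + 1 + ?k * ?d * ?C) / \<theta> * x s t powr (real N * \<alpha>)" if "t0 \<le> s" "s < t" "t \<le> t1" for s t
      using norm_\<rho>_le_of_sewing[OF that \<open>0 \<le> Q\<close>] \<open>valid Q\<close> that by (simp add: valid_def)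
    then show "valid (?S * (Q + 1 + ?k * ?d * ?C + 1))"
      unfolding valid_def using sewing_of_norm_\<rho>_le[of "Q + 1 + ?k * ?d * ?C"] C that by simp
    have "?S * Q \<le> 1 / 2 * Q" using absorb that(2) by (intro mult_right_mono)
    then show "?S * (Q + 1 + ?k * ?d * ?C + 1) \<le> Q / 2 + c" by (simp add: c_def algebra_simps)
  qed
  obtain A where A: "0 \<le> A" "\<And>s t. s \<in> {0..1} \<Longrightarrow> t \<in> {0..1} \<Longrightarrow> s \<noteq> t \<Longrightarrow> \<bar>t - s\<bar> < 1
    \<Longrightarrow> norm (\<rho> s t) \<le> A * \<bar>t - s\<bar> powr (real N * \<alpha>)" using controlled_bound by blast
  \<comment> \<open>The constant from the control hypothesis in normalised units. It enters only
    through the initial value \<open>Q0\<close>, whose contribution is halved in each round.\<close>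
  define M0 where "M0 = A * \<theta> * (t1 - t0) powr (real N * \<alpha>)"
  have M0: "0 \<le> M0" using A \<theta> by (simp add: M0_def)
  have "norm (\<rho> s t) \<le> M0 / \<theta> * x s t powr (real N * \<alpha>)" if "t0 \<le> s" "s < t" "t \<le> t1" for s t
    using A(2)[of s t] that t01 \<theta> by (simp add: M0_def x_def powr_divide)
  then have v0: "valid (?S * (M0 + 1))"
    unfolding valid_def using sewing_of_norm_\<rho>_le[OF M0] by simp
  define Q0 where "Q0 = ?S * (M0 + 1)"
  have Q0: "0 \<le> Q0" using S M0 by (simp add: Q0_def)
  have iter: "valid (Q0 / 2 ^ n + 2 * c)" for n
  proof (induction n)
    case 0
    show ?case using valid_mono[OF v0] c by (simp add: Q0_def)
  next
    case (Suc n)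
    have "0 \<le> Q0 / 2 ^ n + 2 * c" using Q0 c by simp
    from improve[OF Suc this] show ?case by (simp add: field_simps)
  qed
  have xz: "x s t powr ?z \<le> 1" using x_bounds[OF st] N\<alpha> by (intro powr_le1) auto
  have "norm (I s t - \<Xi> s t) \<le> (Q0 * (1 / 2) ^ n + 2 * c) / \<theta>" for n
  proof -
    have "norm (I s t - \<Xi> s t) \<le> (Q0 / 2 ^ n + 2 * c) / \<theta> * x s t powr ?z"
      using iter[of n] st by (simp add: valid_def)
    also have "\<dots> \<le> (Q0 / 2 ^ n + 2 * c) / \<theta> * 1"
      using xz Q0 c \<theta> by (intro mult_left_mono) auto
    finally show ?thesis by (simp add: power_divide)
  qed
  moreover have "(\<lambda>n. (Q0 * (1 / 2) ^ n + 2 * c) / \<theta>) \<longlonglongrightarrow> (Q0 * 0 + 2 * c) / \<theta>"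
    using \<theta> by (intro tendsto_intros LIMSEQ_power_zero) auto
  ultimately have "norm (I s t - \<Xi> s t) \<le> (Q0 * 0 + 2 * c) / \<theta>"
    by (intro LIMSEQ_le_const) auto
  then have "norm (I s t - \<Xi> s t) \<le> 2 * c / \<theta>" by simp
  then have "norm (I s t) \<le> 2 * c / \<theta> + ?k * ?d * ?C * \<epsilon> / \<theta>"
    using norm_\<Xi>_le[OF st] norm_triangle_sub[of "I s t" "\<Xi> s t"] by linarith
  also have "\<dots> = incr_const \<alpha> ?d ?k N K * \<epsilon> / \<theta>"
    by (simp add: incr_const_def c_def algebra_simps add_divide_distrib)
  finally show ?thesis .
qed

end

end

section \<open>Coming down from infinity by discrete steps\<close>

text \<open>Bernoulli's inequality for a negative exponent, from ln (1 - u) <= - u and exp z >= 1 +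
  z.\<close>

lemma one_minus_powr_neg_ge:
  fixes u p :: real assumes "0 \<le> u" "u < 1" "0 \<le> p"
  shows "1 + p * u \<le> (1 - u) powr (- p)"
proof -
  have "ln (1 - u) \<le> - u" using ln_le_minus_one[of "1 - u"] assms by simp
  then have "p * u \<le> - p * ln (1 - u)" using mult_left_mono[of "ln (1 - u)" "- u" p] assms by simp
  then have "1 + p * u \<le> exp (- p * ln (1 - u))"
    using exp_ge_add_one_self[of "- p * ln (1 - u)"] by linarith
  then show ?thesis using assms by (simp add: powr_def)
qed

text \<open>By convexity the gain of the negative power is at least its linearisation at
  \<open>v\<close>. This is the discrete substitute for differentiating |Y|^(1-m) in time.\<close>

lemma powr_neg_gain:
  fixes v \<delta> p :: real assumes "0 < v" "0 \<le> \<delta>" "\<delta> < v" "0 \<le> p" "0 < u" "u \<le> v - \<delta>"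
  shows "v powr (- p) + p * \<delta> * v powr (- p - 1) \<le> u powr (- p)"
proof -
  have "v powr (- p) + p * \<delta> * v powr (- p - 1) = v powr (- p) * (1 + p * (\<delta> / v))"
    using assms(1) by (simp add: powr_diff algebra_simps)
  also have "\<dots> \<le> v powr (- p) * (1 - \<delta> / v) powr (- p)"
    using assms by (intro mult_left_mono one_minus_powr_neg_ge) auto
  also have "\<dots> = (v - \<delta>) powr (- p)"
    using assms by (simp add: right_diff_distrib flip: powr_mult)
  also have "\<dots> \<le> u powr (- p)" using assms by (intro powr_mono2') auto
  finally show ?thesis .
qed

text \<open>Consider the last time in \<open>[0, t]\<close> at which the desired bound holds without
  the factor 2. Either it is \<open>t\<close>, or a step starting there overshoots \<open>t\<close>,
  and then the value at \<open>t\<close> is at most doubled.\<close>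

lemma bound_from_steps:
  fixes n :: "real \<Rightarrow> real"
  assumes cont: "continuous_on {0..1} n" and nonneg: "\<And>t. 0 \<le> n t" and m: "1 < m" and \<kappa>: "0 < \<kappa>" and \<Lambda>: "0 < \<Lambda>"
    and step: "\<And>t0. t0 \<in> {0..1} \<Longrightarrow> \<Lambda> \<le> n t0 \<Longrightarrow> \<exists>H>0. H \<le> n t0 powr (1 - m)
      \<and> (\<forall>t. t0 \<le> t \<and> t \<le> t0 + H \<and> t \<le> 1 \<longrightarrow> n t \<le> 2 * n t0)
      \<and> (t0 + H \<le> 1 \<longrightarrow> n (t0 + H) < n t0 \<and> n t0 powr (1 - m) + \<kappa> * H \<le> n (t0 + H) powr (1 - m))"
    and t: "t \<in> {0..1}"
  shows "n t \<le> 2 * (1 / \<kappa> + 1) powr (1 / (m - 1)) * max \<Lambda> (damping m t (n 0))"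
proof -
  let ?q = "(1 / \<kappa> + 1) powr (1 / (m - 1))"
  \<comment> \<open>The maximum with \<open>\<Lambda>\<close> keeps the base positive, so that its
    negative power is continuous.\<close>
  define g where "g = (\<lambda>s. max \<Lambda> (n s))"
  define G where "G = {s \<in> {0..t}. n s \<le> max \<Lambda> (n 0)} \<inter> ({s \<in> {0..t}. n s \<le> \<Lambda>} \<union> {s \<in> {0..t}. \<kappa> * s \<le> g s powr (1 - m)})"
  have cn: "continuous_on {0..t} n" using continuous_on_subset[OF cont] t by auto
  have g_pos: "0 < g s" for s using \<Lambda> by (simp add: g_def less_max_iff_disj)
  have cg: "continuous_on {0..t} (\<lambda>s. g s powr (1 - m))"
    using g_pos unfolding g_def by (intro continuous_intros cn) (metis less_irrefl)
  have closed: "closed G" unfolding G_def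
    by (intro closed_Int closed_Un continuous_on_closed_Collect_le cn cg continuous_intros)
  have "G = {0..t} \<inter> G" by (auto simp: G_def)
  then have "compact G" using compact_Int_closed[OF compact_Icc[of 0 t] closed] by simp
  moreover have "0 \<in> G" using t by (auto simp: G_def)
  ultimately obtain s where s: "s \<in> G" and max: "\<And>r. r \<in> G \<Longrightarrow> r \<le> s"
    using compact_attains_sup[of G] by blast
  have s01: "0 \<le> s" "s \<le> t" "s \<in> {0..1}" using s t by (auto simp: G_def)
  have "n t \<le> 2 * n s \<and> (n s \<le> \<Lambda> \<or> t \<le> (1 / \<kappa> + 1) * n s powr (1 - m))"
  proof (cases "s = t")
    case True
    have "n s \<le> \<Lambda> \<or> \<kappa> * s \<le> n s powr (1 - m)" using s by (auto simp: G_def g_def max_def split: if_splits)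
    moreover have "t \<le> (1 / \<kappa> + 1) * n s powr (1 - m)" if "\<kappa> * s \<le> n s powr (1 - m)"
    proof -
      have "t \<le> 1 / \<kappa> * n s powr (1 - m)" using that True \<kappa> by (simp add: field_simps)
      then show ?thesis by (simp add: distrib_right add_increasing2)
    qed
    ultimately show ?thesis using True nonneg[of t] by auto
  next
    case False
    then have lt: "s < t" using s01 by simp
    \<comment> \<open>Strictly below the level, continuity would place slightly later times in
      \<open>G\<close>, against the choice of \<open>s\<close>.\<close>
    have ge: "\<Lambda> \<le> n s"
    proof (rule ccontr)
      assume "\<not> \<Lambda> \<le> n s"
      then have "0 < \<Lambda> - n s" by simp
      then obtain d where d: "0 < d" "\<And>r. r \<in> {0..t} \<Longrightarrow> dist r s < d \<Longrightarrow> dist (n r) (n s) < \<Lambda> - n s"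
        using cn s01 unfolding continuous_on_iff by (metis atLeastAtMost_iff)
      define r where "r = min t (s + d / 2)"
      have r: "r \<in> {0..t}" "s < r" "dist r s < d" using lt d(1) s01 by (auto simp: r_def dist_real_def min_def)
      then have "n r < \<Lambda>" using d(2)[OF r(1,3)] by (simp add: dist_real_def)
      then have "r \<in> G" using r by (auto simp: G_def)
      then show False using max r(2) by force
    qed
    obtain H where H: "0 < H" "H \<le> n s powr (1 - m)" "\<And>r. s \<le> r \<Longrightarrow> r \<le> s + H \<Longrightarrow> r \<le> 1 \<Longrightarrow> n r \<le> 2 * n s"
      and H1: "s + H \<le> 1 \<Longrightarrow> n (s + H) < n s \<and> n s powr (1 - m) + \<kappa> * H \<le> n (s + H) powr (1 - m)"
      using step[OF s01(3) ge] by blast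
    have alt: "n s \<le> \<Lambda> \<or> \<kappa> * s \<le> n s powr (1 - m)" using s by (auto simp: G_def g_def max_def split: if_splits)
    \<comment> \<open>Otherwise the step from \<open>s\<close> would end in \<open>G\<close>, again
      later than \<open>s\<close>.\<close>
    have "t < s + H"
    proof (rule ccontr)
      assume "\<not> t < s + H"
      then have le: "s + H \<le> t" "s + H \<le> 1" using t by auto
      note H1 = H1[OF le(2)]
      have "n (s + H) \<le> max \<Lambda> (n 0)" using H1 s by (auto simp: G_def)
      moreover have "n (s + H) \<le> \<Lambda> \<or> \<kappa> * (s + H) \<le> g (s + H) powr (1 - m)"
        using alt H1 by (auto simp: g_def max_def distrib_left)
      ultimately have "s + H \<in> G" using le s01 H(1) by (auto simp: G_def)
      then show False using max H(1) by force
    qed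
    \<comment> \<open>The time up to \<open>s\<close> is paid for by the accumulated gain and the
      rest is shorter than \<open>H\<close>; together this gives the factor 1 / \<kappa> +
      1.\<close>
    moreover have "\<kappa> * s \<le> n s powr (1 - m) \<Longrightarrow> s \<le> 1 / \<kappa> * n s powr (1 - m)" using \<kappa> by (simp add: field_simps)
    ultimately show ?thesis using alt H(2) H(3)[of t] lt t unfolding distrib_right by force
  qed
  then have nt: "n t \<le> 2 * n s" and alt: "n s \<le> \<Lambda> \<or> t \<le> (1 / \<kappa> + 1) * n s powr (1 - m)" by auto
  have q1: "1 \<le> ?q" using \<kappa> m by (intro ge_one_powr_ge_zero) auto
  have "n s \<le> ?q * max \<Lambda> (damping m t (n 0))"
  proof (cases "n s \<le> \<Lambda>")
    case True
    have "1 * \<Lambda> \<le> ?q * max \<Lambda> (damping m t (n 0))" using q1 \<Lambda> by (intro mult_mono) auto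
    then show ?thesis using True by simp
  next
    case False
    then have pos: "0 < n s" and n0: "n s \<le> n 0" and alt: "t \<le> (1 / \<kappa> + 1) * n s powr (1 - m)"
      using alt \<Lambda> s by (auto simp: G_def)
    have "n s \<le> ?q * damping m t (n 0)"
    proof (cases "t = 0")
      case True
      then show ?thesis using n0 mult_mono[OF q1 n0] pos by (simp add: damping_def)
    next
      case False
      then have t0: "0 < t" using t by simp
      have "n s powr (m - 1) \<le> (1 / \<kappa> + 1) / t"
      proof -
        have "n s powr (m - 1) * n s powr (1 - m) = 1" using pos by (simp flip: powr_add)
        then have "n s powr (m - 1) * t \<le> 1 / \<kappa> + 1"
          using mult_left_mono[OF alt, of "n s powr (m - 1)"] by (simp add: algebra_simps)
        then show ?thesis using t0 by (simp add: field_simps)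
      qed
      then have "(n s powr (m - 1)) powr (1 / (m - 1)) \<le> ((1 / \<kappa> + 1) / t) powr (1 / (m - 1))"
        using m by (intro powr_mono2) auto
      then have "n s \<le> ?q * t powr (- 1 / (m - 1))"
        using m pos \<kappa> t0 by (simp add: powr_powr powr_divide powr_minus_divide)
      moreover have "n s \<le> ?q * n 0" using mult_mono[OF q1 n0] pos by simp
      ultimately show ?thesis using False q1 by (auto simp: damping_def min_def)
    qed
    also have "\<dots> \<le> ?q * max \<Lambda> (damping m t (n 0))" by (intro mult_left_mono) auto
    finally show ?thesis .
  qed
  then show ?thesis using nt by linarith
qed

context rde_solution
begin

context
  fixes K L \<theta> R \<epsilon> c t0 :: real
  assumes K: "0 \<le> K" and L: "0 < L" and \<theta>: "0 < \<theta>" and R: "0 \<le> R"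
    and t0: "t0 \<in> {0..1}" and large: "1 \<le> norm (y t0)" "1 / \<theta> \<le> norm (y t0)"
    and X_bound: "\<And>s t h. s \<in> {0..1} \<Longrightarrow> t \<in> {0..1} \<Longrightarrow> s \<noteq> t \<Longrightarrow> h \<in> trees N
      \<Longrightarrow> \<bar>X s t (basis {#h#})\<bar> \<le> (R * \<bar>s - t\<bar> powr \<alpha>) ^ tree_size h"
    and regular: "\<And>x. x \<in> cball (y t0) (1 / (4 * \<theta>)) \<Longrightarrow> regular_at K L \<theta> x"
    and c: "0 < c" "c \<le> (3 / 4) powr m / (8 * (2 powr m)\<^sup>2)"
    and \<epsilon>: "L * \<theta> * (R * (c / (\<theta> * norm (y t0) powr m)) powr \<alpha>) \<le> \<epsilon>"
    and \<epsilon>_eps: "\<epsilon> \<le> eps_const (real CARD('d)) (real CARD('k)) N K"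
    and absorb: "sew_const \<alpha> (real CARD('d)) (real CARD('k)) N K * \<epsilon> \<le> 1 / 2"
    and incr: "incr_const \<alpha> (real CARD('d)) (real CARD('k)) N K * \<epsilon> \<le> (3 / 4) powr m * c / 4"
begin

section \<open>One step dominated by the damping\<close>

abbreviation "v \<equiv> norm (y t0)"
text \<open>The time in which a drift of speed \<open>v powr m\<close> covers the fraction
  \<open>c\<close> of the length scale 1 / \<open>\<theta>\<close>.\<close>

abbreviation "H \<equiv> c / (\<theta> * v powr m)"
text \<open>During the step the norm stays above three quarters of its initial value; this is the
  resulting loss in the strength of the damping.\<close>

abbreviation "\<beta> \<equiv> (3 / 4 :: real) powr m"

lemma \<beta>_bounds: "0 < \<beta>" "\<beta> \<le> 1" using m_gt_1 by (auto intro!: powr_le1)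

lemma two_powr_m: "1 \<le> 2 powr m" using m_gt_1 by (intro ge_one_powr_ge_zero) auto

lemma c_bounds: "c * 2 powr m \<le> 1 / 8" "c * (2 powr m)\<^sup>2 \<le> \<beta>" "c \<le> 1 / 8"
proof -
  let ?q = "2 powr m :: real"
  have q: "1 \<le> ?q" by (rule two_powr_m)
  have "c * ?q\<^sup>2 * 8 \<le> \<beta>" using c(2) q by (simp add: field_simps)
  then have main: "c * ?q\<^sup>2 \<le> \<beta> / 8" by simp
  then show "c * ?q\<^sup>2 \<le> \<beta>" using \<beta>_bounds by linarith
  have q2: "?q \<le> ?q\<^sup>2" using q self_le_power[of ?q 2] by simp
  have "c * ?q \<le> c * ?q\<^sup>2" using c(1) q2 by (intro mult_left_mono) auto
  then show 1: "c * ?q \<le> 1 / 8" using main \<beta>_bounds by linarith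
  have "c * 1 \<le> c * ?q" using c(1) q by (intro mult_left_mono) auto
  then show "c \<le> 1 / 8" using 1 by linarith
qed

lemma v_pos: "0 < v" using large by linarith

lemma H_pos: "0 < H" using c \<theta> v_pos by simp

lemma H_v: "H * v powr m = c / \<theta>" using v_pos by simp

lemma H_le: "H \<le> c * v powr (1 - m)"
proof -
  have "H = c * (1 / \<theta>) * v powr (- m)" by (simp add: powr_minus_divide)
  also have "\<dots> \<le> c * v * v powr (- m)" using large c by (intro mult_right_mono mult_left_mono) auto
  also have "\<dots> = c * v powr (1 - m)" using v_pos by (simp add: powr_diff powr_minus_divide)
  finally show ?thesis .
qed

lemma H_less_1: "H < 1"
proof -
  have "v powr (1 - m) \<le> v powr 0" using large(1) m_gt_1 by (intro powr_mono) auto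
  then have "v powr (1 - m) \<le> 1" using v_pos by simp
  then have "c * v powr (1 - m) \<le> c * 1" using c by (intro mult_left_mono) auto
  then show ?thesis using H_le c_bounds(3) by linarith
qed

lemma norm_y_bounds:
  assumes "norm (y r - y t0) \<le> 1 / (4 * \<theta>)"
  shows "3 / 4 * v \<le> norm (y r)" "norm (y r) \<le> 2 * v" "3 / 4 * v\<^sup>2 \<le> y r \<bullet> y t0"
proof -
  have q: "norm (y r - y t0) \<le> v / 4" using assms large(2) by simp
  show "3 / 4 * v \<le> norm (y r)" using q norm_triangle_ineq2[of "y t0" "y r"] by (simp add: norm_minus_commute)
  show "norm (y r) \<le> 2 * v" using q norm_triangle_ineq2[of "y r" "y t0"] v_pos by linarith
  have "y r \<bullet> y t0 = v\<^sup>2 + (y r - y t0) \<bullet> y t0" by (simp add: inner_diff_left power2_norm_eq_inner)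
  moreover have "- ((y r - y t0) \<bullet> y t0) \<le> v / 4 * v"
    using Cauchy_Schwarz_ineq2[of "y r - y t0" "y t0"] mult_right_mono[OF q norm_ge_zero, of "y t0"] by linarith
  ultimately show "3 / 4 * v\<^sup>2 \<le> y r \<bullet> y t0" by (simp add: power2_eq_square)
qed

lemma norm_drift_le:
  assumes "t0 \<le> s" "s \<le> t" "t \<le> 1" "\<And>r. s \<le> r \<Longrightarrow> r \<le> t \<Longrightarrow> norm (y r - y t0) \<le> 1 / (4 * \<theta>)"
  shows "norm (drift s t) \<le> 2 powr m * v powr m * (t - s)"
  unfolding drift_def
proof (rule integral_bound)
  show "continuous_on {s..t} (\<lambda>r. norm (y r) powr (m - 1) *\<^sub>R y r)"
    using continuous_on_subset[OF continuous_damping] assms t0 by auto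
  fix r assume "r \<in> {s..t}"
  then have r: "norm (y r - y t0) \<le> 1 / (4 * \<theta>)" using assms by auto
  have pos: "0 < norm (y r)" using norm_y_bounds(1)[OF r] v_pos by linarith
  have "norm (norm (y r) powr (m - 1) *\<^sub>R y r) = norm (y r) powr m"
    using pos by (simp add: powr_diff)
  also have "\<dots> \<le> (2 * v) powr m" using norm_y_bounds(2)[OF r] m_gt_1 by (intro powr_mono2) auto
  finally show "norm (norm (y r) powr (m - 1) *\<^sub>R y r) \<le> 2 powr m * v powr m"
    using v_pos by (simp add: powr_mult)
qed (use assms in auto)

text \<open>The noise estimate is used on \<open>[t0, t]\<close> because closeness is known only up
  to \<open>t\<close>. The drift condition survives, as its right-hand side grows when the interval
  shrinks.\<close>

lemma norm_I_step:
  assumes t: "t0 < t" "t \<le> t0 + H" "t \<le> 1"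
    and stay: "\<And>r. t0 \<le> r \<Longrightarrow> r \<le> t \<Longrightarrow> norm (y r - y t0) \<le> 1 / (4 * \<theta>)"
  shows "norm (I t0 t) \<le> \<beta> * c / 4 / \<theta>"
proof -
  have "norm (I t0 t) \<le> incr_const \<alpha> (real CARD('d)) (real CARD('k)) N K * \<epsilon> / \<theta>"
  proof (rule norm_I_le[OF K L \<theta> R _ t(1) t(3) _ X_bound regular _ _ _ \<epsilon>_eps absorb])
    show "0 \<le> t0" using t0 by simp
    show "t - t0 < 1" using t H_less_1 by linarith
    show "y r \<in> cball (y t0) (1 / (4 * \<theta>))" if "r \<in> {t0..t}" for r
      using stay that by (auto simp: dist_norm norm_minus_commute)
    show "norm (drift s u) \<le> (u - s) / (\<theta> * (t - t0))" if "t0 \<le> s" "s \<le> u" "u \<le> t" for s u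
    proof -
      have "norm (drift s u) \<le> 2 powr m * v powr m * (u - s)"
        using that t stay by (intro norm_drift_le) auto
      also have "\<dots> \<le> (1 / (\<theta> * H)) * (u - s)"
      proof (intro mult_right_mono)
        have "2 powr m * c \<le> 1" using c_bounds(1) by (simp add: mult.commute)
        then have "2 powr m * c * v powr m \<le> 1 * v powr m" by (intro mult_right_mono) auto
        then show "2 powr m * v powr m \<le> 1 / (\<theta> * H)"
          using \<theta> c(1) v_pos by (simp add: field_simps)
      qed (use that in auto)
      also have "\<dots> \<le> (1 / (\<theta> * (t - t0))) * (u - s)"
      proof (intro mult_right_mono frac_le)
        show "\<theta> * (t - t0) \<le> \<theta> * H" using t(2) \<theta> by (intro mult_left_mono) auto
        show "0 < \<theta> * (t - t0)" using t(1) \<theta> by simp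
      qed (use that in auto)
      finally show ?thesis by simp
    qed
    have "L * \<theta> * (R * (t - t0) powr \<alpha>) \<le> L * \<theta> * (R * H powr \<alpha>)"
      using t L \<theta> R \<alpha>_pos by (intro mult_left_mono powr_mono2) auto
    then show "L * \<theta> * (R * (t - t0) powr \<alpha>) \<le> \<epsilon>" using \<epsilon> by linarith
  qed (use t in auto)
  also have "\<dots> \<le> \<beta> * c / 4 / \<theta>" using incr \<theta> by (intro divide_right_mono) auto
  finally show ?thesis .
qed

text \<open>At a first exit time the distance is exactly 1 / (4 \<theta>) and all estimates are
  still available, but they allow at most (1 / 32 + 1 / 8) / \<theta>.\<close>

lemma stays_close:
  assumes "t0 \<le> t" "t \<le> t0 + H" "t \<le> 1"
  shows "norm (y t - y t0) \<le> 1 / (4 * \<theta>)"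
proof (rule ccontr)
  assume far: "\<not> norm (y t - y t0) \<le> 1 / (4 * \<theta>)"
  let ?q = "1 / (4 * \<theta>)" and ?f = "\<lambda>r. norm (y r - y t0)"
  have q: "0 < ?q" using \<theta> by simp
  have cf: "continuous_on {t0..t} ?f"
    using continuous_on_subset[OF continuous_y, of "{t0..t}"] assms t0 by (intro continuous_intros) auto
  define S where "S = {r \<in> {t0..t}. ?q \<le> ?f r}"
  have "closed S" unfolding S_def by (intro continuous_on_closed_Collect_le cf continuous_intros)
  then have "compact ({t0..t} \<inter> S)" by (intro compact_Int_closed) auto
  moreover have "{t0..t} \<inter> S = S" by (auto simp: S_def)
  moreover have "S \<noteq> {}" using far assms by (auto simp: S_def intro!: exI[of _ t])
  ultimately obtain u where u: "u \<in> S" and min: "\<And>r. r \<in> S \<Longrightarrow> u \<le> r"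
    using compact_attains_inf[of S] by auto
  have ut: "t0 \<le> u" "u \<le> t" "?q \<le> ?f u" using u by (auto simp: S_def)
  obtain r where r: "t0 \<le> r" "r \<le> u" "?f r = ?q"
    using IVT'[of ?f t0 ?q u] ut q continuous_on_subset[OF cf, of "{t0..u}"] by auto
  have "r \<in> S" using r ut by (simp add: S_def)
  then have fu: "?f u = ?q" using min[of r] r by simp
  have lt: "t0 < u" using fu q ut by (cases "t0 = u") auto
  have stay: "?f r \<le> ?q" if "t0 \<le> r" "r \<le> u" for r
  proof (rule ccontr)
    assume "\<not> ?f r \<le> ?q"
    then have "r \<in> S" using that ut by (simp add: S_def)
    then show False using min[of r] that fu \<open>\<not> ?f r \<le> ?q\<close> by simp
  qed
  have u1: "u \<le> t0 + H" "u \<le> 1" using ut assms by auto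
  have "norm (y u - y t0) \<le> norm (I t0 u) + norm (drift t0 u)"
    using y_increment[of t0 u] lt u1 t0 norm_triangle_ineq4[of "I t0 u" "drift t0 u"] by simp
  also have "\<dots> \<le> \<beta> * c / 4 / \<theta> + 2 powr m * v powr m * (u - t0)"
    using norm_I_step[OF lt u1 stay] norm_drift_le[OF order_refl ut(1) u1(2) stay] by (intro add_mono)
  also have "\<dots> \<le> \<beta> * c / 4 / \<theta> + 2 powr m * v powr m * H"
    using u1 by (intro add_left_mono mult_left_mono) auto
  also have "2 powr m * v powr m * H = c * 2 powr m / \<theta>" using v_pos by simp
  also have "\<beta> * c / 4 / \<theta> + c * 2 powr m / \<theta> \<le> (1 / 32 + 1 / 8) / \<theta>"
  proof -
    have "\<beta> * c \<le> 1 * (1 / 8)" using \<beta>_bounds c_bounds c by (intro mult_mono) auto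
    then have "\<beta> * c / 4 + c * 2 powr m \<le> 1 / 32 + 1 / 8" using c_bounds by linarith
    then show ?thesis using \<theta> by (simp only: add_divide_distrib[symmetric] divide_right_mono less_imp_le)
  qed
  also have "\<dots> < ?q" using \<theta> by (simp add: field_simps)
  finally show False using fu by simp
qed

text \<open>The drift has a definite component along \<open>y t0\<close>, since the path stays
  within a quarter of its norm from there. Expanding the square yields a linear gain and a quadratic
  error.\<close>

lemma norm_after_drift:
  assumes "t0 + H \<le> 1"
  shows "norm (y t0 - drift t0 (t0 + H)) \<le> v - \<beta> * c / (2 * \<theta>)"
proof -
  let ?D = "drift t0 (t0 + H)" and ?\<Theta> = "1 / \<theta>"
  let ?F = "\<lambda>r. norm (y r) powr (m - 1) *\<^sub>R y r"
  have \<Theta>: "0 < ?\<Theta>" "?\<Theta> \<le> v" using \<theta> large by auto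
  have stay: "norm (y r - y t0) \<le> 1 / (4 * \<theta>)" if "t0 \<le> r" "r \<le> t0 + H" for r
    using stays_close that assms by auto
  have D_le: "norm ?D \<le> c * 2 powr m * ?\<Theta>"
    using norm_drift_le[of t0 "t0 + H"] stay assms H_pos v_pos by (simp add: mult.commute)
  have int: "?F integrable_on {t0..t0 + H}"
    using continuous_on_subset[OF continuous_damping] assms t0 by (intro integrable_continuous_interval) auto
  have lin: "bounded_linear (\<lambda>x. x \<bullet> y t0)" by (rule bounded_linear_inner_left)
  have inner_int: "(\<lambda>r. ?F r \<bullet> y t0) integrable_on {t0..t0 + H}"
    using integrable_linear[OF int lin] by (simp add: comp_def)
  have "\<beta> * v powr m * v * H = integral {t0..t0 + H} (\<lambda>r. \<beta> * v powr m * v)"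
    using H_pos by simp
  also have "\<dots> \<le> integral {t0..t0 + H} (\<lambda>r. ?F r \<bullet> y t0)"
  proof (rule integral_le[OF _ inner_int])
    fix r assume "r \<in> {t0..t0 + H}"
    then have r: "norm (y r - y t0) \<le> 1 / (4 * \<theta>)" using stay by simp
    have "\<beta> * v powr m * v = (3 / 4 * v) powr m * v" by (simp only: powr_mult)
    also have "\<dots> = (3 / 4 * v) powr (m - 1) * (3 / 4 * v\<^sup>2)"
      using v_pos by (simp add: powr_diff power2_eq_square)
    also have "\<dots> \<le> norm (y r) powr (m - 1) * (y r \<bullet> y t0)"
      using norm_y_bounds[OF r] v_pos m_gt_1 by (intro mult_mono powr_mono2) auto
    finally show "\<beta> * v powr m * v \<le> ?F r \<bullet> y t0" by simp
  qed auto
  also have "\<dots> = ?D \<bullet> y t0"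
    using integral_linear[OF int lin] by (simp add: drift_def comp_def)
  finally have int_le: "\<beta> * v powr m * v * H \<le> ?D \<bullet> y t0" .
  have "\<beta> * v powr m * v * H = \<beta> * v * (H * v powr m)" by (simp only: mult_ac)
  also have "\<dots> = \<beta> * c * ?\<Theta> * v" unfolding H_v by simp
  finally have inner: "\<beta> * c * ?\<Theta> * v \<le> ?D \<bullet> y t0" using int_le by (simp only:)
  have "(norm (y t0 - ?D))\<^sup>2 = v\<^sup>2 - 2 * (?D \<bullet> y t0) + (norm ?D)\<^sup>2"
    by (simp add: power2_norm_eq_inner inner_diff_left inner_diff_right inner_commute)
  also have "\<dots> \<le> v\<^sup>2 - 2 * (\<beta> * c * ?\<Theta> * v) + (c * 2 powr m * ?\<Theta>)\<^sup>2"
    using inner power_mono[OF D_le norm_ge_zero, of 2] by linarith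
  \<comment> \<open>The quadratic error consumes half of the linear gain; the square of
    \<open>2 powr m\<close> in the bound on \<open>c\<close> is there for this purpose.\<close>
  also have "(c * 2 powr m * ?\<Theta>)\<^sup>2 = (c * (2 powr m)\<^sup>2) * (c * ?\<Theta> * ?\<Theta>)"
    by (simp add: power2_eq_square)
  also have "(c * (2 powr m)\<^sup>2) * (c * ?\<Theta> * ?\<Theta>) \<le> \<beta> * (c * ?\<Theta> * v)"
    using c_bounds(2) c(1) \<Theta> \<beta>_bounds by (intro mult_mono mult_left_mono) auto
  finally have "(norm (y t0 - ?D))\<^sup>2 \<le> v\<^sup>2 - \<beta> * c * ?\<Theta> * v" by (simp add: mult_ac)
  also have "\<dots> \<le> (v - \<beta> * c / (2 * \<theta>))\<^sup>2"
    unfolding power2_diff by (simp add: mult_ac)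
  finally have sq: "(norm (y t0 - ?D))\<^sup>2 \<le> (v - \<beta> * c / (2 * \<theta>))\<^sup>2" .
  have "\<beta> * c \<le> 1 * 1" using \<beta>_bounds c c_bounds by (intro mult_mono) auto
  then have "\<beta> * c * ?\<Theta> \<le> 1 * v" using \<Theta> \<beta>_bounds c by (intro mult_mono) auto
  then have "\<beta> * c * ?\<Theta> / 2 \<le> v / 2" by simp
  also have "\<dots> \<le> v" by simp
  finally have "0 \<le> v - \<beta> * c / (2 * \<theta>)" by simp
  then show ?thesis using sq by (rule power2_le_imp_le[rotated])
qed

text \<open>The drift lowers the norm by \<beta> c / (2 \<theta>) and the noise returns at most half
  of that. Since \<open>H\<close> contains the same factor c / \<theta>, the gain per unit of time
  is independent of the scales.\<close>

lemma step:
  "\<exists>H>0. H \<le> v powr (1 - m)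
      \<and> (\<forall>t. t0 \<le> t \<and> t \<le> t0 + H \<and> t \<le> 1 \<longrightarrow> norm (y t) \<le> 2 * v)
      \<and> (t0 + H \<le> 1 \<longrightarrow> norm (y (t0 + H)) < v
          \<and> v powr (1 - m) + (m - 1) * (3 / 4) powr m / 4 * H \<le> norm (y (t0 + H)) powr (1 - m))"
proof (intro exI[of _ H] conjI impI allI)
  show "0 < H" by (rule H_pos)
  have "c * v powr (1 - m) \<le> 1 * v powr (1 - m)" using c_bounds by (intro mult_right_mono) auto
  then show "H \<le> v powr (1 - m)" using H_le by linarith
  show "norm (y t) \<le> 2 * v" if "t0 \<le> t \<and> t \<le> t0 + H \<and> t \<le> 1" for t
    using norm_y_bounds(2) stays_close that by blast
  assume le: "t0 + H \<le> 1"
  let ?\<delta> = "\<beta> * c / (4 * \<theta>)"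
  have close: "norm (y (t0 + H) - y t0) \<le> 1 / (4 * \<theta>)" using stays_close le H_pos by simp
  have I: "norm (I t0 (t0 + H)) \<le> \<beta> * c / 4 / \<theta>"
    using norm_I_step[of "t0 + H"] stays_close le H_pos by simp
  have "y (t0 + H) = (y t0 - drift t0 (t0 + H)) + I t0 (t0 + H)"
    using y_increment[of t0 "t0 + H"] t0 le H_pos by (simp add: algebra_simps)
  then have "norm (y (t0 + H)) \<le> norm (y t0 - drift t0 (t0 + H)) + norm (I t0 (t0 + H))"
    using norm_triangle_ineq by metis
  also have "\<dots> \<le> (v - \<beta> * c / (2 * \<theta>)) + \<beta> * c / 4 / \<theta>"
    using norm_after_drift[OF le] I by (intro add_mono)
  also have "\<dots> = v - ?\<delta>" using \<theta> by (simp add: field_simps)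
  finally have dec: "norm (y (t0 + H)) \<le> v - ?\<delta>" .
  have \<delta>: "0 < ?\<delta>" using \<beta>_bounds c \<theta> by simp
  then show "norm (y (t0 + H)) < v" using dec by linarith
  have pos: "0 < norm (y (t0 + H))" using norm_y_bounds(1)[OF close] v_pos by linarith
  have "v powr (- (m - 1)) + (m - 1) * ?\<delta> * v powr (- (m - 1) - 1) \<le> norm (y (t0 + H)) powr (- (m - 1))"
  proof (rule powr_neg_gain)
    show "?\<delta> < v" using dec pos by linarith
  qed (use dec \<delta> v_pos m_gt_1 pos in auto)
  moreover have "(m - 1) * ?\<delta> * v powr (- (m - 1) - 1) = (m - 1) * \<beta> / 4 * H"
    by (simp add: powr_minus_divide)
  ultimately show "v powr (1 - m) + (m - 1) * \<beta> / 4 * H \<le> norm (y (t0 + H)) powr (1 - m)" by simp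
qed

end

end

section \<open>The two growth regimes\<close>

definition step_const :: "real \<Rightarrow> real" where
  "step_const m = (3 / 4) powr m / (8 * (2 powr m)\<^sup>2)"

text \<open>The three entries make the remainder loop close, the sewing iteration contract, and the
  noise over a step smaller than the damping. The added ones keep the denominators positive.\<close>

definition small_const :: "real \<Rightarrow> real \<Rightarrow> real \<Rightarrow> real \<Rightarrow> nat \<Rightarrow> real \<Rightarrow> real" where
  "small_const m \<alpha> d k N K = min (eps_const d k N K) (min (1 / (2 * (sew_const \<alpha> d k N K + 1)))
    ((3 / 4) powr m * step_const m / (4 * (incr_const \<alpha> d k N K + 1))))"

lemma step_const_bounds: assumes "1 < m" shows "0 < step_const m" "step_const m \<le> 1"
proof -
  show "0 < step_const m" by (simp add: step_const_def)
  have "(3 / 4) powr m \<le> (1::real)" using assms by (intro powr_le1) auto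
  moreover have "1 \<le> (2 powr m :: real)" using assms by (intro ge_one_powr_ge_zero) auto
  then have "1 \<le> (2 powr m :: real)\<^sup>2" by (simp add: one_le_power)
  ultimately show "step_const m \<le> 1" by (simp add: step_const_def divide_le_eq)
qed

lemma small_const_bounds:
  assumes "1 < m" "0 \<le> d" "0 \<le> k" "0 \<le> K" "1 < (real N + 1) * \<alpha>"
  defines "\<epsilon> \<equiv> small_const m \<alpha> d k N K"
  shows "0 < \<epsilon>" "\<epsilon> \<le> 1 / 2" "\<epsilon> \<le> eps_const d k N K" "sew_const \<alpha> d k N K * \<epsilon> \<le> 1 / 2"
    "incr_const \<alpha> d k N K * \<epsilon> \<le> (3 / 4) powr m * step_const m / 4"
proof -
  let ?S = "sew_const \<alpha> d k N K" and ?T = "incr_const \<alpha> d k N K" and ?b = "(3 / 4) powr m * step_const m"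
  have S: "0 \<le> ?S" by (rule sew_const_nonneg[OF assms(2-5)])
  have T: "0 \<le> ?T" using S coeff_const_nonneg[OF assms(2-4), of N] assms by (simp add: incr_const_def)
  have b: "0 < ?b" using step_const_bounds[OF assms(1)] by simp
  note eps = eps_const_bounds[OF assms(2-4), of N]
  show pos: "0 < \<epsilon>" using eps S T b by (simp add: \<epsilon>_def small_const_def)
  show le: "\<epsilon> \<le> eps_const d k N K" by (simp add: \<epsilon>_def small_const_def)
  then show "\<epsilon> \<le> 1 / 2" using eps(2) by linarith
  have "\<epsilon> \<le> 1 / (2 * (?S + 1))" by (simp add: \<epsilon>_def small_const_def)
  then have "(?S + 1) * \<epsilon> \<le> 1 / 2" using S by (simp add: field_simps)
  then show "?S * \<epsilon> \<le> 1 / 2" using pos by (simp add: distrib_right)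
  have "\<epsilon> \<le> ?b / (4 * (?T + 1))" by (simp add: \<epsilon>_def small_const_def)
  then have "(?T + 1) * \<epsilon> \<le> ?b / 4" using T by (simp add: field_simps)
  then show "?T * \<epsilon> \<le> ?b / 4" using pos by (simp add: distrib_right)
qed

text \<open>Isolates what a growth regime has to supply: at every position above the level, scales
  \<open>L\<close> and \<open>\<theta>\<close> for which the noise over one step is below the
  threshold.\<close>

lemma (in rde_solution) bound_of_scaling:
  assumes K: "0 \<le> K" and R: "0 \<le> R" and \<Lambda>: "1 \<le> \<Lambda>"
    and X_bound: "\<And>s t h. s \<in> {0..1} \<Longrightarrow> t \<in> {0..1} \<Longrightarrow> s \<noteq> t \<Longrightarrow> h \<in> trees N
      \<Longrightarrow> \<bar>X s t (basis {#h#})\<bar> \<le> (R * \<bar>s - t\<bar> powr \<alpha>) ^ tree_size h"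
    and scaling: "\<And>z. \<Lambda> \<le> norm z \<Longrightarrow> \<exists>L>0. \<exists>\<theta>>0. 1 / \<theta> \<le> norm z
      \<and> (\<forall>x\<in>cball z (1 / (4 * \<theta>)). regular_at K L \<theta> x)
      \<and> L * \<theta> * (R * (step_const m / (\<theta> * norm z powr m)) powr \<alpha>)
          \<le> small_const m \<alpha> (real CARD('d)) (real CARD('k)) N K"
    and t: "t \<in> {0..1}"
  shows "norm (y t) \<le> 2 * (1 / ((m - 1) * (3 / 4) powr m / 4) + 1) powr (1 / (m - 1))
    * max \<Lambda> (damping m t (norm y0))"
proof -
  note small = small_const_bounds[OF m_gt_1 _ _ K N\<alpha>(2), of "real CARD('d)" "real CARD('k)", simplified]
  have "norm (y t) \<le> 2 * (1 / ((m - 1) * (3 / 4) powr m / 4) + 1) powr (1 / (m - 1))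
      * max \<Lambda> (damping m t (norm (y 0)))"
  proof (rule bound_from_steps[where n = "\<lambda>t. norm (y t)", OF _ _ m_gt_1 _ _ _ t])
    show "continuous_on {0..1} (\<lambda>t. norm (y t))" by (intro continuous_intros continuous_y)
    show "0 < (m - 1) * (3 / 4) powr m / 4" using m_gt_1 by simp
    show "0 < \<Lambda>" using \<Lambda> by simp
    fix t0 :: real assume t0: "t0 \<in> {0..1}" and large: "\<Lambda> \<le> norm (y t0)"
    obtain L \<theta> where L: "0 < L" and \<theta>: "0 < \<theta>" "1 / \<theta> \<le> norm (y t0)"
      and reg: "\<And>x. x \<in> cball (y t0) (1 / (4 * \<theta>)) \<Longrightarrow> regular_at K L \<theta> x"
      and \<epsilon>: "L * \<theta> * (R * (step_const m / (\<theta> * norm (y t0) powr m)) powr \<alpha>)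
          \<le> small_const m \<alpha> (real CARD('d)) (real CARD('k)) N K"
      using scaling[OF large] by blast
    have "1 \<le> norm (y t0)" using large \<Lambda> by linarith
    from step[OF K L \<theta>(1) R t0 this \<theta>(2) X_bound reg step_const_bounds(1)[OF m_gt_1] _ \<epsilon>]
    show "\<exists>H>0. H \<le> norm (y t0) powr (1 - m)
      \<and> (\<forall>t. t0 \<le> t \<and> t \<le> t0 + H \<and> t \<le> 1 \<longrightarrow> norm (y t) \<le> 2 * norm (y t0))
      \<and> (t0 + H \<le> 1 \<longrightarrow> norm (y (t0 + H)) < norm (y t0)
        \<and> norm (y t0) powr (1 - m) + (m - 1) * (3 / 4) powr m / 4 * H \<le> norm (y (t0 + H)) powr (1 - m))"
      using small by (simp add: step_const_def)
  qed simp_all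
  then show ?thesis by (simp only: y_0)
qed

text \<open>The regimes differ only in the scales and in the exponent \<open>e\<close>, chosen so
  that the noise over one step from \<open>z\<close> is at most \<open>(R / norm z) powr e\<close>.
  The constant is fixed before the driver and the solution are introduced.\<close>

lemma uniform_bound:
  fixes P :: "(real ^ 'k::finite \<Rightarrow> real ^ 'd::finite ^ 'k) \<Rightarrow> bool"
  assumes m: "1 < m" and \<alpha>: "0 < \<alpha>" and N: "0 < N" "real N * \<alpha> \<le> 1" "1 < (real N + 1) * \<alpha>"
    and e: "0 < e" and K: "0 \<le> K"
    and scaling: "\<And>\<sigma> z. P \<sigma> \<Longrightarrow> 1 \<le> norm z \<Longrightarrow> \<exists>L>0. \<exists>\<theta>>0. 1 / \<theta> \<le> norm z
      \<and> (\<forall>x\<in>cball z (1 / (4 * \<theta>)). \<forall>w. length w \<le> N \<longrightarrow> norm (partial \<sigma> w x) \<le> K * L * \<theta> ^ length w)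
      \<and> (\<forall>c R. 0 < c \<longrightarrow> c \<le> 1 \<longrightarrow> 0 \<le> R \<longrightarrow>
          L * \<theta> * (R powr e * (c / (\<theta> * norm z powr m)) powr \<alpha>) \<le> (R / norm z) powr e)"
  shows "\<exists>C. \<forall>(X :: 'd rough_map) (\<sigma> :: real ^ 'k \<Rightarrow> real ^ 'd ^ 'k) (y0 :: real ^ 'k) (Y :: ('d, 'k) fpath).
    rough_path \<alpha> N X \<and> C_class N \<sigma> \<and> P \<sigma> \<and> is_solution m \<alpha> N X \<sigma> y0 Y \<longrightarrow>
    (\<forall>t \<in> {0..1}. norm (coef {#} (Y t)) \<le> C * Max {damping m t (norm y0),
      MAX h \<in> trees N. rp_seminorm \<alpha> X {#h#} powr (1 / (e * real (tree_size h))), 1})"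
proof -
  define \<epsilon> where "\<epsilon> = small_const m \<alpha> (real CARD('d)) (real CARD('k)) N K"
  define Q where "Q = 2 * (1 / ((m - 1) * (3 / 4) powr m / 4) + 1) powr (1 / (m - 1))"
  \<comment> \<open>Above the level \<open>q * M\<close> the quotient \<open>M / norm z\<close> is
    at most 1 / q, whose power \<open>e\<close> is the threshold \<epsilon>.\<close>
  define q where "q = \<epsilon> powr (- 1 / e)"
  have \<epsilon>: "0 < \<epsilon>" "\<epsilon> \<le> 1 / 2"
    using small_const_bounds(1,2)[OF m _ _ K N(3), of "real CARD('d)" "real CARD('k)"] by (simp_all add: \<epsilon>_def)
  have q1: "1 \<le> q"
    using \<epsilon> e powr_mono2'[of "- 1 / e" \<epsilon> 1] by (simp add: q_def)
  have Q0: "0 \<le> Q" by (simp add: Q_def)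
  show ?thesis
  proof (intro exI[of _ "Q * q"] allI impI ballI)
    fix X :: "'d rough_map" and \<sigma> :: "real ^ 'k \<Rightarrow> real ^ 'd ^ 'k" and y0 :: "real ^ 'k" and Y :: "('d, 'k) fpath"
      and t :: real
    assume asm: "rough_path \<alpha> N X \<and> C_class N \<sigma> \<and> P \<sigma> \<and> is_solution m \<alpha> N X \<sigma> y0 Y" and t: "t \<in> {0..1}"
    interpret rde_solution m \<alpha> N X \<sigma> y0 Y
      using asm m \<alpha> N by unfold_locales auto
    let ?n = "\<lambda>h. rp_seminorm \<alpha> X {#h#} powr (1 / (e * real (tree_size h)))"
    \<comment> \<open>Chosen such that \<open>M powr e\<close> serves as the common noise amplitude
      for all trees, because each seminorm is at most its power of order
      \<open>tree_size h\<close>.\<close>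
    define M where "M = max (MAX h \<in> trees N. ?n h) 1"
    have M1: "1 \<le> M" by (simp add: M_def)
    have semi: "rp_seminorm \<alpha> X {#h#} \<le> (M powr e) ^ tree_size h" if h: "h \<in> trees N" for h
    proof -
      have pos: "0 < e * real (tree_size h)" using e tree_size_pos[of h] by simp
      have "?n h \<le> (MAX h \<in> trees N. ?n h)" using h by (intro Max_ge) auto
      then have "?n h \<le> M" by (simp add: M_def)
      then have "?n h powr (e * real (tree_size h)) \<le> M powr (e * real (tree_size h))"
        using pos by (intro powr_mono2) auto
      moreover have "?n h powr (e * real (tree_size h)) = rp_seminorm \<alpha> X {#h#}"
        using e tree_size_pos[of h] rp_seminorm_nonneg[OF rough h] by (simp add: powr_powr)
      ultimately show ?thesis using M1 by (simp add: powr_power mult.commute)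
    qed
    have "norm (y t) \<le> Q * max (q * M) (damping m t (norm y0))"
      unfolding Q_def
    proof (rule bound_of_scaling[OF K, where R = "M powr e"])
      show "1 \<le> q * M" using mult_mono[OF q1 M1] q1 by simp
      fix z :: "real ^ 'k" assume z: "q * M \<le> norm z"
      then have z1: "1 \<le> norm z" using mult_mono[OF q1 M1] q1 by simp
      obtain L \<theta> where L\<theta>: "0 < L" "0 < \<theta>" "1 / \<theta> \<le> norm z"
        and reg: "\<forall>x\<in>cball z (1 / (4 * \<theta>)). \<forall>w. length w \<le> N \<longrightarrow> norm (partial \<sigma> w x) \<le> K * L * \<theta> ^ length w"
        and small: "\<And>c R. 0 < c \<Longrightarrow> c \<le> 1 \<Longrightarrow> 0 \<le> R \<Longrightarrow>
          L * \<theta> * (R powr e * (c / (\<theta> * norm z powr m)) powr \<alpha>) \<le> (R / norm z) powr e"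
        using scaling[OF _ z1] asm by metis
      have "L * \<theta> * (M powr e * (step_const m / (\<theta> * norm z powr m)) powr \<alpha>) \<le> (M / norm z) powr e"
        using small step_const_bounds[OF m] M1 by simp
      also have "\<dots> \<le> (1 / q) powr e"
      proof (rule powr_mono2)
        have "0 < q * M" using q1 M1 by (intro mult_pos_pos) auto
        then have "M / norm z \<le> M / (q * M)" using z M1 by (intro frac_le) auto
        then show "M / norm z \<le> 1 / q" using M1 by simp
      qed (use e M1 z1 in auto)
      also have "\<dots> = \<epsilon>" using \<epsilon> e by (simp add: q_def powr_divide powr_powr powr_minus_divide)
      finally show "\<exists>L>0. \<exists>\<theta>>0. 1 / \<theta> \<le> norm z \<and> (\<forall>x\<in>cball z (1 / (4 * \<theta>)). regular_at K L \<theta> x)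
          \<and> L * \<theta> * (M powr e * (step_const m / (\<theta> * norm z powr m)) powr \<alpha>)
            \<le> small_const m \<alpha> (real CARD('d)) (real CARD('k)) N K"
        using L\<theta> reg unfolding regular_at_def \<epsilon>_def by blast
    qed (use t abs_X_le_seminorm[OF rough _ semi] in auto)
    also have "\<dots> \<le> Q * (q * max M (damping m t (norm y0)))"
    proof (intro mult_left_mono Q0)
      have "0 \<le> damping m t (norm y0)" by (simp add: damping_def)
      then have "1 * damping m t (norm y0) \<le> q * damping m t (norm y0)" using q1 by (intro mult_right_mono)
      moreover have "q * M \<le> q * max M (damping m t (norm y0))"
        "q * damping m t (norm y0) \<le> q * max M (damping m t (norm y0))"
        using q1 by (auto intro!: mult_left_mono)
      ultimately show "max (q * M) (damping m t (norm y0)) \<le> q * max M (damping m t (norm y0))" by auto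
    qed
    also have "max M (damping m t (norm y0)) = Max {damping m t (norm y0), MAX h \<in> trees N. ?n h, 1}"
      by (simp add: M_def max.commute)
    finally show "norm (coef {#} (Y t)) \<le> Q * q * Max {damping m t (norm y0), MAX h \<in> trees N. ?n h, 1}"
      by (simp add: y_def mult.assoc)
  qed
qed

lemma bounded_scaling:
  fixes \<sigma> :: "real ^ 'k::finite \<Rightarrow> real ^ 'd::finite ^ 'k"
  assumes m: "1 < m" and \<alpha>: "0 < \<alpha>" and \<sigma>: "bounded_coeffs N C \<sigma>" and z: "1 \<le> norm z"
  shows "\<exists>L>0. \<exists>\<theta>>0. 1 / \<theta> \<le> norm z
      \<and> (\<forall>x\<in>cball z (1 / (4 * \<theta>)). \<forall>w. length w \<le> N \<longrightarrow> norm (partial \<sigma> w x) \<le> \<bar>C\<bar> * L * \<theta> ^ length w)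
      \<and> (\<forall>c R. 0 < c \<longrightarrow> c \<le> 1 \<longrightarrow> 0 \<le> R \<longrightarrow>
          L * \<theta> * (R powr ((m - 1) * \<alpha>) * (c / (\<theta> * norm z powr m)) powr \<alpha>) \<le> (R / norm z) powr ((m - 1) * \<alpha>))"
proof (intro exI[of _ "1::real"] conjI allI impI ballI)
  fix x and w :: "'k list" assume "length w \<le> N"
  then have "norm (partial \<sigma> w x) \<le> C" using \<sigma> by (simp add: bounded_coeffs_def)
  then show "norm (partial \<sigma> w x) \<le> \<bar>C\<bar> * 1 * 1 ^ length w" by simp
next
  fix c R :: real assume cR: "0 < c" "c \<le> 1" "0 \<le> R"
  have zp: "0 < norm z" using z by linarith
  have "(c / (1 * norm z powr m)) powr \<alpha> \<le> (1 / norm z powr (m - 1)) powr \<alpha>"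
  proof (rule powr_mono2)
    \<comment> \<open>A step of order \<open>norm z powr (- m)\<close> is shorter than the exponent
      \<open>(m - 1) * \<alpha>\<close> demands, as \<open>norm z\<close> is at least 1.\<close>
    have "norm z powr (m - 1) \<le> norm z powr m" using z by (intro powr_mono) auto
    then show "c / (1 * norm z powr m) \<le> 1 / norm z powr (m - 1)"
      using cR zp by (intro frac_le) auto
  qed (use \<alpha> cR in auto)
  then have "R powr ((m - 1) * \<alpha>) * (c / (1 * norm z powr m)) powr \<alpha>
      \<le> R powr ((m - 1) * \<alpha>) * (1 / norm z powr (m - 1)) powr \<alpha>" by (intro mult_left_mono) auto
  also have "\<dots> = (R / norm z) powr ((m - 1) * \<alpha>)" by (simp add: powr_divide powr_powr)
  finally show "1 * 1 * (R powr ((m - 1) * \<alpha>) * (c / (1 * norm z powr m)) powr \<alpha>) \<le> (R / norm z) powr ((m - 1) * \<alpha>)"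
    by simp
qed (use z in auto)

text \<open>Compares the growth weight at a nearby point with that at the centre; the ratio lies
  between 1 / 2 and 3, and both signs of the exponent occur.\<close>

lemma powr_le_two_sided:
  fixes u p :: real assumes "1 / 2 \<le> u" "u \<le> 3" "- real N \<le> p" "p \<le> \<gamma>" "0 \<le> \<gamma>"
  shows "u powr p \<le> 3 powr \<gamma> + 2 ^ N"
proof (cases "0 \<le> p")
  case True
  have "u powr p \<le> 3 powr p" using assms True by (intro powr_mono2) auto
  also have "\<dots> \<le> 3 powr \<gamma>" using assms by (intro powr_mono) auto
  finally show ?thesis by (simp add: add_increasing2)
next
  case False
  have "u powr p \<le> (1 / 2) powr p" using assms False powr_mono2'[of p "1 / 2" u] by simp
  also have "\<dots> = 2 powr (- p)" by (simp add: powr_divide powr_minus_divide)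
  also have "\<dots> \<le> 2 powr real N" using assms by (intro powr_mono) auto
  finally show ?thesis by (simp add: powr_realpow add_increasing)
qed

text \<open>In a ball of radius a quarter of \<open>norm z\<close> the growth weight is comparable
  to \<open>norm z\<close>, so \<sigma> has size \<open>norm z powr \<gamma>\<close> there and each
  derivative costs one factor \<open>1 / norm z\<close>.\<close>

lemma poly_growth_scaling:
  fixes \<sigma> :: "real ^ 'k::finite \<Rightarrow> real ^ 'd::finite ^ 'k"
  assumes m: "1 < m" and \<alpha>: "0 < \<alpha>" and \<gamma>: "1 \<le> \<gamma>" and \<sigma>: "poly_growth_coeffs N \<gamma> C \<sigma>" and z: "1 \<le> norm z"
  defines "e \<equiv> (m - 1) * \<alpha> - \<gamma> + 1"
  shows "\<exists>L>0. \<exists>\<theta>>0. 1 / \<theta> \<le> norm z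
      \<and> (\<forall>x\<in>cball z (1 / (4 * \<theta>)). \<forall>w. length w \<le> N \<longrightarrow>
          norm (partial \<sigma> w x) \<le> \<bar>C\<bar> * (3 powr \<gamma> + 2 ^ N) * L * \<theta> ^ length w)
      \<and> (\<forall>c R. 0 < c \<longrightarrow> c \<le> 1 \<longrightarrow> 0 \<le> R \<longrightarrow>
          L * \<theta> * (R powr e * (c / (\<theta> * norm z powr m)) powr \<alpha>) \<le> (R / norm z) powr e)"
proof (rule exI[of _ "norm z powr \<gamma>"], intro exI[of _ "1 / norm z"] conjI allI impI ballI)
  let ?v = "norm z"
  have v: "0 < ?v" using z by linarith
  show "0 < ?v powr \<gamma>" "0 < 1 / ?v" "1 / (1 / ?v) \<le> ?v" using v by auto
  fix x and w :: "'k list" assume x: "x \<in> cball z (1 / (4 * (1 / ?v)))" and w: "length w \<le> N"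
  have d: "norm (x - z) \<le> ?v / 4" using x by (simp add: dist_norm norm_minus_commute)
  have lo: "?v / 2 \<le> norm x" and hi: "norm x \<le> 2 * ?v"
    using d norm_triangle_ineq2[of z x] norm_triangle_ineq2[of x z] v by (simp_all add: norm_minus_commute)
  let ?r = "sqrt (1 + (norm x)\<^sup>2)"
  have "?v / 2 \<le> ?r" using lo real_sqrt_le_mono[of "(norm x)\<^sup>2" "1 + (norm x)\<^sup>2"] by simp
  moreover have "?r \<le> 3 * ?v"
  proof (rule real_le_lsqrt)
    have "(norm x)\<^sup>2 \<le> (2 * ?v)\<^sup>2" using hi by (intro power_mono) auto
    moreover have "1 \<le> ?v\<^sup>2" using z by (simp add: one_le_power)
    ultimately show "1 + (norm x)\<^sup>2 \<le> (3 * ?v)\<^sup>2" by (simp add: power_mult_distrib)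
  qed (use v in auto)
  ultimately have "(?r / ?v) powr (\<gamma> - real (length w)) \<le> 3 powr \<gamma> + 2 ^ N"
    using v w \<gamma> by (intro powr_le_two_sided) (auto simp: field_simps)
  then have "(?r / ?v) powr (\<gamma> - real (length w)) * ?v powr (\<gamma> - real (length w))
      \<le> (3 powr \<gamma> + 2 ^ N) * ?v powr (\<gamma> - real (length w))" by (intro mult_right_mono) auto
  moreover have "(?r / ?v) powr (\<gamma> - real (length w)) * ?v powr (\<gamma> - real (length w)) = ?r powr (\<gamma> - real (length w))"
    using v by (simp flip: powr_mult)
  ultimately have "?r powr (\<gamma> - real (length w)) \<le> (3 powr \<gamma> + 2 ^ N) * (?v powr \<gamma> * (1 / ?v) ^ length w)"
    using v by (simp add: powr_diff powr_realpow power_divide)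
  then have "\<bar>C\<bar> * ?r powr (\<gamma> - real (length w)) \<le> \<bar>C\<bar> * ((3 powr \<gamma> + 2 ^ N) * (?v powr \<gamma> * (1 / ?v) ^ length w))"
    by (intro mult_left_mono) auto
  moreover have "norm (partial \<sigma> w x) \<le> C * ?r powr (\<gamma> - real (length w))"
    using \<sigma> w by (simp add: poly_growth_coeffs_def)
  moreover have "C * ?r powr (\<gamma> - real (length w)) \<le> \<bar>C\<bar> * ?r powr (\<gamma> - real (length w))"
    by (intro mult_right_mono) auto
  ultimately show "norm (partial \<sigma> w x) \<le> \<bar>C\<bar> * (3 powr \<gamma> + 2 ^ N) * ?v powr \<gamma> * (1 / ?v) ^ length w"
    by (simp add: mult_ac)
next
  let ?v = "norm z"
  fix c R :: real assume cR: "0 < c" "c \<le> 1" "0 \<le> R"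
  have v: "0 < ?v" using z by linarith
  have "(c / (1 / ?v * ?v powr m)) powr \<alpha> \<le> (1 / (1 / ?v * ?v powr m)) powr \<alpha>"
    using cR v \<alpha> by (intro powr_mono2 divide_right_mono) auto
  also have "1 / (1 / ?v * ?v powr m) = ?v powr (1 - m)" using v by (simp add: powr_diff)
  finally have "?v powr \<gamma> * (1 / ?v) * (R powr e * (c / (1 / ?v * ?v powr m)) powr \<alpha>)
      \<le> ?v powr \<gamma> * (1 / ?v) * (R powr e * (?v powr (1 - m)) powr \<alpha>)"
    using v by (intro mult_left_mono) auto
  also have "\<dots> = R powr e * (?v powr (\<gamma> - 1) * ?v powr ((1 - m) * \<alpha>))"
  proof -
    have "(?v powr (1 - m)) powr \<alpha> = ?v powr ((1 - m) * \<alpha>)" by (rule powr_powr)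
    moreover have "?v powr \<gamma> * (1 / ?v) = ?v powr (\<gamma> - 1)" using v by (simp add: powr_diff)
    ultimately show ?thesis by (simp only: mult_ac)
  qed
  \<comment> \<open>Here the exponent \<open>e\<close> arises: \<gamma> - 1 comes from the two
    scales and (1 - m) \<alpha> from the length of the step.\<close>
  also have "?v powr (\<gamma> - 1) * ?v powr ((1 - m) * \<alpha>) = ?v powr (- e)"
    by (simp add: e_def algebra_simps flip: powr_add)
  also have "R powr e * ?v powr (- e) = (R / ?v) powr e"
    by (simp add: powr_divide powr_minus_divide)
  finally show "?v powr \<gamma> * (1 / ?v) * (R powr e * (c / (1 / ?v * ?v powr m)) powr \<alpha>) \<le> (R / ?v) powr e" .
qed

theorem corollary1p6:
  fixes m \<alpha> C\<^sub>\<sigma> :: real and N :: nat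
  assumes "1 < m" and "0 < \<alpha>" and "\<alpha> < 1"
    and "real N * \<alpha> \<le> 1" and "1 < (real N + 1) * \<alpha>"
  shows "(\<exists>C. \<forall>(X :: 'd::finite rough_map) (\<sigma> :: real ^ 'k::finite \<Rightarrow> real ^ 'd ^ 'k)
              (y0 :: real ^ 'k) (Y :: ('d, 'k) fpath).
            rough_path \<alpha> N X \<and> C_class N \<sigma> \<and> bounded_coeffs N C\<^sub>\<sigma> \<sigma> \<and>
            is_solution m \<alpha> N X \<sigma> y0 Y \<longrightarrow>
            (\<forall>t \<in> {0..1}. norm (coef {#} (Y t)) \<le>
               C * Max {damping m t (norm y0),
                        MAX h \<in> trees N. rp_seminorm \<alpha> X {#h#}
                          powr (1 / ((m - 1) * \<alpha> * real (tree_size h))),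
                        1}))
       \<and> (\<forall>\<gamma>. 1 \<le> \<gamma> \<and> \<gamma> < (m - 1) * \<alpha> + 1 \<longrightarrow>
         (\<exists>C. \<forall>(X :: 'd::finite rough_map) (\<sigma> :: real ^ 'k::finite \<Rightarrow> real ^ 'd ^ 'k)
              (y0 :: real ^ 'k) (Y :: ('d, 'k) fpath).
            rough_path \<alpha> N X \<and> C_class N \<sigma> \<and> poly_growth_coeffs N \<gamma> C\<^sub>\<sigma> \<sigma> \<and>
            is_solution m \<alpha> N X \<sigma> y0 Y \<longrightarrow>
            (\<forall>t \<in> {0..1}. norm (coef {#} (Y t)) \<le>
               C * Max {damping m t (norm y0),
                        MAX h \<in> trees N. rp_seminorm \<alpha> X {#h#}
                          powr (1 / (((m - 1) * \<alpha> - \<gamma> + 1) * real (tree_size h))),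
                        1})))"
  (is "?A \<and> (\<forall>\<gamma>. _ \<longrightarrow> ?B \<gamma>)")
proof (intro conjI allI impI)
  \<comment> \<open>For \<open>N = 0\<close> the last hypothesis would read 1 < \<alpha>.\<close>
  have N: "0 < N" using assms by (cases N) auto
  show ?A
    using assms N by (intro uniform_bound[where K = "\<bar>C\<^sub>\<sigma>\<bar>"] bounded_scaling) auto
  fix \<gamma> assume "1 \<le> \<gamma> \<and> \<gamma> < (m - 1) * \<alpha> + 1"
  \<comment> \<open>The upper bound on \<gamma> makes the exponent positive; the absolute value
    keeps the constant nonnegative whatever the sign of \<open>C\<^sub>\<sigma>\<close>.\<close>
  then show "?B \<gamma>"
    using assms N by (intro uniform_bound[where K = "\<bar>C\<^sub>\<sigma>\<bar> * (3 powr \<gamma> + 2 ^ N)"] poly_growth_scaling) auto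
qed

end
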